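(* Let $n\ge 2$. For any $\mathbf{H}(S_n)$-module $M$ the assignments $V\mapsto F_M(V):=M\otimes V$ define a family of endo-functors on the category $H_q(S_n)\text{-}Mod$ of $H_q(S_n)$-modules, so that $F_{M\otimes N}=F_M\circ F_N$ for all $\mathbf{H}(S_n)$-modules $M,N$.
   Context: For $n\ge 2$, $\mathbf{H}(S_n)$ denotes the (unital associative) $\mathbb{Z}$-algebra generated by $s_i$ and $D_i$, $i=1,\ldots,n-1$, subject to the relations: (1) $s_i^2=1$, $s_iD_i+D_is_i=s_i-1$, $D_i^2=D_i$ for $i=1,\ldots,n-1$; (2) $s_js_i=s_is_j$, $D_js_i=s_iD_j$, $D_jD_i=D_iD_j$ if $|i-j|>1$; (3) $s_js_is_j=s_is_js_i$, $D_is_js_i=s_js_iD_j$, $D_js_iD_j=s_iD_jD_i+D_iD_js_i+s_iD_js_i$ if $|i-j|=1$. It is a Hopf algebra with $\Delta(s_i)=s_i\otimes s_i$, $\Delta(D_i)=D_i\otimes 1+s_i\otimes D_i$, $\varepsilon(s_i)=1$, $\varepsilon(D_i)=0$, $S(s_i)=s_i$, $S(D_i)=-s_iD_i$; the tensor product $M\otimes N$ (over $\mathbb{Z}$) of $\mathbf{H}(S_n)$-modules is an $\mathbf{H}(S_n)$-module via $\Delta$. The Hecke algebra $H_q(S_n)$ is the algebra generated over $\mathbb{Z}[q,q^{-1}]$ by $T_1,\ldots,T_{n-1}$ subject to the braid relations $T_iT_jT_i=T_jT_iT_j$ if $|i-j|=1$ and $T_iT_j=T_jT_i$ if $|i-j|>1$,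 and the quadratic relations $T_i^2=(1-q)T_i+q$. For an $\mathbf{H}(S_n)$-module $M$ and an $H_q(S_n)$-module $V$, the $H_q(S_n)$-action on $M\otimes V$ (tensor product over $\mathbb{Z}$) is obtained via the algebra homomorphism $H_q(S_n)\to\mathbf{H}(S_n)\otimes H_q(S_n)$, $T_i\mapsto s_i\otimes T_i+D_i\otimes(1-q)$, $i=1,\ldots,n-1$ (a coassociative and counital left coaction). The equality $F_{M\otimes N}=F_M\circ F_N$ is understood under the canonical identification $(M\otimes N)\otimes V=M\otimes(N\otimes V)$. *)

theory Defs
  imports
    "HOL-Algebra.Module"
    "HOL-Algebra.QuotRing"
    "HOL-Algebra.Free_Abelian_Groups"
    "HOL-Library.Poly_Mapping"
    "HOL-Library.Infinite_Typeclass"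
begin

section \<open>Algebras given by generators and relations\<close>

text \<open>
  The free monoid on \<open>'x\<close>, written additively so that \<open>'x free_word \<Rightarrow>\<^sub>0 'k\<close> with the
  convolution product of \<^theory>\<open>HOL-Library.Poly_Mapping\<close> is the free (noncommutative) algebra.
\<close>

datatype 'x free_word = Word (letters: "'x list")

instantiation free_word :: (type) monoid_add
begin

definition zero_free_word :: "'a free_word" where
  "0 = Word []"

definition plus_free_word :: "'a free_word \<Rightarrow> 'a free_word \<Rightarrow> 'a free_word" where
  "u + v = Word (letters u @ letters v)"

instance
  by standard (simp_all add: zero_free_word_def plus_free_word_def)

end

definition free_algebra :: "'x set \<Rightarrow> ('x free_word \<Rightarrow>\<^sub>0 'k::comm_ring_1) ring" where
  "free_algebra A = \<lparr>carrier = {f. \<forall>w \<in> Poly_Mapping.keys f. set (letters w) \<subseteq> A},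
     monoid.mult = (*), monoid.one = 1, ring.zero = 0, add = (+)\<rparr>"

definition gen :: "'x \<Rightarrow> ('x free_word \<Rightarrow>\<^sub>0 'k::comm_ring_1)" where
  "gen x = Poly_Mapping.single (Word [x]) 1"

definition scalar :: "'k::comm_ring_1 \<Rightarrow> ('x free_word \<Rightarrow>\<^sub>0 'k)" where
  "scalar c = Poly_Mapping.single 0 c"

text \<open>A relation \<open>l = r\<close> is encoded by the element \<open>l - r\<close>.\<close>

definition presented_algebra ::
    "'x set \<Rightarrow> ('x free_word \<Rightarrow>\<^sub>0 'k::comm_ring_1) set \<Rightarrow> ('x free_word \<Rightarrow>\<^sub>0 'k) set ring" where
  "presented_algebra A rels = free_algebra A Quot (Idl\<^bsub>free_algebra A\<^esub> rels)"

definition presented_class ::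
    "'x set \<Rightarrow> ('x free_word \<Rightarrow>\<^sub>0 'k::comm_ring_1) set \<Rightarrow> ('x free_word \<Rightarrow>\<^sub>0 'k)
      \<Rightarrow> ('x free_word \<Rightarrow>\<^sub>0 'k) set" where
  "presented_class A rels a = (Idl\<^bsub>free_algebra A\<^esub> rels) +>\<^bsub>free_algebra A\<^esub> a"


section \<open>The algebra H(S_n)\<close>

datatype hs_gen = SGen nat | DGen nat

type_synonym hs = "(hs_gen free_word \<Rightarrow>\<^sub>0 int) set"

definition far :: "nat \<Rightarrow> nat \<Rightarrow> bool" where
  "far i j \<longleftrightarrow> \<bar>int i - int j\<bar> > 1"

definition adjacent :: "nat \<Rightarrow> nat \<Rightarrow> bool" where
  "adjacent i j \<longleftrightarrow> \<bar>int i - int j\<bar> = 1"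

definition HS_gens :: "nat \<Rightarrow> hs_gen set" where
  "HS_gens n = SGen ` {1..n-1} \<union> DGen ` {1..n-1}"

definition HS_rels :: "nat \<Rightarrow> (hs_gen free_word \<Rightarrow>\<^sub>0 int) set" where
  "HS_rels n = (let s = (\<lambda>i. gen (SGen i)); D = (\<lambda>i. gen (DGen i)); I = {1..n-1} in
      (\<Union>i\<in>I. {s i * s i - 1,
               (s i * D i + D i * s i) - (s i - 1),
               D i * D i - D i})
    \<union> (\<Union>i\<in>I. \<Union>j\<in>{j\<in>I. far i j}.
              {s j * s i - s i * s j,
               D j * s i - s i * D j,
               D j * D i - D i * D j})
    \<union> (\<Union>i\<in>I. \<Union>j\<in>{j\<in>I. adjacent i j}.
              {s j * s i * s j - s i * s j * s i,
               D i * s j * s i - s j * s i * D j,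
               D j * s i * D j - (s i * D j * D i + D i * D j * s i + s i * D j * s i)}))"

definition HS :: "nat \<Rightarrow> hs ring" where
  "HS n = presented_algebra (HS_gens n) (HS_rels n)"

definition HS_s :: "nat \<Rightarrow> nat \<Rightarrow> hs" where
  "HS_s n i = presented_class (HS_gens n) (HS_rels n) (gen (SGen i))"

definition HS_D :: "nat \<Rightarrow> nat \<Rightarrow> hs" where
  "HS_D n i = presented_class (HS_gens n) (HS_rels n) (gen (DGen i))"


section \<open>The Hecke algebra\<close>

text \<open>Laurent polynomials are the group ring of the integers.\<close>

type_synonym laurent = "int \<Rightarrow>\<^sub>0 int"

definition q_var :: laurent where
  "q_var = Poly_Mapping.single 1 1"

type_synonym hecke = "(nat free_word \<Rightarrow>\<^sub>0 laurent) set"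

definition Hq_rels :: "nat \<Rightarrow> (nat free_word \<Rightarrow>\<^sub>0 laurent) set" where
  "Hq_rels n = (let T = gen; I = {1..n-1} in
      (\<Union>i\<in>I. \<Union>j\<in>{j\<in>I. adjacent i j}. {T i * T j * T i - T j * T i * T j})
    \<union> (\<Union>i\<in>I. \<Union>j\<in>{j\<in>I. far i j}. {T i * T j - T j * T i})
    \<union> (\<Union>i\<in>I. {T i * T i - (scalar (1 - q_var) * T i + scalar q_var)}))"

definition Hq :: "nat \<Rightarrow> hecke ring" where
  "Hq n = presented_algebra {1..n-1} (Hq_rels n)"

definition Hq_T :: "nat \<Rightarrow> nat \<Rightarrow> hecke" where
  "Hq_T n i = presented_class {1..n-1} (Hq_rels n) (gen i)"

definition Hq_scalar :: "nat \<Rightarrow> laurent \<Rightarrow> hecke" where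
  "Hq_scalar n c = presented_class {1..n-1} (Hq_rels n) (scalar c)"


section \<open>Left modules\<close>

text \<open>
  The library locale \<^locale>\<open>module\<close> requires a commutative ring of scalars, so the axioms are
  repeated here over an arbitrary ring.  As in the library, the fields \<open>mult\<close> and \<open>one\<close> of a
  module record carry no information.
\<close>

locale left_module = R: ring R + M: abelian_group M
  for R :: "('r, 'c) ring_scheme" (structure) and M :: "('r, 'm, 'd) module_scheme" (structure) +
  assumes smult_closed:
      "\<lbrakk>a \<in> carrier R; x \<in> carrier M\<rbrakk> \<Longrightarrow> a \<odot>\<^bsub>M\<^esub> x \<in> carrier M"
    and smult_l_distr:
      "\<lbrakk>a \<in> carrier R; b \<in> carrier R; x \<in> carrier M\<rbrakk> \<Longrightarrow>
        (a \<oplus>\<^bsub>R\<^esub> b) \<odot>\<^bsub>M\<^esub> x = a \<odot>\<^bsub>M\<^esub> x \<oplus>\<^bsub>M\<^esub> b \<odot>\<^bsub>M\<^esub> x"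
    and smult_r_distr:
      "\<lbrakk>a \<in> carrier R; x \<in> carrier M; y \<in> carrier M\<rbrakk> \<Longrightarrow>
        a \<odot>\<^bsub>M\<^esub> (x \<oplus>\<^bsub>M\<^esub> y) = a \<odot>\<^bsub>M\<^esub> x \<oplus>\<^bsub>M\<^esub> a \<odot>\<^bsub>M\<^esub> y"
    and smult_assoc:
      "\<lbrakk>a \<in> carrier R; b \<in> carrier R; x \<in> carrier M\<rbrakk> \<Longrightarrow>
        (a \<otimes>\<^bsub>R\<^esub> b) \<odot>\<^bsub>M\<^esub> x = a \<odot>\<^bsub>M\<^esub> (b \<odot>\<^bsub>M\<^esub> x)"
    and smult_one:
      "x \<in> carrier M \<Longrightarrow> \<one>\<^bsub>R\<^esub> \<odot>\<^bsub>M\<^esub> x = x"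

definition module_homs ::
    "'r ring \<Rightarrow> ('r, 'm) module \<Rightarrow> ('r, 'n) module \<Rightarrow> ('m \<Rightarrow> 'n) set" where
  "module_homs R M N = {f \<in> carrier M \<rightarrow>\<^sub>E carrier N.
     (\<forall>x\<in>carrier M. \<forall>y\<in>carrier M. f (x \<oplus>\<^bsub>M\<^esub> y) = f x \<oplus>\<^bsub>N\<^esub> f y) \<and>
     (\<forall>a\<in>carrier R. \<forall>x\<in>carrier M. f (a \<odot>\<^bsub>M\<^esub> x) = a \<odot>\<^bsub>N\<^esub> f x)}"

definition restrict_scalars :: "('r \<Rightarrow> 't) \<Rightarrow> ('t, 'm) module \<Rightarrow> ('r, 'm) module" where
  "restrict_scalars \<phi> M = \<lparr>carrier = carrier M, monoid.mult = undefined, monoid.one = undefined,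
     ring.zero = \<zero>\<^bsub>M\<^esub>, add = add M, smult = (\<lambda>a x. \<phi> a \<odot>\<^bsub>M\<^esub> x)\<rparr>"

text \<open>Transport of structure along a map \<open>g\<close> that is injective on the carrier.\<close>

definition transport :: "('m \<Rightarrow> 'u) \<Rightarrow> ('r, 'm) module \<Rightarrow> ('r, 'u) module" where
  "transport g M = (let h = inv_into (carrier M) g in
     \<lparr>carrier = g ` carrier M, monoid.mult = undefined, monoid.one = undefined,
      ring.zero = g \<zero>\<^bsub>M\<^esub>, add = (\<lambda>x y. g (h x \<oplus>\<^bsub>M\<^esub> h y)), smult = (\<lambda>a x. g (a \<odot>\<^bsub>M\<^esub> h x))\<rparr>)"


section \<open>Tensor products over the integers\<close>

definition tensor_rels ::
    "('a, 'c) ring_scheme \<Rightarrow> ('b, 'd) ring_scheme \<Rightarrow> ('a \<times> 'b \<Rightarrow>\<^sub>0 int) set" where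
  "tensor_rels M N =
     {frag_of (x \<oplus>\<^bsub>M\<^esub> x', y) - frag_of (x, y) - frag_of (x', y) | x x' y.
        x \<in> carrier M \<and> x' \<in> carrier M \<and> y \<in> carrier N}
   \<union> {frag_of (x, y \<oplus>\<^bsub>N\<^esub> y') - frag_of (x, y) - frag_of (x, y') | x y y'.
        x \<in> carrier M \<and> y \<in> carrier N \<and> y' \<in> carrier N}"

definition tensor_kernel ::
    "('a, 'c) ring_scheme \<Rightarrow> ('b, 'd) ring_scheme \<Rightarrow> ('a \<times> 'b \<Rightarrow>\<^sub>0 int) set" where
  "tensor_kernel M N =
     generate (free_Abelian_group (carrier M \<times> carrier N)) (tensor_rels M N)"

text \<open>The tensor product of the additive groups of \<open>M\<close> and \<open>N\<close>, written multiplicatively.\<close>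

definition tensor_group ::
    "('a, 'c) ring_scheme \<Rightarrow> ('b, 'd) ring_scheme \<Rightarrow> ('a \<times> 'b \<Rightarrow>\<^sub>0 int) set monoid" where
  "tensor_group M N = free_Abelian_group (carrier M \<times> carrier N) Mod tensor_kernel M N"

definition pure ::
    "('a, 'c) ring_scheme \<Rightarrow> ('b, 'd) ring_scheme \<Rightarrow> 'a \<Rightarrow> 'b \<Rightarrow> ('a \<times> 'b \<Rightarrow>\<^sub>0 int) set" where
  "pure M N x y =
     tensor_kernel M N #>\<^bsub>free_Abelian_group (carrier M \<times> carrier N)\<^esub> frag_of (x, y)"

text \<open>The homomorphism out of the tensor product induced by a biadditive map \<open>f\<close>.\<close>

definition tensor_lift ::
    "('a, 'c) ring_scheme \<Rightarrow> ('b, 'd) ring_scheme \<Rightarrow> ('g, 'e) monoid_scheme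
      \<Rightarrow> ('a \<Rightarrow> 'b \<Rightarrow> 'g) \<Rightarrow> ('a \<times> 'b \<Rightarrow>\<^sub>0 int) set \<Rightarrow> 'g" where
  "tensor_lift M N G f = (THE h.
     h \<in> hom (tensor_group M N) G \<inter> extensional (carrier (tensor_group M N)) \<and>
     (\<forall>x\<in>carrier M. \<forall>y\<in>carrier N. h (pure M N x y) = f x y))"

text \<open>Multiplication is determined by \<open>(a \<otimes> b)(c \<otimes> d) = ac \<otimes> bd\<close>.\<close>

definition tensor_ring ::
    "('a, 'c) ring_scheme \<Rightarrow> ('b, 'd) ring_scheme \<Rightarrow> ('a \<times> 'b \<Rightarrow>\<^sub>0 int) set ring" where
  "tensor_ring A B = (let G = tensor_group A B in
     \<lparr>carrier = carrier G,
      monoid.mult = (\<lambda>t u. tensor_lift A B G (\<lambda>a b.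
                tensor_lift A B G (\<lambda>c d. pure A B (a \<otimes>\<^bsub>A\<^esub> c) (b \<otimes>\<^bsub>B\<^esub> d)) u) t),
      monoid.one = pure A B \<one>\<^bsub>A\<^esub> \<one>\<^bsub>B\<^esub>,
      ring.zero = \<one>\<^bsub>G\<^esub>,
      add = monoid.mult G\<rparr>)"

text \<open>
  \<open>M \<otimes> N\<close> as a module over \<open>A \<otimes> B\<close>; the action is determined by
  \<open>(a \<otimes> b)(x \<otimes> y) = ax \<otimes> by\<close>.
\<close>

definition tensor_module ::
    "'a ring \<Rightarrow> 'b ring \<Rightarrow> ('a, 'm) module \<Rightarrow> ('b, 'n) module
      \<Rightarrow> (('a \<times> 'b \<Rightarrow>\<^sub>0 int) set, ('m \<times> 'n \<Rightarrow>\<^sub>0 int) set) module" where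
  "tensor_module A B M N = (let G = tensor_group M N in
     \<lparr>carrier = carrier G, monoid.mult = undefined, monoid.one = undefined,
      ring.zero = \<one>\<^bsub>G\<^esub>,
      add = monoid.mult G,
      smult = (\<lambda>t z. tensor_lift A B G (\<lambda>a b.
                 tensor_lift M N G (\<lambda>x y. pure M N (a \<odot>\<^bsub>M\<^esub> x) (b \<odot>\<^bsub>N\<^esub> y)) z) t)\<rparr>)"

text \<open>
  To have one category of modules that is closed under tensor products, carriers are taken inside
  a fixed infinite type \<open>'u\<close> (that is, modules of cardinality at most that of \<open>'u\<close>).  The carrier
  of the tensor product of two such modules injects into \<open>'u\<close>, and the tensor product is replaced
  by its isomorphic copy along a chosen injection.
\<close>

definition tensor_code ::
    "('u::infinite, 'c) ring_scheme \<Rightarrow> ('u, 'd) ring_scheme \<Rightarrow> ('u \<times> 'u \<Rightarrow>\<^sub>0 int) set \<Rightarrow> 'u" where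
  "tensor_code M N = (SOME g. inj_on g (carrier (tensor_group M N)))"

definition tensor_elt ::
    "('u::infinite, 'c) ring_scheme \<Rightarrow> ('u, 'd) ring_scheme \<Rightarrow> 'u \<Rightarrow> 'u \<Rightarrow> 'u" where
  "tensor_elt M N x y = tensor_code M N (pure M N x y)"

definition tensor_copy ::
    "'a ring \<Rightarrow> 'b ring \<Rightarrow> ('a, 'u::infinite) module \<Rightarrow> ('b, 'u) module
      \<Rightarrow> (('a \<times> 'b \<Rightarrow>\<^sub>0 int) set, 'u) module" where
  "tensor_copy A B M N = transport (tensor_code M N) (tensor_module A B M N)"


section \<open>Comultiplication and coaction\<close>

definition HS_comult :: "nat \<Rightarrow> hs \<Rightarrow> (hs \<times> hs \<Rightarrow>\<^sub>0 int) set" where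
  "HS_comult n = (let H = HS n; H2 = tensor_ring H H in
     THE \<Delta>. \<Delta> \<in> ring_hom H H2 \<inter> extensional (carrier H) \<and>
       (\<forall>i\<in>{1..n-1}.
          \<Delta> (HS_s n i) = pure H H (HS_s n i) (HS_s n i) \<and>
          \<Delta> (HS_D n i) = pure H H (HS_D n i) \<one>\<^bsub>H\<^esub> \<oplus>\<^bsub>H2\<^esub> pure H H (HS_s n i) (HS_D n i)))"

text \<open>
  The coaction is linear over the Laurent polynomials, which act on \<open>H(S_n) \<otimes> H_q(S_n)\<close> through
  the second factor.
\<close>

definition Hq_coaction :: "nat \<Rightarrow> hecke \<Rightarrow> (hs \<times> hecke \<Rightarrow>\<^sub>0 int) set" where
  "Hq_coaction n = (let H = HS n; K = Hq n; HK = tensor_ring H K in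
     THE \<delta>. \<delta> \<in> ring_hom K HK \<inter> extensional (carrier K) \<and>
       (\<forall>c. \<delta> (Hq_scalar n c) = pure H K \<one>\<^bsub>H\<^esub> (Hq_scalar n c)) \<and>
       (\<forall>i\<in>{1..n-1}.
          \<delta> (Hq_T n i) = pure H K (HS_s n i) (Hq_T n i)
                      \<oplus>\<^bsub>HK\<^esub> pure H K (HS_D n i) (Hq_scalar n (1 - q_var))))"

definition HS_tensor ::
    "nat \<Rightarrow> (hs, 'u::infinite) module \<Rightarrow> (hs, 'u) module \<Rightarrow> (hs, 'u) module" where
  "HS_tensor n M N = restrict_scalars (HS_comult n) (tensor_copy (HS n) (HS n) M N)"

definition Hq_tensor ::
    "nat \<Rightarrow> (hs, 'u::infinite) module \<Rightarrow> (hecke, 'u) module \<Rightarrow> (hecke, 'u) module" where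
  "Hq_tensor n M V = restrict_scalars (Hq_coaction n) (tensor_copy (HS n) (Hq n) M V)"


section \<open>Categories and endofunctors\<close>

record ('o, 'a) cat =
  Obj :: "'o set"
  Hom :: "'o \<Rightarrow> 'o \<Rightarrow> 'a set"
  Id :: "'o \<Rightarrow> 'a"
  Comp :: "'o \<Rightarrow> 'o \<Rightarrow> 'o \<Rightarrow> 'a \<Rightarrow> 'a \<Rightarrow> 'a"
    \<comment> \<open>\<open>Comp C X Y Z g f\<close> is the composite of \<open>f : X \<rightarrow> Y\<close> and \<open>g : Y \<rightarrow> Z\<close>\<close>

locale category =
  fixes C :: "('o, 'a) cat"
  assumes Id_in: "X \<in> Obj C \<Longrightarrow> Id C X \<in> Hom C X X"
    and Comp_in:
      "\<lbrakk>X \<in> Obj C; Y \<in> Obj C; Z \<in> Obj C; f \<in> Hom C X Y; g \<in> Hom C Y Z\<rbrakk>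
        \<Longrightarrow> Comp C X Y Z g f \<in> Hom C X Z"
    and Id_left:
      "\<lbrakk>X \<in> Obj C; Y \<in> Obj C; f \<in> Hom C X Y\<rbrakk> \<Longrightarrow> Comp C X Y Y (Id C Y) f = f"
    and Id_right:
      "\<lbrakk>X \<in> Obj C; Y \<in> Obj C; f \<in> Hom C X Y\<rbrakk> \<Longrightarrow> Comp C X X Y f (Id C X) = f"
    and Comp_assoc:
      "\<lbrakk>W \<in> Obj C; X \<in> Obj C; Y \<in> Obj C; Z \<in> Obj C;
        f \<in> Hom C W X; g \<in> Hom C X Y; h \<in> Hom C Y Z\<rbrakk>
        \<Longrightarrow> Comp C W Y Z h (Comp C W X Y g f) = Comp C W X Z (Comp C X Y Z h g) f"

record ('o, 'a) endo =
  omap :: "'o \<Rightarrow> 'o"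
  amap :: "'o \<Rightarrow> 'o \<Rightarrow> 'a \<Rightarrow> 'a"

locale endofunctor = category C for C :: "('o, 'a) cat" +
  fixes F :: "('o, 'a) endo"
  assumes omap_in: "X \<in> Obj C \<Longrightarrow> omap F X \<in> Obj C"
    and amap_in:
      "\<lbrakk>X \<in> Obj C; Y \<in> Obj C; f \<in> Hom C X Y\<rbrakk> \<Longrightarrow> amap F X Y f \<in> Hom C (omap F X) (omap F Y)"
    and amap_Id:
      "X \<in> Obj C \<Longrightarrow> amap F X X (Id C X) = Id C (omap F X)"
    and amap_Comp:
      "\<lbrakk>X \<in> Obj C; Y \<in> Obj C; Z \<in> Obj C; f \<in> Hom C X Y; g \<in> Hom C Y Z\<rbrakk>
        \<Longrightarrow> amap F X Z (Comp C X Y Z g f)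
          = Comp C (omap F X) (omap F Y) (omap F Z) (amap F Y Z g) (amap F X Y f)"

definition endo_comp :: "('o, 'a) endo \<Rightarrow> ('o, 'a) endo \<Rightarrow> ('o, 'a) endo" where
  "endo_comp F G = \<lparr>omap = (\<lambda>X. omap F (omap G X)),
     amap = (\<lambda>X Y f. amap F (omap G X) (omap G Y) (amap G X Y f))\<rparr>"

locale natural_isomorphism =
  F: endofunctor C F + G: endofunctor C G for C :: "('o, 'a) cat" and F G +
  fixes \<eta> :: "'o \<Rightarrow> 'a"
  assumes component_in: "X \<in> Obj C \<Longrightarrow> \<eta> X \<in> Hom C (omap F X) (omap G X)"
    and component_iso:
      "X \<in> Obj C \<Longrightarrow> \<exists>\<theta> \<in> Hom C (omap G X) (omap F X).
         Comp C (omap F X) (omap G X) (omap F X) \<theta> (\<eta> X) = Id C (omap F X) \<and>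
         Comp C (omap G X) (omap F X) (omap G X) (\<eta> X) \<theta> = Id C (omap G X)"
    and naturality:
      "\<lbrakk>X \<in> Obj C; Y \<in> Obj C; f \<in> Hom C X Y\<rbrakk> \<Longrightarrow>
         Comp C (omap F X) (omap G X) (omap G Y) (amap G X Y f) (\<eta> X)
         = Comp C (omap F X) (omap F Y) (omap G Y) (\<eta> Y) (amap F X Y f)"

definition Mod_cat :: "'r ring \<Rightarrow> (('r, 'u) module, 'u \<Rightarrow> 'u) cat" where
  "Mod_cat R = \<lparr>Obj = {V. left_module R V},
     Hom = module_homs R,
     Id = (\<lambda>V. \<lambda>x\<in>carrier V. x),
     Comp = (\<lambda>U V W g f. compose (carrier U) g f)\<rparr>"

text \<open>On morphisms, \<open>F_M(f) = id \<otimes> f\<close>.\<close>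

definition F_mor ::
    "nat \<Rightarrow> (hs, 'u::infinite) module \<Rightarrow> (hecke, 'u) module \<Rightarrow> (hecke, 'u) module
      \<Rightarrow> ('u \<Rightarrow> 'u) \<Rightarrow> 'u \<Rightarrow> 'u" where
  "F_mor n M V W f = (THE h.
     h \<in> hom (add_monoid (Hq_tensor n M V)) (add_monoid (Hq_tensor n M W))
         \<inter> extensional (carrier (Hq_tensor n M V)) \<and>
     (\<forall>m\<in>carrier M. \<forall>v\<in>carrier V. h (tensor_elt M V m v) = tensor_elt M W m (f v)))"

definition F_endo ::
    "nat \<Rightarrow> (hs, 'u::infinite) module \<Rightarrow> ((hecke, 'u) module, 'u \<Rightarrow> 'u) endo" where
  "F_endo n M = \<lparr>omap = Hq_tensor n M, amap = F_mor n M\<rparr>"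

end

theory Submission
  imports Defs
begin

text \<open>
  Both structure maps exist because the images of the generators satisfy the defining relations in
  the tensor product of rings.  With \<open>c = 1 - q\<close>, the braid relation for \<open>s\<^sub>i \<otimes> T\<^sub>i + D\<^sub>i \<otimes> c\<close>
  compares coefficients of the powers of \<open>c\<close>: the relation for \<open>D\<^sub>j s\<^sub>i D\<^sub>j\<close> is exactly the
  coefficient of \<open>c\<^sup>2 T\<^sub>i\<close>, and the coefficient of \<open>c\<^sup>3\<close> needs the braid relation for the
  \<open>D\<^sub>i\<close>, a consequence of the other relations.  An additive map that commutes with the scalars and
  the generators \<open>T\<^sub>i\<close> is linear over the Hecke algebra; on pure tensors the associativity
  isomorphism commutes with \<open>T\<^sub>i\<close>, both sides being
  \<open>s\<^sub>i x \<otimes> s\<^sub>i y \<otimes> T\<^sub>i v + D\<^sub>i x \<otimes> y \<otimes> c v + s\<^sub>i x \<otimes> D\<^sub>i y \<otimes> c v\<close>.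
\<close>

section \<open>Tensor products of abelian groups\<close>

text \<open>The maps \<open>tensor_lift\<close>, \<open>HS_comult\<close>,
  \<open>Hq_coaction\<close> and \<open>F_mor\<close> are all given by definite descriptions, so
  nothing can be computed with them before existence and uniqueness are settled. Moreover, elements
  of a tensor product of modules are images under an arbitrary injection into \<open>'u\<close>, so
  they are accessible only through pure tensors. This fixes the pattern of almost every argument:
  existence from a universal property, and equality of two maps by comparing them on pure tensors or
  on algebra generators, with extensionality taking care of the values off the carrier. The chosen
  copies also make \<open>(M \<otimes> N) \<otimes> V\<close> and
  \<open>M \<otimes> (N \<otimes> V)\<close> different records, so the equality of functors has to
  take the form of a natural isomorphism with prescribed values on pure tensors. Targets of
  biadditive maps are multiplicative monoids because \<open>tensor_group\<close> is one; rings and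
  modules enter through \<open>add_monoid\<close>.\<close>

definition biadditive ::
    "('a, 'c) ring_scheme \<Rightarrow> ('b, 'd) ring_scheme \<Rightarrow> ('g, 'e) monoid_scheme \<Rightarrow> ('a \<Rightarrow> 'b \<Rightarrow> 'g) \<Rightarrow> bool" where
  "biadditive M N G f \<longleftrightarrow>
     (\<forall>x\<in>carrier M. \<forall>y\<in>carrier N. f x y \<in> carrier G) \<and>
     (\<forall>x\<in>carrier M. \<forall>x'\<in>carrier M. \<forall>y\<in>carrier N. f (x \<oplus>\<^bsub>M\<^esub> x') y = f x y \<otimes>\<^bsub>G\<^esub> f x' y) \<and>
     (\<forall>x\<in>carrier M. \<forall>y\<in>carrier N. \<forall>y'\<in>carrier N. f x (y \<oplus>\<^bsub>N\<^esub> y') = f x y \<otimes>\<^bsub>G\<^esub> f x y')"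

lemma biadditiveI:
  assumes "\<And>x y. \<lbrakk>x \<in> carrier M; y \<in> carrier N\<rbrakk> \<Longrightarrow> f x y \<in> carrier G"
    and "\<And>x x' y. \<lbrakk>x \<in> carrier M; x' \<in> carrier M; y \<in> carrier N\<rbrakk> \<Longrightarrow>
      f (x \<oplus>\<^bsub>M\<^esub> x') y = f x y \<otimes>\<^bsub>G\<^esub> f x' y"
    and "\<And>x y y'. \<lbrakk>x \<in> carrier M; y \<in> carrier N; y' \<in> carrier N\<rbrakk> \<Longrightarrow>
      f x (y \<oplus>\<^bsub>N\<^esub> y') = f x y \<otimes>\<^bsub>G\<^esub> f x y'"
  shows "biadditive M N G f"
  using assms by (simp add: biadditive_def)

lemma biadditiveD:
  assumes "biadditive M N G f"
  shows "\<lbrakk>x \<in> carrier M; y \<in> carrier N\<rbrakk> \<Longrightarrow> f x y \<in> carrier G"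
    and "\<lbrakk>x \<in> carrier M; x' \<in> carrier M; y \<in> carrier N\<rbrakk> \<Longrightarrow>
      f (x \<oplus>\<^bsub>M\<^esub> x') y = f x y \<otimes>\<^bsub>G\<^esub> f x' y"
    and "\<lbrakk>x \<in> carrier M; y \<in> carrier N; y' \<in> carrier N\<rbrakk> \<Longrightarrow>
      f x (y \<oplus>\<^bsub>N\<^esub> y') = f x y \<otimes>\<^bsub>G\<^esub> f x y'"
  using assms by (simp_all add: biadditive_def)

locale tensor_pair = M: abelian_group M + N: abelian_group N
  for M :: "('a, 'c) ring_scheme" and N :: "('b, 'd) ring_scheme"
begin

abbreviation "FA \<equiv> free_Abelian_group (carrier M \<times> carrier N)"
abbreviation "TG \<equiv> tensor_group M N"

lemma tensor_rels_subset: "tensor_rels M N \<subseteq> carrier FA"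
proof -
  have "frag_of a - frag_of b - frag_of c \<in> carrier FA"
    if "a \<in> carrier M \<times> carrier N" "b \<in> carrier M \<times> carrier N" "c \<in> carrier M \<times> carrier N" for a b c
    using that keys_diff[of "frag_of a - frag_of b" "frag_of c"] keys_diff[of "frag_of a" "frag_of b"]
    by auto
  then show ?thesis
    by (force simp: tensor_rels_def simp del: carrier_free_Abelian_group_iff)
qed

lemma tensor_kernel_subgroup: "subgroup (tensor_kernel M N) FA"
  unfolding tensor_kernel_def
  by (rule group.generate_is_subgroup[OF group_free_Abelian_group tensor_rels_subset])

lemma tensor_kernel_normal: "tensor_kernel M N \<lhd> FA"
  using tensor_kernel_subgroup abelian_free_Abelian_group comm_group.normal_iff_subgroup by blast

lemma tensor_comm_group [simp]: "comm_group TG"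
  unfolding tensor_group_def
  by (rule comm_group.abelian_FactGroup[OF abelian_free_Abelian_group tensor_kernel_subgroup])

sublocale TG: comm_group TG by simp

lemma coset_hom: "(\<lambda>x. tensor_kernel M N #>\<^bsub>FA\<^esub> x) \<in> hom FA TG"
  unfolding tensor_group_def using normal.r_coset_hom_Mod[OF tensor_kernel_normal] by simp

lemma pure_closed [simp]: "\<lbrakk>x \<in> carrier M; y \<in> carrier N\<rbrakk> \<Longrightarrow> pure M N x y \<in> carrier TG"
  unfolding pure_def using coset_hom by (auto simp: hom_def)

text \<open>Both families of relators have the shape \<open>a - b - c\<close>, so one argument
  serves additivity in either variable: the relator lies in the kernel, its coset is the identity,
  and splitting off this coset leaves the product of the other two.\<close>

lemma coset_rel:
  assumes "frag_of a - frag_of b - frag_of c \<in> tensor_rels M N"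
    and "b \<in> carrier M \<times> carrier N" "c \<in> carrier M \<times> carrier N"
  shows "tensor_kernel M N #>\<^bsub>FA\<^esub> frag_of a
    = (tensor_kernel M N #>\<^bsub>FA\<^esub> frag_of b) \<otimes>\<^bsub>TG\<^esub> (tensor_kernel M N #>\<^bsub>FA\<^esub> frag_of c)"
proof -
  let ?q = "\<lambda>x. tensor_kernel M N #>\<^bsub>FA\<^esub> x" and ?r = "frag_of a - frag_of b - frag_of c"
  interpret FA: group FA by simp
  have r: "?r \<in> tensor_kernel M N"
    unfolding tensor_kernel_def by (rule generate.incl[OF assms(1)])
  have bc: "frag_of b + frag_of c \<in> carrier FA"
    using assms by (metis FA.m_closed frag_of_in_free_Abelian_group mult_free_Abelian_group)
  have rc: "?r \<in> carrier FA"
    using r tensor_kernel_subgroup subgroup.mem_carrier by metis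
  have "?q (frag_of a) = ?q (?r \<otimes>\<^bsub>FA\<^esub> (frag_of b + frag_of c))"
    by simp
  also have "\<dots> = ?q ?r \<otimes>\<^bsub>TG\<^esub> ?q (frag_of b + frag_of c)"
    using hom_mult[OF coset_hom rc bc] .
  also have "?q ?r = \<one>\<^bsub>TG\<^esub>"
    using FA.coset_join2[OF rc tensor_kernel_subgroup r] by (simp add: tensor_group_def)
  also have "\<one>\<^bsub>TG\<^esub> \<otimes>\<^bsub>TG\<^esub> ?q (frag_of b + frag_of c) = ?q (frag_of b + frag_of c)"
    using hom_in_carrier[OF coset_hom bc] by simp
  also have "\<dots> = ?q (frag_of b) \<otimes>\<^bsub>TG\<^esub> ?q (frag_of c)"
    using hom_mult[OF coset_hom, of "frag_of b" "frag_of c"] assms by simp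
  finally show ?thesis .
qed

lemma pure_add_left:
  "\<lbrakk>x \<in> carrier M; x' \<in> carrier M; y \<in> carrier N\<rbrakk> \<Longrightarrow>
    pure M N (x \<oplus>\<^bsub>M\<^esub> x') y = pure M N x y \<otimes>\<^bsub>TG\<^esub> pure M N x' y"
  unfolding pure_def by (rule coset_rel) (auto simp: tensor_rels_def)

lemma pure_add_right:
  "\<lbrakk>x \<in> carrier M; y \<in> carrier N; y' \<in> carrier N\<rbrakk> \<Longrightarrow>
    pure M N x (y \<oplus>\<^bsub>N\<^esub> y') = pure M N x y \<otimes>\<^bsub>TG\<^esub> pure M N x y'"
  unfolding pure_def by (rule coset_rel) (auto simp: tensor_rels_def)

lemma pure_zero_left: "y \<in> carrier N \<Longrightarrow> pure M N \<zero>\<^bsub>M\<^esub> y = \<one>\<^bsub>TG\<^esub>"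
  using pure_add_left[of "\<zero>\<^bsub>M\<^esub>" "\<zero>\<^bsub>M\<^esub>" y] TG.l_cancel_one'[of "pure M N \<zero>\<^bsub>M\<^esub> y" "pure M N \<zero>\<^bsub>M\<^esub> y"]
  by simp

lemma inv_pure:
  assumes "x \<in> carrier M" "y \<in> carrier N"
  shows "inv\<^bsub>TG\<^esub> pure M N x y = pure M N (\<ominus>\<^bsub>M\<^esub> x) y"
  using assms pure_add_left[of "\<ominus>\<^bsub>M\<^esub> x" x y]
  by (intro TG.inv_equality) (auto simp: M.l_neg pure_zero_left)

text \<open>Inverses of pure tensors are pure, so sums of pure tensors exhaust the group.\<close>

lemma tensor_induct [consumes 1, case_names pure mult]:
  assumes z: "z \<in> carrier TG"
    and pure: "\<And>x y. \<lbrakk>x \<in> carrier M; y \<in> carrier N\<rbrakk> \<Longrightarrow> P (pure M N x y)"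
    and mult: "\<And>u v. \<lbrakk>u \<in> carrier TG; v \<in> carrier TG; P u; P v\<rbrakk> \<Longrightarrow> P (u \<otimes>\<^bsub>TG\<^esub> v)"
  shows "P z"
proof -
  let ?q = "\<lambda>x. tensor_kernel M N #>\<^bsub>FA\<^esub> x"
  interpret q: group_hom FA TG ?q
    by (intro group_hom.intro group_hom_axioms.intro coset_hom) (simp_all add: TG.is_group)
  from z obtain c where c: "c \<in> carrier FA" "z = ?q c"
    by (auto simp: tensor_group_def carrier_FactGroup)
  \<comment> \<open>Induction in the free abelian group proceeds by differences while
    \<open>P\<close> is closed only under products, so the claim has to carry the inverse
    along.\<close>
  have "P (?q c) \<and> P (inv\<^bsub>TG\<^esub> ?q c) \<and> ?q c \<in> carrier TG"
  proof (rule free_Abelian_group_induct[of c "carrier M \<times> carrier N"])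
    show "Poly_Mapping.keys c \<subseteq> carrier M \<times> carrier N" using c by simp
    have "?q 0 = \<one>\<^bsub>TG\<^esub>" using q.hom_one by simp
    then show "P (?q 0) \<and> P (inv\<^bsub>TG\<^esub> ?q 0) \<and> ?q 0 \<in> carrier TG"
      using pure[of "\<zero>\<^bsub>M\<^esub>" "\<zero>\<^bsub>N\<^esub>"] pure_zero_left[of "\<zero>\<^bsub>N\<^esub>"] by simp
  next
    fix a assume "a \<in> carrier M \<times> carrier N"
    then show "P (?q (frag_of a)) \<and> P (inv\<^bsub>TG\<^esub> ?q (frag_of a)) \<and> ?q (frag_of a) \<in> carrier TG"
      using pure inv_pure pure_closed unfolding pure_def by auto
  next
    fix x y
    assume k: "Poly_Mapping.keys x \<subseteq> carrier M \<times> carrier N" "Poly_Mapping.keys y \<subseteq> carrier M \<times> carrier N"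
      and x: "P (?q x) \<and> P (inv\<^bsub>TG\<^esub> ?q x) \<and> ?q x \<in> carrier TG"
      and y: "P (?q y) \<and> P (inv\<^bsub>TG\<^esub> ?q y) \<and> ?q y \<in> carrier TG"
    have m: "- y \<in> carrier FA" using k by simp
    have "?q (- y) = inv\<^bsub>TG\<^esub> ?q y"
      using q.hom_inv[of y] k by simp
    then have e: "?q (x - y) = ?q x \<otimes>\<^bsub>TG\<^esub> inv\<^bsub>TG\<^esub> ?q y"
      using q.hom_mult[of x "- y"] k m by simp
    then have "inv\<^bsub>TG\<^esub> ?q (x - y) = inv\<^bsub>TG\<^esub> ?q x \<otimes>\<^bsub>TG\<^esub> ?q y"
      using x y by (simp add: TG.inv_mult)
    with e show "P (?q (x - y)) \<and> P (inv\<^bsub>TG\<^esub> ?q (x - y)) \<and> ?q (x - y) \<in> carrier TG"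
      using x y by (auto intro!: mult)
  qed
  with c show ?thesis by simp
qed

lemma tensor_hom_eqI:
  assumes "h \<in> hom TG G" "h' \<in> hom TG G"
    and "\<And>x y. \<lbrakk>x \<in> carrier M; y \<in> carrier N\<rbrakk> \<Longrightarrow> h (pure M N x y) = h' (pure M N x y)"
    and "z \<in> carrier TG"
  shows "h z = h' z"
  using assms(4) by (induction rule: tensor_induct) (simp_all add: assms(3) hom_mult[OF assms(1)] hom_mult[OF assms(2)])

text \<open>Existence half of the universal property: the extension of \<open>f\<close> to the free
  abelian group kills both kinds of relators because \<open>f\<close> is biadditive, hence it
  factors through the quotient. The uniqueness half is \<open>tensor_hom_eqI\<close>.\<close>

lemma tensor_universal:
  assumes G: "comm_group G" and f: "biadditive M N G f"
  obtains h where "h \<in> hom TG G"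
    and "\<And>x y. \<lbrakk>x \<in> carrier M; y \<in> carrier N\<rbrakk> \<Longrightarrow> h (pure M N x y) = f x y"
proof -
  interpret G: comm_group G by fact
  have "(\<lambda>(x, y). f x y) ` (carrier M \<times> carrier N) \<subseteq> carrier G"
    using biadditiveD(1)[OF f] by auto
  from G.free_Abelian_group_universal[OF this] obtain h
    where h: "h \<in> hom FA G"
      and hf: "\<And>a. a \<in> carrier M \<times> carrier N \<Longrightarrow> h (frag_of a) = (case a of (x, y) \<Rightarrow> f x y)"
    by metis
  interpret h: group_hom FA G h
    by (intro group_hom.intro group_hom_axioms.intro h) (simp_all add: G.is_group)
  have rel: "h (frag_of a - frag_of b - frag_of c) = \<one>\<^bsub>G\<^esub>"
    if "h (frag_of a) = h (frag_of b) \<otimes>\<^bsub>G\<^esub> h (frag_of c)" "a \<in> carrier M \<times> carrier N"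
       "b \<in> carrier M \<times> carrier N" "c \<in> carrier M \<times> carrier N" for a b c
  proof -
    have bc: "frag_of b \<otimes>\<^bsub>FA\<^esub> frag_of c \<in> carrier FA"
      using that by (intro h.G.m_closed) auto
    have "h (frag_of a \<otimes>\<^bsub>FA\<^esub> inv\<^bsub>FA\<^esub> (frag_of b \<otimes>\<^bsub>FA\<^esub> frag_of c))
        = h (frag_of a) \<otimes>\<^bsub>G\<^esub> inv\<^bsub>G\<^esub> (h (frag_of b) \<otimes>\<^bsub>G\<^esub> h (frag_of c))"
      using that bc by (simp only: h.hom_mult h.hom_inv h.G.inv_closed frag_of_in_free_Abelian_group)
    also have "\<dots> = \<one>\<^bsub>G\<^esub>" using that h.hom_closed[of "frag_of b"] h.hom_closed[of "frag_of c"] by simp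
    finally show ?thesis using bc by (simp add: algebra_simps)
  qed
  have "tensor_rels M N \<subseteq> kernel FA G h"
  proof
    fix r assume r: "r \<in> tensor_rels M N"
    then have "r \<in> carrier FA" using tensor_rels_subset by blast
    moreover from r have "h r = \<one>\<^bsub>G\<^esub>"
      unfolding tensor_rels_def by (auto intro!: rel simp: hf biadditiveD[OF f])
    ultimately show "r \<in> kernel FA G h" by (simp add: kernel_def)
  qed
  then have "tensor_kernel M N \<subseteq> kernel FA G h"
    unfolding tensor_kernel_def by (rule h.G.generate_subgroup_incl[OF _ h.subgroup_kernel])
  from h.FactGroup_universal_kernel[OF tensor_kernel_normal this] obtain g
    where g: "g \<in> hom TG G" "\<And>x. x \<in> carrier FA \<Longrightarrow> g (tensor_kernel M N #>\<^bsub>FA\<^esub> x) = h x"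
    unfolding tensor_group_def by metis
  show thesis
    using that[OF g(1)] g(2) hf unfolding pure_def by simp
qed

text \<open>This makes the definite description usable: a map from \<open>tensor_universal\<close>
  is cut down to the carrier, and a competitor agrees with it on the carrier by
  \<open>tensor_hom_eqI\<close> and off it by extensionality.\<close>

lemma tensor_lift:
  assumes G: "comm_group G" and f: "biadditive M N G f"
  shows tensor_lift_hom: "tensor_lift M N G f \<in> hom TG G"
    and tensor_lift_pure: "\<And>x y. \<lbrakk>x \<in> carrier M; y \<in> carrier N\<rbrakk> \<Longrightarrow> tensor_lift M N G f (pure M N x y) = f x y"
proof -
  let ?P = "\<lambda>h. h \<in> hom TG G \<inter> extensional (carrier TG) \<and>
     (\<forall>x\<in>carrier M. \<forall>y\<in>carrier N. h (pure M N x y) = f x y)"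
  obtain h where h: "h \<in> hom TG G"
    and hp: "\<And>x y. \<lbrakk>x \<in> carrier M; y \<in> carrier N\<rbrakk> \<Longrightarrow> h (pure M N x y) = f x y"
    using tensor_universal[OF G f] by blast
  have "\<exists>!h. ?P h"
  proof (rule ex1I)
    show "?P (restrict h (carrier TG))"
      using h hp by (auto simp: hom_def)
    fix h' assume "?P h'"
    then show "h' = restrict h (carrier TG)"
      using tensor_hom_eqI[OF _ h, of h'] hp
      by (intro extensionalityI[of _ "carrier TG"]) auto
  qed
  then have "?P (tensor_lift M N G f)"
    unfolding tensor_lift_def by (rule theI')
  then show "tensor_lift M N G f \<in> hom TG G"
    and "\<And>x y. \<lbrakk>x \<in> carrier M; y \<in> carrier N\<rbrakk> \<Longrightarrow> tensor_lift M N G f (pure M N x y) = f x y"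
    by auto
qed

end

text \<open>A quotient of a free abelian group on part of \<open>'u \<times> 'u\<close> is no larger
  than the free abelian group on all pairs, which is equipollent to \<open>'u \<times> 'u\<close>
  and so to \<open>'u\<close>. The choice in \<open>tensor_code\<close> rests on this.\<close>

lemma tensor_group_lepoll_infinite:
  fixes M :: "('u::infinite, 'c) ring_scheme" and N :: "('u, 'd) ring_scheme"
  shows "carrier (tensor_group M N) \<lesssim> (UNIV :: 'u set)"
proof -
  have inf: "infinite (UNIV :: ('u \<times> 'u) set)"
    using infinite_UNIV by (simp add: finite_prod)
  have "carrier (tensor_group M N) \<lesssim> carrier (free_Abelian_group (carrier M \<times> carrier N))"
    unfolding tensor_group_def carrier_FactGroup by (rule image_lepoll)
  also have "\<dots> \<lesssim> carrier (free_Abelian_group (UNIV :: ('u \<times> 'u) set))"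
    by (rule subset_imp_lepoll) auto
  also have "\<dots> \<approx> (UNIV :: ('u \<times> 'u) set)"
    by (rule eqpoll_free_Abelian_group_infinite[OF inf])
  also have "\<dots> \<approx> (UNIV :: 'u set)"
    unfolding eqpoll_iff_card_of_ordIso
    by (metis card_of_Times_same_infinite[OF infinite_UNIV] UNIV_Times_UNIV)
  finally show ?thesis .
qed

lemma inj_on_tensor_code:
  fixes M :: "('u::infinite, 'c) ring_scheme" and N :: "('u, 'd) ring_scheme"
  shows "inj_on (tensor_code M N) (carrier (tensor_group M N))"
proof -
  obtain g :: "('u \<times> 'u \<Rightarrow>\<^sub>0 int) set \<Rightarrow> 'u" where "inj_on g (carrier (tensor_group M N))"
    using tensor_group_lepoll_infinite[of M N] unfolding lepoll_def by metis
  then show ?thesis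
    unfolding tensor_code_def by (rule someI[of "\<lambda>g. inj_on g (carrier (tensor_group M N))"])
qed

section \<open>Actions of a tensor product on a tensor product\<close>

definition tensor_act ::
    "('a, 'c) ring_scheme \<Rightarrow> ('b, 'd) ring_scheme \<Rightarrow> ('m, 'e) ring_scheme \<Rightarrow> ('n, 'f) ring_scheme
      \<Rightarrow> ('a \<Rightarrow> 'm \<Rightarrow> 'm) \<Rightarrow> ('b \<Rightarrow> 'n \<Rightarrow> 'n)
      \<Rightarrow> ('a \<times> 'b \<Rightarrow>\<^sub>0 int) set \<Rightarrow> ('m \<times> 'n \<Rightarrow>\<^sub>0 int) set \<Rightarrow> ('m \<times> 'n \<Rightarrow>\<^sub>0 int) set" where
  "tensor_act A B M N \<mu> \<nu> t z =
     tensor_lift A B (tensor_group M N)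
       (\<lambda>a b. tensor_lift M N (tensor_group M N) (\<lambda>x y. pure M N (\<mu> a x) (\<nu> b y)) z) t"

text \<open>Abstract biadditive maps \<open>\<mu>\<close> and \<open>\<nu>\<close> let one
  development cover both the product of \<open>tensor_ring\<close>, where the rings act on
  themselves, and the scalar action of \<open>tensor_module\<close>.\<close>

locale tensor_action = AB: tensor_pair A B + MN: tensor_pair M N
  for A :: "('a, 'c) ring_scheme" and B :: "('b, 'd) ring_scheme"
    and M :: "('m, 'e) ring_scheme" and N :: "('n, 'f) ring_scheme" +
  fixes \<mu> :: "'a \<Rightarrow> 'm \<Rightarrow> 'm" and \<nu> :: "'b \<Rightarrow> 'n \<Rightarrow> 'n"
  assumes mu: "biadditive A M (add_monoid M) \<mu>" and nu: "biadditive B N (add_monoid N) \<nu>"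
begin

abbreviation "act \<equiv> tensor_act A B M N \<mu> \<nu>"
abbreviation "act_pure a b \<equiv> tensor_lift M N MN.TG (\<lambda>x y. pure M N (\<mu> a x) (\<nu> b y))"

lemmas mu_simps [simp] = biadditiveD[OF mu, simplified]
lemmas nu_simps [simp] = biadditiveD[OF nu, simplified]

lemma biadditive_act_pure:
  "\<lbrakk>a \<in> carrier A; b \<in> carrier B\<rbrakk> \<Longrightarrow> biadditive M N MN.TG (\<lambda>x y. pure M N (\<mu> a x) (\<nu> b y))"
  by (intro biadditiveI) (simp_all add: MN.pure_add_left MN.pure_add_right)

lemmas act_pure_hom = MN.tensor_lift_hom[OF MN.tensor_comm_group biadditive_act_pure]
lemmas act_pure_pure = MN.tensor_lift_pure[OF MN.tensor_comm_group biadditive_act_pure]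

text \<open>The outer lift over \<open>A\<close> and \<open>B\<close> requires this for every
  \<open>z\<close>, whereas \<open>act_pure\<close> has a formula on pure tensors only. Both sides
  are homomorphisms in \<open>z\<close>, the right one because the target group is commutative, so
  the formula decides.\<close>

lemma act_pure_add_left:
  assumes a: "a \<in> carrier A" "a' \<in> carrier A" "b \<in> carrier B" and z: "z \<in> carrier MN.TG"
  shows "act_pure (a \<oplus>\<^bsub>A\<^esub> a') b z = act_pure a b z \<otimes>\<^bsub>MN.TG\<^esub> act_pure a' b z"
proof (rule MN.tensor_hom_eqI[OF _ _ _ z, of _ MN.TG "\<lambda>z. act_pure a b z \<otimes>\<^bsub>MN.TG\<^esub> act_pure a' b z"])
  show "act_pure (a \<oplus>\<^bsub>A\<^esub> a') b \<in> hom MN.TG MN.TG" using a by (simp add: act_pure_hom)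
  show "(\<lambda>z. act_pure a b z \<otimes>\<^bsub>MN.TG\<^esub> act_pure a' b z) \<in> hom MN.TG MN.TG"
    by (rule MN.TG.hom_group_mult) (use a in \<open>simp_all add: act_pure_hom\<close>)
  show "act_pure (a \<oplus>\<^bsub>A\<^esub> a') b (pure M N x y)
      = act_pure a b (pure M N x y) \<otimes>\<^bsub>MN.TG\<^esub> act_pure a' b (pure M N x y)"
    if "x \<in> carrier M" "y \<in> carrier N" for x y
    using that a by (simp add: act_pure_pure MN.pure_add_left)
qed

lemma act_pure_add_right:
  assumes a: "a \<in> carrier A" "b \<in> carrier B" "b' \<in> carrier B" and z: "z \<in> carrier MN.TG"
  shows "act_pure a (b \<oplus>\<^bsub>B\<^esub> b') z = act_pure a b z \<otimes>\<^bsub>MN.TG\<^esub> act_pure a b' z"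
proof (rule MN.tensor_hom_eqI[OF _ _ _ z, of _ MN.TG "\<lambda>z. act_pure a b z \<otimes>\<^bsub>MN.TG\<^esub> act_pure a b' z"])
  show "act_pure a (b \<oplus>\<^bsub>B\<^esub> b') \<in> hom MN.TG MN.TG" using a by (simp add: act_pure_hom)
  show "(\<lambda>z. act_pure a b z \<otimes>\<^bsub>MN.TG\<^esub> act_pure a b' z) \<in> hom MN.TG MN.TG"
    by (rule MN.TG.hom_group_mult) (use a in \<open>simp_all add: act_pure_hom\<close>)
  show "act_pure a (b \<oplus>\<^bsub>B\<^esub> b') (pure M N x y)
      = act_pure a b (pure M N x y) \<otimes>\<^bsub>MN.TG\<^esub> act_pure a b' (pure M N x y)"
    if "x \<in> carrier M" "y \<in> carrier N" for x y
    using that a by (simp add: act_pure_pure MN.pure_add_right)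
qed

lemma biadditive_act_outer:
  assumes "z \<in> carrier MN.TG"
  shows "biadditive A B MN.TG (\<lambda>a b. act_pure a b z)"
  using assms
  by (intro biadditiveI) (auto simp: act_pure_add_left act_pure_add_right hom_in_carrier[OF act_pure_hom])

lemma act_hom_left: "z \<in> carrier MN.TG \<Longrightarrow> (\<lambda>t. act t z) \<in> hom AB.TG MN.TG"
  using AB.tensor_lift_hom[OF MN.tensor_comm_group biadditive_act_outer]
  unfolding tensor_act_def by (simp add: hom_def)

lemma act_closed [simp]: "\<lbrakk>t \<in> carrier AB.TG; z \<in> carrier MN.TG\<rbrakk> \<Longrightarrow> act t z \<in> carrier MN.TG"
  using act_hom_left by (rule hom_in_carrier)

lemma act_add_left:
  "\<lbrakk>t \<in> carrier AB.TG; t' \<in> carrier AB.TG; z \<in> carrier MN.TG\<rbrakk> \<Longrightarrow>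
    act (t \<otimes>\<^bsub>AB.TG\<^esub> t') z = act t z \<otimes>\<^bsub>MN.TG\<^esub> act t' z"
  using act_hom_left by (rule hom_mult)

lemma act_pure_eq:
  "\<lbrakk>a \<in> carrier A; b \<in> carrier B; z \<in> carrier MN.TG\<rbrakk> \<Longrightarrow> act (pure A B a b) z = act_pure a b z"
  unfolding tensor_act_def
  by (rule AB.tensor_lift_pure[OF MN.tensor_comm_group biadditive_act_outer])

lemma act_pure_pure_eq [simp]:
  "\<lbrakk>a \<in> carrier A; b \<in> carrier B; x \<in> carrier M; y \<in> carrier N\<rbrakk> \<Longrightarrow>
    act (pure A B a b) (pure M N x y) = pure M N (\<mu> a x) (\<nu> b y)"
  by (simp add: act_pure_eq act_pure_pure)

text \<open>As a lift in \<open>t\<close>, \<open>act\<close> is additive in \<open>t\<close> by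
  construction but not visibly in \<open>z\<close>. Induction on \<open>t\<close> reduces to pure
  \<open>t\<close>, where \<open>act\<close> is the inner lift and thus a homomorphism in
  \<open>z\<close>.\<close>

lemma act_add_right:
  assumes t: "t \<in> carrier AB.TG" and z: "z \<in> carrier MN.TG" "z' \<in> carrier MN.TG"
  shows "act t (z \<otimes>\<^bsub>MN.TG\<^esub> z') = act t z \<otimes>\<^bsub>MN.TG\<^esub> act t z'"
  using t
proof (induction rule: AB.tensor_induct)
  case (pure a b)
  then show ?case
    using z by (simp add: act_pure_eq hom_mult[OF act_pure_hom])
next
  case (mult u v)
  then show ?case
    using z by (simp add: act_add_left MN.TG.m_ac)
qed

lemma act_one:
  assumes "a \<in> carrier A" "b \<in> carrier B" and "z \<in> carrier MN.TG"
    and "\<And>x. x \<in> carrier M \<Longrightarrow> \<mu> a x = x" "\<And>y. y \<in> carrier N \<Longrightarrow> \<nu> b y = y"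
  shows "act (pure A B a b) z = z"
  using assms(3) by (induction rule: MN.tensor_induct) (simp_all add: assms act_add_right)

text \<open>Both sides are additive in each of \<open>z\<close>, \<open>u\<close> and
  \<open>t\<close>, so three nested inductions leave pure tensors, where the hypotheses on
  \<open>\<mu>\<close> and \<open>\<nu>\<close> apply. With ring products for all maps this is
  associativity of the tensor ring; with scalar multiplications for \<open>\<mu>\<close> and
  \<open>\<nu>\<close> it is the module law.\<close>

lemma act_assoc:
  assumes R: "tensor_action A B A B \<alpha> \<beta>"
    and \<mu>: "\<And>a a' x. \<lbrakk>a \<in> carrier A; a' \<in> carrier A; x \<in> carrier M\<rbrakk> \<Longrightarrow> \<mu> (\<alpha> a a') x = \<mu> a (\<mu> a' x)"
    and \<nu>: "\<And>b b' y. \<lbrakk>b \<in> carrier B; b' \<in> carrier B; y \<in> carrier N\<rbrakk> \<Longrightarrow> \<nu> (\<beta> b b') y = \<nu> b (\<nu> b' y)"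
    and t: "t \<in> carrier AB.TG" and u: "u \<in> carrier AB.TG" and z: "z \<in> carrier MN.TG"
  shows "act (tensor_act A B A B \<alpha> \<beta> t u) z = act t (act u z)"
proof -
  interpret R: tensor_action A B A B \<alpha> \<beta> by fact
  show ?thesis
    using z
  proof (induction rule: MN.tensor_induct)
    case (mult z z')
    then show ?case using t u by (simp add: act_add_right)
  next
    case (pure x y)
    show ?case
      using u
    proof (induction rule: AB.tensor_induct)
      case (mult u u')
      then show ?case using t pure by (simp add: act_add_left act_add_right R.act_add_right)
    next
      case pure': (pure a' b')
      show ?case
        using t
      proof (induction rule: AB.tensor_induct)
        case (mult u u')
        then show ?case using pure pure' by (simp add: act_add_left R.act_add_left)
      next
        case (pure a b)
        then show ?case using \<open>x \<in> _\<close> \<open>y \<in> _\<close> pure' by (simp add: \<mu> \<nu>)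
      qed
    qed
  qed
qed

end

section \<open>The tensor product of rings and of modules\<close>

lemma (in ring) biadditive_mult: "biadditive R R (add_monoid R) (\<otimes>)"
  by (rule biadditiveI) (simp_all add: l_distr r_distr)

lemma (in left_module) biadditive_smult: "biadditive R M (add_monoid M) (\<odot>\<^bsub>M\<^esub>)"
  by (rule biadditiveI) (simp_all add: smult_closed smult_l_distr smult_r_distr)

locale ring_pair = A: ring A + B: ring B for A :: "'a ring" and B :: "'b ring"
begin

sublocale tensor_pair A B ..
sublocale tensor_action A B A B "(\<otimes>\<^bsub>A\<^esub>)" "(\<otimes>\<^bsub>B\<^esub>)"
  by (intro tensor_action.intro tensor_action_axioms.intro tensor_pair_axioms A.biadditive_mult B.biadditive_mult)

abbreviation "TR \<equiv> tensor_ring A B"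

lemma tensor_ring_simps:
  "carrier TR = carrier TG"
  "mult TR = act"
  "\<one>\<^bsub>TR\<^esub> = pure A B \<one>\<^bsub>A\<^esub> \<one>\<^bsub>B\<^esub>"
  "\<zero>\<^bsub>TR\<^esub> = \<one>\<^bsub>TG\<^esub>"
  "add TR = mult TG"
  by (simp_all add: tensor_ring_def tensor_act_def Let_def fun_eq_iff)

lemma tensor_ring_abelian_group: "abelian_group TR"
  by (rule comm_group_abelian_groupI, rule comm_groupI)
    (auto simp: tensor_ring_simps TG.m_ac intro: TG.l_inv_ex)

lemma tensor_ring_ring: "ring TR"
proof (rule ringI)
  show "abelian_group TR" by (rule tensor_ring_abelian_group)
  show "Group.monoid TR"
  proof (rule monoidI; unfold tensor_ring_simps)
    fix x y z assume "x \<in> carrier TG" "y \<in> carrier TG" "z \<in> carrier TG"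
    then show "act (act x y) z = act x (act y z)"
      by (intro act_assoc) (auto simp: tensor_action_axioms A.m_assoc B.m_assoc)
  next
    fix x assume "x \<in> carrier TG"
    then show "act x (pure A B \<one>\<^bsub>A\<^esub> \<one>\<^bsub>B\<^esub>) = x"
      by (induction rule: tensor_induct) (simp_all add: act_add_left)
  next
    fix x assume "x \<in> carrier TG"
    then show "act (pure A B \<one>\<^bsub>A\<^esub> \<one>\<^bsub>B\<^esub>) x = x"
      by (rule act_one[rotated 2]) simp_all
  qed simp_all
qed (simp_all only: tensor_ring_simps act_add_left act_add_right)

sublocale TR: ring TR by (rule tensor_ring_ring)

lemma pure_ring_closed [simp]:
  "\<lbrakk>a \<in> carrier A; b \<in> carrier B\<rbrakk> \<Longrightarrow> pure A B a b \<in> carrier TR"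
  by (simp add: tensor_ring_simps)

lemma pure_mult [simp]:
  "\<lbrakk>a \<in> carrier A; b \<in> carrier B; a' \<in> carrier A; b' \<in> carrier B\<rbrakk> \<Longrightarrow>
    pure A B a b \<otimes>\<^bsub>TR\<^esub> pure A B a' b' = pure A B (a \<otimes>\<^bsub>A\<^esub> a') (b \<otimes>\<^bsub>B\<^esub> b')"
  by (simp add: tensor_ring_simps)

lemma pure_ring_add_left:
  "\<lbrakk>a \<in> carrier A; b \<in> carrier B; a' \<in> carrier A\<rbrakk> \<Longrightarrow>
    pure A B (a \<oplus>\<^bsub>A\<^esub> a') b = pure A B a b \<oplus>\<^bsub>TR\<^esub> pure A B a' b"
  by (simp add: tensor_ring_simps pure_add_left)

lemma pure_ring_add_right:
  "\<lbrakk>a \<in> carrier A; b \<in> carrier B; b' \<in> carrier B\<rbrakk> \<Longrightarrow>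
    pure A B a (b \<oplus>\<^bsub>B\<^esub> b') = pure A B a b \<oplus>\<^bsub>TR\<^esub> pure A B a b'"
  by (simp add: tensor_ring_simps pure_add_right)

end

locale module_pair = M: left_module A M + N: left_module B N
  for A :: "'a ring" and B :: "'b ring" and M :: "('a, 'm) module" and N :: "('b, 'n) module"
begin

sublocale AB: ring_pair A B ..
sublocale MN: tensor_pair M N ..
sublocale tensor_action A B M N "(\<odot>\<^bsub>M\<^esub>)" "(\<odot>\<^bsub>N\<^esub>)"
  by (intro tensor_action.intro tensor_action_axioms.intro AB.tensor_pair_axioms MN.tensor_pair_axioms
      M.biadditive_smult N.biadditive_smult)

abbreviation "TM \<equiv> tensor_module A B M N"

lemma tensor_module_simps:
  "carrier TM = carrier MN.TG"
  "\<zero>\<^bsub>TM\<^esub> = \<one>\<^bsub>MN.TG\<^esub>"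
  "add TM = mult MN.TG"
  "smult TM = act"
  by (simp_all add: tensor_module_def tensor_act_def Let_def fun_eq_iff)

lemma tensor_module_left_module: "left_module AB.TR TM"
proof -
  interpret TM: abelian_group TM
    by (rule comm_group_abelian_groupI, rule comm_groupI)
      (auto simp: tensor_module_simps MN.TG.m_ac intro: MN.TG.l_inv_ex)
  show ?thesis
  proof (unfold_locales; unfold tensor_module_simps AB.tensor_ring_simps)
    fix t u z assume "t \<in> carrier AB.TG" "u \<in> carrier AB.TG" "z \<in> carrier MN.TG"
    then show "act (AB.act t u) z = act t (act u z)"
      by (intro act_assoc) (auto simp: AB.tensor_action_axioms M.smult_assoc N.smult_assoc)
  qed (simp_all add: act_add_left act_add_right act_one M.smult_one N.smult_one)
qed

end

section \<open>Restriction of scalars and transport of structure\<close>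

lemma restrict_scalars_simps [simp]:
  "carrier (restrict_scalars \<phi> M) = carrier M"
  "add (restrict_scalars \<phi> M) = add M"
  "\<zero>\<^bsub>restrict_scalars \<phi> M\<^esub> = \<zero>\<^bsub>M\<^esub>"
  "a \<odot>\<^bsub>restrict_scalars \<phi> M\<^esub> x = \<phi> a \<odot>\<^bsub>M\<^esub> x"
  by (simp_all add: restrict_scalars_def)

lemma left_module_restrict_scalars:
  assumes R: "ring R" and \<phi>: "\<phi> \<in> ring_hom R S" and M: "left_module S M"
  shows "left_module R (restrict_scalars \<phi> M)"
proof -
  interpret R: ring R by fact
  interpret M: left_module S M by fact
  interpret T: abelian_group "restrict_scalars \<phi> M"
    by (rule abelian_groupI) (auto simp: M.M.a_ac intro: M.M.l_neg)
  show ?thesis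
    by unfold_locales
      (simp_all add: ring_hom_closed[OF \<phi>] ring_hom_add[OF \<phi>] ring_hom_mult[OF \<phi>] ring_hom_one[OF \<phi>]
        M.smult_closed M.smult_l_distr M.smult_r_distr M.smult_assoc M.smult_one)
qed

lemma transport_simps:
  assumes "inj_on g (carrier M)"
  shows "carrier (transport g M) = g ` carrier M"
    and "\<zero>\<^bsub>transport g M\<^esub> = g \<zero>\<^bsub>M\<^esub>"
    and "\<lbrakk>x \<in> carrier M; y \<in> carrier M\<rbrakk> \<Longrightarrow> g x \<oplus>\<^bsub>transport g M\<^esub> g y = g (x \<oplus>\<^bsub>M\<^esub> y)"
    and "x \<in> carrier M \<Longrightarrow> a \<odot>\<^bsub>transport g M\<^esub> g x = g (a \<odot>\<^bsub>M\<^esub> x)"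
  using assms by (simp_all add: transport_def Let_def)

lemma left_module_transport:
  assumes g: "inj_on g (carrier M)" and M: "left_module R M"
  shows "left_module R (transport g M)"
proof -
  interpret M: left_module R M by fact
  note simps = transport_simps[OF g]
  interpret T: abelian_group "transport g M"
  proof (rule abelian_groupI)
    fix x assume "x \<in> carrier (transport g M)"
    then obtain z where z: "z \<in> carrier M" "x = g z" by (auto simp: simps)
    then have "g (\<ominus>\<^bsub>M\<^esub> z) \<oplus>\<^bsub>transport g M\<^esub> x = \<zero>\<^bsub>transport g M\<^esub>"
      by (simp add: simps M.M.l_neg)
    then show "\<exists>y\<in>carrier (transport g M). y \<oplus>\<^bsub>transport g M\<^esub> x = \<zero>\<^bsub>transport g M\<^esub>"
      using z by (auto simp: simps)
  qed (auto simp: simps M.M.a_ac)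
  show ?thesis
    by unfold_locales
      (auto simp: simps M.smult_closed M.smult_l_distr M.smult_r_distr M.smult_assoc M.smult_one)
qed

section \<open>The tensor product of modules with carrier coded inside \<open>'u\<close>\<close>

locale copy_pair = module_pair A B M N
  for A :: "'a ring" and B :: "'b ring" and M :: "('a, 'u::infinite) module" and N :: "('b, 'u) module"
begin

abbreviation "TC \<equiv> tensor_copy A B M N"
abbreviation "elt \<equiv> tensor_elt M N"

lemma code_inj: "inj_on (tensor_code M N) (carrier TM)"
  by (simp add: tensor_module_simps inj_on_tensor_code)

lemma tensor_copy_left_module: "left_module AB.TR TC"
  unfolding tensor_copy_def by (rule left_module_transport[OF code_inj tensor_module_left_module])

sublocale TC: left_module AB.TR TC by (rule tensor_copy_left_module)

lemmas copy_simps = transport_simps[OF code_inj, unfolded tensor_copy_def[symmetric] tensor_module_simps]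

lemma elt_closed [simp]: "\<lbrakk>x \<in> carrier M; y \<in> carrier N\<rbrakk> \<Longrightarrow> elt x y \<in> carrier TC"
  by (simp add: tensor_elt_def copy_simps)

lemma elt_add_left:
  "\<lbrakk>x \<in> carrier M; x' \<in> carrier M; y \<in> carrier N\<rbrakk> \<Longrightarrow> elt (x \<oplus>\<^bsub>M\<^esub> x') y = elt x y \<oplus>\<^bsub>TC\<^esub> elt x' y"
  by (simp add: tensor_elt_def copy_simps MN.pure_add_left)

lemma elt_add_right:
  "\<lbrakk>x \<in> carrier M; y \<in> carrier N; y' \<in> carrier N\<rbrakk> \<Longrightarrow> elt x (y \<oplus>\<^bsub>N\<^esub> y') = elt x y \<oplus>\<^bsub>TC\<^esub> elt x y'"
  by (simp add: tensor_elt_def copy_simps MN.pure_add_right)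

lemma pure_smult_elt [simp]:
  "\<lbrakk>a \<in> carrier A; b \<in> carrier B; x \<in> carrier M; y \<in> carrier N\<rbrakk> \<Longrightarrow>
    pure A B a b \<odot>\<^bsub>TC\<^esub> elt x y = elt (a \<odot>\<^bsub>M\<^esub> x) (b \<odot>\<^bsub>N\<^esub> y)"
  by (simp add: tensor_elt_def copy_simps)

lemma copy_induct [consumes 1, case_names elt add]:
  assumes z: "z \<in> carrier TC"
    and elt: "\<And>x y. \<lbrakk>x \<in> carrier M; y \<in> carrier N\<rbrakk> \<Longrightarrow> P (elt x y)"
    and add: "\<And>u v. \<lbrakk>u \<in> carrier TC; v \<in> carrier TC; P u; P v\<rbrakk> \<Longrightarrow> P (u \<oplus>\<^bsub>TC\<^esub> v)"
  shows "P z"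
proof -
  obtain t where t: "t \<in> carrier MN.TG" "z = tensor_code M N t"
    using z by (auto simp: copy_simps)
  from t(1) have "P (tensor_code M N t)"
  proof (induction rule: MN.tensor_induct)
    case (pure x y)
    then show ?case using elt by (simp add: tensor_elt_def)
  next
    case (mult u v)
    then show ?case using add[of "tensor_code M N u" "tensor_code M N v"] by (simp add: copy_simps)
  qed
  with t show ?thesis by simp
qed

text \<open>The universal property moves along the bijection between the tensor group and its coded
  copy: elements are decoded by the inverse of \<open>tensor_code\<close>. The restriction to the
  carrier is what later turns agreement on the carrier into equality of functions.\<close>

lemma copy_universal:
  assumes G: "comm_group G" and f: "biadditive M N G f"
  shows "\<exists>h\<in>hom (add_monoid TC) G. h \<in> extensional (carrier TC) \<and>
    (\<forall>x\<in>carrier M. \<forall>y\<in>carrier N. h (elt x y) = f x y)"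
proof -
  obtain h where h: "h \<in> hom MN.TG G"
    and hp: "\<And>x y. \<lbrakk>x \<in> carrier M; y \<in> carrier N\<rbrakk> \<Longrightarrow> h (pure M N x y) = f x y"
    using MN.tensor_universal[OF G f] by blast
  let ?h = "restrict (\<lambda>z. h (inv_into (carrier MN.TG) (tensor_code M N) z)) (carrier TC)"
  have eq: "?h (tensor_code M N t) = h t" if "t \<in> carrier MN.TG" for t
    using that code_inj by (simp add: copy_simps tensor_module_simps)
  show ?thesis
  proof (intro bexI[of _ ?h] conjI ballI)
    show "?h \<in> hom (add_monoid TC) G"
    proof (rule homI; simp only: partial_object.simps monoid.simps)
      fix x assume "x \<in> carrier TC"
      then show "?h x \<in> carrier G" using eq hom_in_carrier[OF h] by (auto simp: copy_simps)
    next
      fix x y assume "x \<in> carrier TC" "y \<in> carrier TC"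
      then obtain s t where st: "s \<in> carrier MN.TG" "t \<in> carrier MN.TG"
        "x = tensor_code M N s" "y = tensor_code M N t"
        by (auto simp: copy_simps)
      have "?h (x \<oplus>\<^bsub>TC\<^esub> y) = ?h (tensor_code M N (s \<otimes>\<^bsub>MN.TG\<^esub> t))"
        using st by (simp only: copy_simps)
      also have "\<dots> = h (s \<otimes>\<^bsub>MN.TG\<^esub> t)" using st by (intro eq) simp
      also have "\<dots> = ?h x \<otimes>\<^bsub>G\<^esub> ?h y" using st hom_mult[OF h] by (simp only: eq)
      finally show "?h (x \<oplus>\<^bsub>TC\<^esub> y) = ?h x \<otimes>\<^bsub>G\<^esub> ?h y" .
    qed
    show "?h (elt x y) = f x y" if "x \<in> carrier M" "y \<in> carrier N" for x y
      using that eq[of "pure M N x y"] hp by (simp only: tensor_elt_def MN.pure_closed)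
  qed simp
qed

end

section \<open>Algebras given by generators and relations\<close>

text \<open>The bound \<open>S\<close> on the support is kept through the induction, so that with
  \<open>S\<close> the words over \<open>A\<close> it stays inside the free algebra on
  \<open>A\<close>.\<close>

lemma poly_mapping_single_induct [consumes 1, case_names zero single add]:
  fixes f :: "'a \<Rightarrow>\<^sub>0 'b::comm_monoid_add"
  assumes keys: "Poly_Mapping.keys f \<subseteq> S"
    and zero: "P 0"
    and single: "\<And>w c. w \<in> S \<Longrightarrow> P (Poly_Mapping.single w c)"
    and add: "\<And>f g. \<lbrakk>Poly_Mapping.keys f \<subseteq> S; Poly_Mapping.keys g \<subseteq> S; P f; P g\<rbrakk> \<Longrightarrow> P (f + g)"
  shows "P f"
  using keys
proof (induction f rule: update_induct)
  case const
  then show ?case by (simp add: zero)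
next
  case (update f a b)
  \<comment> \<open>The update happens at a fresh position, and overwriting a zero coefficient
    amounts to adding a monomial.\<close>
  have eq: "Poly_Mapping.update a b f = f + Poly_Mapping.single a b"
    using update.hyps
    by (intro poly_mapping_eqI)
      (auto simp: lookup_update lookup_add lookup_single in_keys_iff when_def)
  have keys: "Poly_Mapping.keys (Poly_Mapping.update a b f) = insert a (Poly_Mapping.keys f)"
    using update.hyps by (auto simp: in_keys_iff lookup_update split: if_splits)
  then have "Poly_Mapping.keys f \<subseteq> S" "a \<in> S"
    using update.prems by auto
  then show ?case
    unfolding eq using update.IH by (intro add single) auto
qed

lemma letters_simps [simp]: "letters 0 = []" "letters (u + v) = letters u @ letters v"
  by (simp_all add: zero_free_word_def plus_free_word_def)

abbreviation words :: "'x set \<Rightarrow> 'x free_word set" where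
  "words A \<equiv> {w. set (letters w) \<subseteq> A}"

lemma free_algebra_simps [simp]:
  "f \<in> carrier (free_algebra A) \<longleftrightarrow> Poly_Mapping.keys f \<subseteq> words A"
  "mult (free_algebra A) = (*)" "\<one>\<^bsub>free_algebra A\<^esub> = 1" "\<zero>\<^bsub>free_algebra A\<^esub> = 0"
  "add (free_algebra A) = (+)"
  by (auto simp: free_algebra_def)

lemma keys_subset_add:
  "\<lbrakk>Poly_Mapping.keys f \<subseteq> S; Poly_Mapping.keys g \<subseteq> S\<rbrakk> \<Longrightarrow> Poly_Mapping.keys (f + g) \<subseteq> S"
  using Poly_Mapping.keys_add[of f g] by blast

lemma keys_subset_diff:
  "\<lbrakk>Poly_Mapping.keys f \<subseteq> S; Poly_Mapping.keys g \<subseteq> S\<rbrakk> \<Longrightarrow>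
    Poly_Mapping.keys (f - g :: _ \<Rightarrow>\<^sub>0 'b::ab_group_add) \<subseteq> S"
  using Poly_Mapping.keys_add[of f "- g"] by auto

lemma keys_mult_words:
  assumes "Poly_Mapping.keys f \<subseteq> words A" "Poly_Mapping.keys g \<subseteq> words A"
  shows "Poly_Mapping.keys (f * g) \<subseteq> words A"
  using assms keys_mult[of f g] by fastforce

lemma keys_one_words: "Poly_Mapping.keys (1 :: _ \<Rightarrow>\<^sub>0 'k::comm_ring_1) \<subseteq> words A"
  by (simp add: zero_free_word_def)

lemma keys_gen: "x \<in> A \<Longrightarrow> Poly_Mapping.keys (gen x :: _ \<Rightarrow>\<^sub>0 'k::comm_ring_1) \<subseteq> words A"
  by (simp add: gen_def)

lemma keys_scalar: "Poly_Mapping.keys (scalar c :: _ \<Rightarrow>\<^sub>0 'k::comm_ring_1) \<subseteq> words A"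
  by (simp add: scalar_def zero_free_word_def)

lemmas keys_words = keys_subset_add keys_subset_diff keys_mult_words keys_one_words keys_gen keys_scalar

lemma free_algebra_ring: "ring (free_algebra A :: ('x free_word \<Rightarrow>\<^sub>0 'k::comm_ring_1) ring)"
proof (rule ringI)
  show "abelian_group (free_algebra A :: ('x free_word \<Rightarrow>\<^sub>0 'k) ring)"
  proof (rule abelian_groupI)
    fix f :: "'x free_word \<Rightarrow>\<^sub>0 'k" assume "f \<in> carrier (free_algebra A)"
    then show "\<exists>g\<in>carrier (free_algebra A). g \<oplus>\<^bsub>free_algebra A\<^esub> f = \<zero>\<^bsub>free_algebra A\<^esub>"
      by (intro bexI[of _ "- f"]) auto
  qed (simp_all add: keys_subset_add add.assoc add.commute)
  show "Group.monoid (free_algebra A :: ('x free_word \<Rightarrow>\<^sub>0 'k) ring)"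
    by (rule monoidI) (use keys_one_words[of A] in \<open>auto simp: keys_mult_words mult.assoc simp del: keys_one\<close>)
qed (auto simp: algebra_simps)

lemma scalar_add: "scalar (c + d) = scalar c + scalar d"
  by (simp add: scalar_def single_add)

lemma scalar_mult: "scalar (c * d) = scalar c * scalar d"
  by (simp add: scalar_def mult_single)

lemma scalar_one: "scalar 1 = 1"
  by (simp add: scalar_def)

lemma scalar_zero: "scalar 0 = 0"
  by (simp add: scalar_def)

lemma scalar_commute: "scalar c * f = f * scalar c"
  using subset_UNIV[of "Poly_Mapping.keys f"]
  by (induction f rule: poly_mapping_single_induct)
    (simp_all add: scalar_def mult_single distrib_left distrib_right mult.commute)

lemma single_word_Nil: "Poly_Mapping.single (Word []) c = scalar c"
  by (simp add: scalar_def zero_free_word_def)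

lemma single_word_Cons: "Poly_Mapping.single (Word (x # xs)) c = gen x * Poly_Mapping.single (Word xs) c"
  by (simp add: gen_def mult_single plus_free_word_def)

lemma free_algebra_induct [consumes 1, case_names scalar gen add mult]:
  assumes f: "f \<in> carrier (free_algebra A)"
    and scalar: "\<And>c. P (scalar c)"
    and gen: "\<And>x. x \<in> A \<Longrightarrow> P (gen x)"
    and add: "\<And>f g. \<lbrakk>f \<in> carrier (free_algebra A); g \<in> carrier (free_algebra A); P f; P g\<rbrakk> \<Longrightarrow> P (f + g)"
    and mult: "\<And>f g. \<lbrakk>f \<in> carrier (free_algebra A); g \<in> carrier (free_algebra A); P f; P g\<rbrakk> \<Longrightarrow> P (f * g)"
  shows "P f"
proof -
  \<comment> \<open>A monomial is peeled letter by letter; its coefficient stays on the tail until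
    only the empty word, a scalar, is left.\<close>
  have word: "P (Poly_Mapping.single (Word xs) c)" if "set xs \<subseteq> A" for xs c
    using that
  proof (induction xs)
    case Nil
    then show ?case by (simp add: single_word_Nil scalar)
  next
    case (Cons x xs)
    then show ?case
      unfolding single_word_Cons by (intro mult gen) (auto simp: keys_gen)
  qed
  from f have "Poly_Mapping.keys f \<subseteq> words A" by simp
  then show ?thesis
  proof (induction f rule: poly_mapping_single_induct)
    case zero
    then show ?case using scalar[of 0] by (simp add: scalar_zero)
  next
    case (single w c)
    then show ?case using word by (cases w) simp
  next
    case (add f g)
    then show ?case using assms(4) by simp
  qed
qed

section \<open>Evaluation of noncommutative polynomials\<close>

locale free_eval = R: ring R
  for R :: "('r, 'c) ring_scheme" +
  fixes \<phi> :: "'k::comm_ring_1 \<Rightarrow> 'r" and \<psi> :: "'x \<Rightarrow> 'r"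
  assumes phi_closed [simp]: "\<phi> c \<in> carrier R"
    and phi_add: "\<phi> (c + d) = \<phi> c \<oplus>\<^bsub>R\<^esub> \<phi> d"
    and phi_mult: "\<phi> (c * d) = \<phi> c \<otimes>\<^bsub>R\<^esub> \<phi> d"
    and phi_one: "\<phi> 1 = \<one>\<^bsub>R\<^esub>"
    and psi_closed [simp]: "\<psi> x \<in> carrier R"
    and commute: "\<phi> c \<otimes>\<^bsub>R\<^esub> \<psi> x = \<psi> x \<otimes>\<^bsub>R\<^esub> \<phi> c"
begin

definition word_eval :: "'x list \<Rightarrow> 'r" where
  "word_eval xs = foldr (\<lambda>x. (\<otimes>\<^bsub>R\<^esub>) (\<psi> x)) xs \<one>\<^bsub>R\<^esub>"

lemma word_eval_simps [simp]:
  "word_eval [] = \<one>\<^bsub>R\<^esub>" "word_eval (x # xs) = \<psi> x \<otimes>\<^bsub>R\<^esub> word_eval xs"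
  by (simp_all add: word_eval_def)

lemma word_eval_closed [simp]: "word_eval xs \<in> carrier R"
  by (induction xs) auto

lemma word_eval_append: "word_eval (xs @ ys) = word_eval xs \<otimes>\<^bsub>R\<^esub> word_eval ys"
  by (induction xs) (auto simp: R.m_assoc)

text \<open>In a product of two monomials the second coefficient must travel past the first word,
  while the target ring may be noncommutative. The assumption \<open>commute\<close> serves this
  purpose.\<close>

lemma phi_commute_word: "\<phi> c \<otimes>\<^bsub>R\<^esub> word_eval xs = word_eval xs \<otimes>\<^bsub>R\<^esub> \<phi> c"
proof (induction xs)
  case (Cons x xs)
  have "\<phi> c \<otimes>\<^bsub>R\<^esub> (\<psi> x \<otimes>\<^bsub>R\<^esub> word_eval xs) = \<psi> x \<otimes>\<^bsub>R\<^esub> (\<phi> c \<otimes>\<^bsub>R\<^esub> word_eval xs)"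
    by (simp add: R.m_assoc[symmetric] commute)
  then show ?case by (simp add: Cons R.m_assoc)
qed simp

lemma phi_zero: "\<phi> 0 = \<zero>\<^bsub>R\<^esub>"
  using phi_add[of 0 0] R.add.l_cancel_one'[of "\<phi> 0" "\<phi> 0"] by simp

definition eval :: "('x free_word \<Rightarrow>\<^sub>0 'k) \<Rightarrow> 'r" where
  "eval f = (\<Oplus>\<^bsub>R\<^esub>w\<in>Poly_Mapping.keys f. \<phi> (Poly_Mapping.lookup f w) \<otimes>\<^bsub>R\<^esub> word_eval (letters w))"

text \<open>The support of a sum can be smaller than the union of the supports because of
  cancellation. Additivity is therefore checked with all three sums taken over a common finite index
  set.\<close>

lemma eval_superset:
  assumes "finite K" "Poly_Mapping.keys f \<subseteq> K"
  shows "eval f = (\<Oplus>\<^bsub>R\<^esub>w\<in>K. \<phi> (Poly_Mapping.lookup f w) \<otimes>\<^bsub>R\<^esub> word_eval (letters w))"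
  unfolding eval_def
  by (rule R.add.finprod_mono_neutral_cong_left)
    (use assms in \<open>auto simp: in_keys_iff phi_zero\<close>)

lemma eval_closed [simp]: "eval f \<in> carrier R"
  unfolding eval_def by (rule R.finsum_closed) auto

lemma eval_add: "eval (f + g) = eval f \<oplus>\<^bsub>R\<^esub> eval g"
proof -
  let ?K = "Poly_Mapping.keys f \<union> Poly_Mapping.keys g"
  have "eval (f + g)
      = (\<Oplus>\<^bsub>R\<^esub>w\<in>?K. \<phi> (Poly_Mapping.lookup (f + g) w) \<otimes>\<^bsub>R\<^esub> word_eval (letters w))"
    by (rule eval_superset) (auto simp: Poly_Mapping.keys_add)
  also have "\<dots> = (\<Oplus>\<^bsub>R\<^esub>w\<in>?K. \<phi> (Poly_Mapping.lookup f w) \<otimes>\<^bsub>R\<^esub> word_eval (letters w) \<oplus>\<^bsub>R\<^esub>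
      \<phi> (Poly_Mapping.lookup g w) \<otimes>\<^bsub>R\<^esub> word_eval (letters w))"
    by (rule R.finsum_cong') (auto simp: lookup_add phi_add R.l_distr)
  also have "\<dots> = eval f \<oplus>\<^bsub>R\<^esub> eval g"
    by (subst R.finsum_addf) (auto simp: eval_superset[of ?K])
  finally show ?thesis .
qed

lemma eval_single: "eval (Poly_Mapping.single w c) = \<phi> c \<otimes>\<^bsub>R\<^esub> word_eval (letters w)"
  by (subst eval_superset[of "{w}"]) auto

lemma eval_zero [simp]: "eval 0 = \<zero>\<^bsub>R\<^esub>"
  by (simp add: eval_def)

lemma eval_single_mult:
  "eval (Poly_Mapping.single v c * Poly_Mapping.single w d)
    = eval (Poly_Mapping.single v c) \<otimes>\<^bsub>R\<^esub> eval (Poly_Mapping.single w d)"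
proof -
  let ?v = "word_eval (letters v)" and ?w = "word_eval (letters w)"
  have "\<phi> c \<otimes>\<^bsub>R\<^esub> ?v \<otimes>\<^bsub>R\<^esub> (\<phi> d \<otimes>\<^bsub>R\<^esub> ?w) = \<phi> c \<otimes>\<^bsub>R\<^esub> (?v \<otimes>\<^bsub>R\<^esub> \<phi> d) \<otimes>\<^bsub>R\<^esub> ?w"
    by (simp add: R.m_assoc)
  also have "\<dots> = \<phi> (c * d) \<otimes>\<^bsub>R\<^esub> (?v \<otimes>\<^bsub>R\<^esub> ?w)"
    by (simp add: phi_commute_word[symmetric] phi_mult R.m_assoc)
  finally show ?thesis
    by (simp add: mult_single eval_single word_eval_append)
qed

lemma eval_mult: "eval (f * g) = eval f \<otimes>\<^bsub>R\<^esub> eval g"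
  using subset_UNIV[of "Poly_Mapping.keys f"]
proof (induction f rule: poly_mapping_single_induct)
  case (single v c)
  show ?case
    using subset_UNIV[of "Poly_Mapping.keys g"]
    by (induction g rule: poly_mapping_single_induct)
      (simp_all add: eval_single_mult distrib_left eval_add R.r_distr)
qed (simp_all add: distrib_right eval_add R.l_distr)

lemma eval_one [simp]: "eval 1 = \<one>\<^bsub>R\<^esub>"
  using eval_single[of 0 1] by (simp add: phi_one)

lemma eval_gen [simp]: "eval (gen x) = \<psi> x"
  by (simp add: gen_def eval_single phi_one)

lemma eval_scalar [simp]: "eval (scalar c) = \<phi> c"
  by (simp add: scalar_def eval_single)

text \<open>Relators are differences; this turns the demand that they evaluate to zero into
  equations without subtraction, the form in which the relations are verified.\<close>

lemma eval_diff_zero: "eval l = eval r \<Longrightarrow> eval (l - r) = \<zero>\<^bsub>R\<^esub>"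
  using eval_add[of "l - r" r] R.add.r_cancel_one'[of "eval r" "eval (l - r)"] by simp

lemma eval_ring_hom: "eval \<in> ring_hom (free_algebra A) R"
  by (rule ring_hom_memI) (simp_all add: eval_add eval_mult)

end

section \<open>Quotients of free algebras by relators\<close>

locale presentation =
  fixes A :: "'x set" and rels :: "('x free_word \<Rightarrow>\<^sub>0 'k::comm_ring_1) set"
  assumes rels_carrier: "rels \<subseteq> carrier (free_algebra A)"
begin

abbreviation "F \<equiv> free_algebra A :: ('x free_word \<Rightarrow>\<^sub>0 'k) ring"
abbreviation "Q \<equiv> presented_algebra A rels"
abbreviation "cls \<equiv> presented_class A rels"

sublocale F: ring F by (rule free_algebra_ring)
sublocale I: ideal "Idl\<^bsub>F\<^esub> rels" F by (rule F.genideal_ideal[OF rels_carrier])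
sublocale Q: ring Q unfolding presented_algebra_def by (rule I.quotient_is_ring)

lemma cls_ring_hom: "cls \<in> ring_hom F Q"
  using I.rcos_ring_hom unfolding presented_algebra_def presented_class_def[abs_def] .

lemma cls_closed [simp]: "Poly_Mapping.keys f \<subseteq> words A \<Longrightarrow> cls f \<in> carrier Q"
  using ring_hom_closed[OF cls_ring_hom] by simp

lemma carrier_presented: "carrier Q = cls ` carrier F"
  by (auto simp: presented_algebra_def presented_class_def FactRing_def A_RCOSETS_def')

lemma cls_add: "\<lbrakk>Poly_Mapping.keys f \<subseteq> words A; Poly_Mapping.keys g \<subseteq> words A\<rbrakk> \<Longrightarrow>
    cls (f + g) = cls f \<oplus>\<^bsub>Q\<^esub> cls g"
  using ring_hom_add[OF cls_ring_hom, of f g] by simp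

lemma cls_mult: "\<lbrakk>Poly_Mapping.keys f \<subseteq> words A; Poly_Mapping.keys g \<subseteq> words A\<rbrakk> \<Longrightarrow>
    cls (f * g) = cls f \<otimes>\<^bsub>Q\<^esub> cls g"
  using ring_hom_mult[OF cls_ring_hom, of f g] by simp

lemma cls_one: "cls 1 = \<one>\<^bsub>Q\<^esub>"
  using ring_hom_one[OF cls_ring_hom] by simp

text \<open>The relator belongs to the ideal it helps to generate, so its class is zero; adding
  \<open>r\<close> back turns the encoded difference into an equation of classes.\<close>

lemma cls_eqI:
  assumes "l - r \<in> rels" "Poly_Mapping.keys r \<subseteq> words A"
  shows "cls l = cls r"
proof -
  have k: "Poly_Mapping.keys (l - r) \<subseteq> words A" using assms rels_carrier by fastforce
  have "cls (l - r) = \<zero>\<^bsub>Q\<^esub>"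
    using assms(1) F.genideal_self[OF rels_carrier] k
    by (auto simp: presented_algebra_def presented_class_def FactRing_def intro!: I.a_rcos_const)
  then show ?thesis using cls_add[OF k assms(2)] assms(2) by simp
qed

lemma presented_induct [consumes 1, case_names scalar gen add mult]:
  assumes X: "X \<in> carrier Q"
    and scalar: "\<And>c. P (cls (scalar c))"
    and gen: "\<And>x. x \<in> A \<Longrightarrow> P (cls (gen x))"
    and add: "\<And>X Y. \<lbrakk>X \<in> carrier Q; Y \<in> carrier Q; P X; P Y\<rbrakk> \<Longrightarrow> P (X \<oplus>\<^bsub>Q\<^esub> Y)"
    and mult: "\<And>X Y. \<lbrakk>X \<in> carrier Q; Y \<in> carrier Q; P X; P Y\<rbrakk> \<Longrightarrow> P (X \<otimes>\<^bsub>Q\<^esub> Y)"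
  shows "P X"
proof -
  obtain f where f: "f \<in> carrier F" "X = cls f" using X carrier_presented by auto
  from f(1) have "P (cls f)"
    by (induction rule: free_algebra_induct)
      (simp_all add: scalar gen add mult cls_add cls_mult)
  with f show ?thesis by simp
qed

lemma cls_scalar_commute:
  assumes "X \<in> carrier Q"
  shows "cls (scalar c) \<otimes>\<^bsub>Q\<^esub> X = X \<otimes>\<^bsub>Q\<^esub> cls (scalar c)"
proof -
  obtain f where f: "f \<in> carrier F" "X = cls f" using assms carrier_presented by auto
  then show ?thesis
    using cls_mult[of "scalar c" f] cls_mult[of f "scalar c"] by (simp add: keys_scalar scalar_commute)
qed

lemma presented_hom_eqI:
  assumes h: "h \<in> ring_hom Q R" "h' \<in> ring_hom Q R"
    and "\<And>c. h (cls (scalar c)) = h' (cls (scalar c))"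
    and "\<And>x. x \<in> A \<Longrightarrow> h (cls (gen x)) = h' (cls (gen x))"
    and "X \<in> carrier Q"
  shows "h X = h' X"
  using assms(5)
  by (induction rule: presented_induct)
    (simp_all add: assms(3,4) ring_hom_add[OF h(1)] ring_hom_add[OF h(2)]
      ring_hom_mult[OF h(1)] ring_hom_mult[OF h(2)])

text \<open>The kernel of the evaluation is an ideal containing the relators, hence contains the
  ideal they generate. Two representatives of one class differ by an element of that ideal, so they
  have the same value.\<close>

lemma presented_universal:
  assumes ev: "free_eval R \<phi> \<psi>" and rels: "\<And>r. r \<in> rels \<Longrightarrow> free_eval.eval R \<phi> \<psi> r = \<zero>\<^bsub>R\<^esub>"
  shows "\<exists>h\<in>ring_hom Q R. h \<in> extensional (carrier Q) \<and>
    (\<forall>c. h (cls (scalar c)) = \<phi> c) \<and> (\<forall>x\<in>A. h (cls (gen x)) = \<psi> x)"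
proof -
  interpret ev: free_eval R \<phi> \<psi> by fact
  interpret hom: ring_hom_ring F R ev.eval
    by (rule ring_hom_ringI2[OF F.ring_axioms ev.R.ring_axioms ev.eval_ring_hom])
  have "rels \<subseteq> a_kernel F R ev.eval"
    using rels rels_carrier unfolding a_kernel_def' by blast
  then have ker: "Idl\<^bsub>F\<^esub> rels \<subseteq> a_kernel F R ev.eval"
    by (rule F.genideal_minimal[OF hom.kernel_is_ideal])
  have "ev.eval f = ev.eval g" if fg: "f \<in> carrier F" "g \<in> carrier F" "cls f = cls g" for f g
  proof -
    have "f \<in> Idl\<^bsub>F\<^esub> rels +>\<^bsub>F\<^esub> g"
      using I.a_rcos_self[OF fg(1)] fg(3) by (simp add: presented_class_def)
    then obtain i where "i \<in> Idl\<^bsub>F\<^esub> rels" "f = i + g" by (auto simp: a_r_coset_def')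
    moreover from this have "ev.eval i = \<zero>\<^bsub>R\<^esub>" using ker unfolding a_kernel_def' by blast
    ultimately show ?thesis by (simp add: ev.eval_add)
  qed
  \<comment> \<open>This is a factorisation of bare functions. After restriction to the quotient,
    the homomorphism laws are read off from \<open>ev.eval\<close> on representatives.\<close>
  then obtain h where h: "\<And>f. f \<in> carrier F \<Longrightarrow> ev.eval f = h (cls f)"
    using function_factors_left_gen[of "\<lambda>f. f \<in> carrier F" cls ev.eval] by blast
  let ?h = "restrict h (carrier Q)"
  have hc: "?h (cls f) = ev.eval f" if "f \<in> carrier F" for f
    using that h by simp
  show ?thesis
  proof (intro bexI[of _ ?h] conjI allI ballI)
    show "?h \<in> ring_hom Q R"
    proof (rule ring_hom_memI)
      show "?h \<one>\<^bsub>Q\<^esub> = \<one>\<^bsub>R\<^esub>" using hc[of 1] keys_one_words[of A] by (simp only: cls_one free_algebra_simps ev.eval_one)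
      fix X Y assume "X \<in> carrier Q" "Y \<in> carrier Q"
      then obtain f g where fg: "f \<in> carrier F" "X = cls f" "g \<in> carrier F" "Y = cls g"
        using carrier_presented by auto
      have "?h (X \<otimes>\<^bsub>Q\<^esub> Y) = ?h (cls (f * g))" using fg by (simp only: cls_mult free_algebra_simps)
      also have "\<dots> = ev.eval (f * g)" using fg by (intro hc) (simp add: keys_words)
      finally show "?h (X \<otimes>\<^bsub>Q\<^esub> Y) = ?h X \<otimes>\<^bsub>R\<^esub> ?h Y" using fg by (simp only: hc ev.eval_mult)
      have "?h (X \<oplus>\<^bsub>Q\<^esub> Y) = ?h (cls (f + g))" using fg by (simp only: cls_add free_algebra_simps)
      also have "\<dots> = ev.eval (f + g)" using fg by (intro hc) (simp add: keys_words)
      finally show "?h (X \<oplus>\<^bsub>Q\<^esub> Y) = ?h X \<oplus>\<^bsub>R\<^esub> ?h Y" using fg by (simp only: hc ev.eval_add)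
    next
      fix X assume "X \<in> carrier Q"
      then obtain f where fg: "f \<in> carrier F" "X = cls f" using carrier_presented by auto
      show "?h X \<in> carrier R" using fg by (simp only: hc ev.eval_closed)
    qed
    show "?h (cls (scalar c)) = \<phi> c" for c
      using hc[of "scalar c"] by (simp add: keys_scalar)
    show "x \<in> A \<Longrightarrow> ?h (cls (gen x)) = \<psi> x" for x
      using hc[of "gen x"] by (simp add: keys_gen)
  qed simp
qed

end

section \<open>The defining relations in tensor products\<close>

text \<open>The defining relations of H(S_n) for elements of any ring, to be available in
  \<open>HS n\<close> and to be verified in its tensor square. In \<open>s_D\<close> the
  \<open>1\<close> is moved to the left, so that the mixed relation collapses a sum of three terms
  to the single term \<open>s i\<close>; it is used in this direction throughout.\<close>

locale hs_family = ring R for R :: "('r, 'c) ring_scheme" (structure) +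
  fixes I :: "nat set" and s D :: "nat \<Rightarrow> 'r"
  assumes s_closed [simp]: "i \<in> I \<Longrightarrow> s i \<in> carrier R"
    and D_closed [simp]: "i \<in> I \<Longrightarrow> D i \<in> carrier R"
    and s_s: "i \<in> I \<Longrightarrow> s i \<otimes> s i = \<one>"
    and s_D: "i \<in> I \<Longrightarrow> s i \<otimes> D i \<oplus> D i \<otimes> s i \<oplus> \<one> = s i"
    and D_D: "i \<in> I \<Longrightarrow> D i \<otimes> D i = D i"
    and far_s: "\<lbrakk>i \<in> I; j \<in> I; far i j\<rbrakk> \<Longrightarrow> s j \<otimes> s i = s i \<otimes> s j"
    and far_sD: "\<lbrakk>i \<in> I; j \<in> I; far i j\<rbrakk> \<Longrightarrow> D j \<otimes> s i = s i \<otimes> D j"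
    and far_D: "\<lbrakk>i \<in> I; j \<in> I; far i j\<rbrakk> \<Longrightarrow> D j \<otimes> D i = D i \<otimes> D j"
    and adjacent_s: "\<lbrakk>i \<in> I; j \<in> I; adjacent i j\<rbrakk> \<Longrightarrow> s j \<otimes> s i \<otimes> s j = s i \<otimes> s j \<otimes> s i"
    and adjacent_Dss: "\<lbrakk>i \<in> I; j \<in> I; adjacent i j\<rbrakk> \<Longrightarrow> D i \<otimes> s j \<otimes> s i = s j \<otimes> s i \<otimes> D j"
    and adjacent_DsD: "\<lbrakk>i \<in> I; j \<in> I; adjacent i j\<rbrakk> \<Longrightarrow>
      D j \<otimes> s i \<otimes> D j = s i \<otimes> D j \<otimes> D i \<oplus> D i \<otimes> D j \<otimes> s i \<oplus> s i \<otimes> D j \<otimes> s i"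

text \<open>Here \<open>c\<close> and \<open>q\<close> stand for the images of \<open>1 - q\<close>
  and \<open>q\<close>. Keeping \<open>c\<close> as one symbol allows products to be sorted by
  powers of \<open>c\<close>.\<close>

locale hecke_family = ring R for R :: "('r, 'c) ring_scheme" (structure) +
  fixes I :: "nat set" and T :: "nat \<Rightarrow> 'r" and c q :: 'r
  assumes T_closed [simp]: "i \<in> I \<Longrightarrow> T i \<in> carrier R"
    and c_closed [simp]: "c \<in> carrier R" and q_closed [simp]: "q \<in> carrier R"
    and c_T: "i \<in> I \<Longrightarrow> T i \<otimes> c = c \<otimes> T i"
    and T_T: "i \<in> I \<Longrightarrow> T i \<otimes> T i = c \<otimes> T i \<oplus> q"
    and far_T: "\<lbrakk>i \<in> I; j \<in> I; far i j\<rbrakk> \<Longrightarrow> T i \<otimes> T j = T j \<otimes> T i"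
    and adjacent_T: "\<lbrakk>i \<in> I; j \<in> I; adjacent i j\<rbrakk> \<Longrightarrow> T i \<otimes> T j \<otimes> T i = T j \<otimes> T i \<otimes> T j"

lemma far_sym: "far i j \<Longrightarrow> far j i"
  by (simp add: far_def abs_minus_commute)

lemma adjacent_sym: "adjacent i j \<Longrightarrow> adjacent j i"
  by (simp add: adjacent_def abs_minus_commute)

context hs_family
begin

text \<open>The relation \<open>D\<^sub>j s\<^sub>i s\<^sub>j = s\<^sub>i s\<^sub>j
  D\<^sub>i\<close> moves \<open>D\<close> across a pair of involutions; inserting
  \<open>s\<^sub>j s\<^sub>j = 1\<close> makes such a pair, and \<open>s\<^sub>i s\<^sub>i\<close>
  cancels afterwards. In the braid relation this is the coefficient of \<open>c q\<close>.\<close>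

lemma adjacent_sDs:
  assumes ij: "i \<in> I" "j \<in> I" "adjacent i j"
  shows "s i \<otimes> D j \<otimes> s i = s j \<otimes> D i \<otimes> s j"
proof -
  have "s i \<otimes> D j \<otimes> s i = s i \<otimes> (D j \<otimes> s i \<otimes> s j) \<otimes> s j"
    using ij by (simp add: m_assoc s_s)
  also have "D j \<otimes> s i \<otimes> s j = s i \<otimes> s j \<otimes> D i"
    using ij adjacent_sym by (intro adjacent_Dss) auto
  also have "s i \<otimes> (s i \<otimes> s j \<otimes> D i) \<otimes> s j = s j \<otimes> D i \<otimes> s j"
    using ij by (simp add: m_assoc[symmetric] s_s)
  finally show ?thesis .
qed

text \<open>
  Multiplying the relation for \<open>D\<^sub>j s\<^sub>i D\<^sub>j\<close> on the left by the idempotent \<open>D\<^sub>j\<close> reproduces its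
  left-hand side; this forces the braid relation for the \<open>D\<^sub>i\<close>.
\<close>

lemma adjacent_D:
  assumes ij: "i \<in> I" "j \<in> I" "adjacent i j"
  shows "D i \<otimes> D j \<otimes> D i = D j \<otimes> D i \<otimes> D j"
proof -
  define X where "X = D j \<otimes> s i \<otimes> D j"
  have X: "X = s i \<otimes> D j \<otimes> D i \<oplus> D i \<otimes> D j \<otimes> s i \<oplus> s i \<otimes> D j \<otimes> s i"
    unfolding X_def by (rule adjacent_DsD[OF ij])
  have [simp]: "X \<in> carrier R" using ij by (simp add: X_def)
  have "X = D j \<otimes> X"
    using ij by (simp add: X_def m_assoc[symmetric] D_D)
  also have "\<dots> = D j \<otimes> s i \<otimes> D j \<otimes> D i \<oplus> D j \<otimes> D i \<otimes> D j \<otimes> s i \<oplus> D j \<otimes> s i \<otimes> D j \<otimes> s i"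
    using ij by (simp add: X r_distr m_assoc)
  also have "\<dots> = (X \<otimes> D i \<oplus> X \<otimes> s i) \<oplus> D j \<otimes> D i \<otimes> D j \<otimes> s i"
    using ij by (simp add: X_def[symmetric] a_ac)
  finally have 1: "(X \<otimes> D i \<oplus> X \<otimes> s i) \<oplus> D j \<otimes> D i \<otimes> D j \<otimes> s i = X" ..
  \<comment> \<open>With \<open>D\<^sub>i D\<^sub>j D\<^sub>i s\<^sub>i\<close> in place of
    \<open>D\<^sub>j D\<^sub>i D\<^sub>j s\<^sub>i\<close> the sum is again \<open>X\<close>: both
    brackets are instances of the mixed relation and collapse to \<open>s\<^sub>i\<close>. The
    common summand can then be cancelled, and after it the involution
    \<open>s\<^sub>i\<close>.\<close>
  have "(X \<otimes> D i \<oplus> X \<otimes> s i) \<oplus> D i \<otimes> D j \<otimes> D i \<otimes> s i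
      = s i \<otimes> D j \<otimes> D i \<oplus> D i \<otimes> D j \<otimes> (s i \<otimes> D i \<oplus> D i \<otimes> s i \<oplus> \<one>)
        \<oplus> s i \<otimes> D j \<otimes> (s i \<otimes> D i \<oplus> D i \<otimes> s i \<oplus> \<one>)"
    using ij by (simp add: X l_distr r_distr m_assoc D_D s_s a_ac)
  also have "\<dots> = X"
    using ij by (simp add: s_D X)
  finally have "D i \<otimes> D j \<otimes> D i \<otimes> s i = D j \<otimes> D i \<otimes> D j \<otimes> s i"
    using 1 ij add.Units_l_cancel[of "X \<otimes> D i \<oplus> X \<otimes> s i" "D i \<otimes> D j \<otimes> D i \<otimes> s i" "D j \<otimes> D i \<otimes> D j \<otimes> s i"]
    by simp
  then have "D i \<otimes> D j \<otimes> D i \<otimes> s i \<otimes> s i = D j \<otimes> D i \<otimes> D j \<otimes> s i \<otimes> s i" by simp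
  then show ?thesis using ij by (simp add: m_assoc s_s)
qed

end

section \<open>The Hecke relations for the elements
  \<open>s\<^sub>i \<otimes> T\<^sub>i + D\<^sub>i \<otimes> c\<close>\<close>

locale hs_hecke_pair = A: hs_family A I s D + B: hecke_family B I T c q
  for A :: "'a ring" and B :: "'b ring" and I s D T c q
begin

sublocale ring_pair A B ..

definition tau :: "nat \<Rightarrow> ('a \<times> 'b \<Rightarrow>\<^sub>0 int) set" where
  "tau i = pure A B (s i) (T i) \<oplus>\<^bsub>TR\<^esub> pure A B (D i) c"

lemma tau_closed [simp]: "i \<in> I \<Longrightarrow> tau i \<in> carrier TR"
  by (simp add: tau_def)

text \<open>Since \<open>s\<^sub>i\<^sup>2 = 1\<close>, the square of the first summand contributes
  \<open>1 \<otimes> c T\<^sub>i\<close> and \<open>1 \<otimes> q\<close>. The former is exactly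
  what the cross terms \<open>(s\<^sub>i D\<^sub>i + D\<^sub>i s\<^sub>i) \<otimes> c
  T\<^sub>i\<close> lack for the mixed relation.\<close>

lemma tau_quadratic:
  assumes i: "i \<in> I"
  shows "tau i \<otimes>\<^bsub>TR\<^esub> tau i = pure A B \<one>\<^bsub>A\<^esub> c \<otimes>\<^bsub>TR\<^esub> tau i \<oplus>\<^bsub>TR\<^esub> pure A B \<one>\<^bsub>A\<^esub> q"
proof -
  let ?p = "pure A B" and ?cT = "c \<otimes>\<^bsub>B\<^esub> T i"
  have "tau i \<otimes>\<^bsub>TR\<^esub> tau i
      = (?p (s i \<otimes>\<^bsub>A\<^esub> D i) ?cT \<oplus>\<^bsub>TR\<^esub> ?p (D i \<otimes>\<^bsub>A\<^esub> s i) ?cT \<oplus>\<^bsub>TR\<^esub> ?p \<one>\<^bsub>A\<^esub> ?cT)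
        \<oplus>\<^bsub>TR\<^esub> ?p (D i) (c \<otimes>\<^bsub>B\<^esub> c) \<oplus>\<^bsub>TR\<^esub> ?p \<one>\<^bsub>A\<^esub> q"
    using i by (simp add: tau_def TR.l_distr TR.r_distr A.s_s A.D_D B.T_T B.c_T pure_ring_add_right TR.a_ac)
  also have "?p (s i \<otimes>\<^bsub>A\<^esub> D i) ?cT \<oplus>\<^bsub>TR\<^esub> ?p (D i \<otimes>\<^bsub>A\<^esub> s i) ?cT \<oplus>\<^bsub>TR\<^esub> ?p \<one>\<^bsub>A\<^esub> ?cT = ?p (s i) ?cT"
    using i by (simp add: pure_ring_add_left[symmetric] A.s_D)
  also have "?p (s i) ?cT \<oplus>\<^bsub>TR\<^esub> ?p (D i) (c \<otimes>\<^bsub>B\<^esub> c) = ?p \<one>\<^bsub>A\<^esub> c \<otimes>\<^bsub>TR\<^esub> tau i"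
    using i by (simp add: tau_def TR.r_distr)
  finally show ?thesis .
qed

lemma tau_far:
  assumes ij: "i \<in> I" "j \<in> I" "far i j"
  shows "tau i \<otimes>\<^bsub>TR\<^esub> tau j = tau j \<otimes>\<^bsub>TR\<^esub> tau i"
  using ij by (simp add: tau_def TR.l_distr TR.r_distr B.c_T B.far_T[OF ij] A.far_s[OF ij] A.far_D[OF ij]
      A.far_sD[OF ij] A.far_sD[OF ij(2,1) far_sym[OF ij(3)]] TR.a_ac)

text \<open>The summands are arranged so that exchanging \<open>i\<close> and \<open>j\<close>
  permutes them up to relations. For this the terms over \<open>c\<^sup>2 T\<^sub>i\<close> are
  gathered into \<open>D\<^sub>j s\<^sub>i D\<^sub>j\<close>, the mirror image of the coefficient of
  \<open>c\<^sup>2 T\<^sub>j\<close>.\<close>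

lemma tau_expand:
  assumes ij: "i \<in> I" "j \<in> I" "adjacent i j"
  shows "tau i \<otimes>\<^bsub>TR\<^esub> tau j \<otimes>\<^bsub>TR\<^esub> tau i =
      pure A B (s i \<otimes>\<^bsub>A\<^esub> s j \<otimes>\<^bsub>A\<^esub> s i) (T i \<otimes>\<^bsub>B\<^esub> T j \<otimes>\<^bsub>B\<^esub> T i)
    \<oplus>\<^bsub>TR\<^esub> pure A B (s i \<otimes>\<^bsub>A\<^esub> s j \<otimes>\<^bsub>A\<^esub> D i) (c \<otimes>\<^bsub>B\<^esub> (T i \<otimes>\<^bsub>B\<^esub> T j))
    \<oplus>\<^bsub>TR\<^esub> pure A B (D i \<otimes>\<^bsub>A\<^esub> s j \<otimes>\<^bsub>A\<^esub> s i) (c \<otimes>\<^bsub>B\<^esub> (T j \<otimes>\<^bsub>B\<^esub> T i))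
    \<oplus>\<^bsub>TR\<^esub> pure A B (s i \<otimes>\<^bsub>A\<^esub> D j \<otimes>\<^bsub>A\<^esub> s i) (c \<otimes>\<^bsub>B\<^esub> q)
    \<oplus>\<^bsub>TR\<^esub> pure A B (D j \<otimes>\<^bsub>A\<^esub> s i \<otimes>\<^bsub>A\<^esub> D j) (c \<otimes>\<^bsub>B\<^esub> (c \<otimes>\<^bsub>B\<^esub> T i))
    \<oplus>\<^bsub>TR\<^esub> pure A B (D i \<otimes>\<^bsub>A\<^esub> s j \<otimes>\<^bsub>A\<^esub> D i) (c \<otimes>\<^bsub>B\<^esub> (c \<otimes>\<^bsub>B\<^esub> T j))
    \<oplus>\<^bsub>TR\<^esub> pure A B (D i \<otimes>\<^bsub>A\<^esub> D j \<otimes>\<^bsub>A\<^esub> D i) (c \<otimes>\<^bsub>B\<^esub> (c \<otimes>\<^bsub>B\<^esub> c))"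
proof -
  have cT: "T k \<otimes>\<^bsub>B\<^esub> (c \<otimes>\<^bsub>B\<^esub> y) = c \<otimes>\<^bsub>B\<^esub> (T k \<otimes>\<^bsub>B\<^esub> y)" if "k \<in> I" "y \<in> carrier B" for k y
    using that by (simp add: B.m_assoc[symmetric] B.c_T)
  \<comment> \<open>By \<open>T\<^sub>i\<^sup>2 = c T\<^sub>i + q\<close> the product
    \<open>s\<^sub>i D\<^sub>j s\<^sub>i \<otimes> c T\<^sub>i\<^sup>2\<close> splits. Its part over
    \<open>c\<^sup>2 T\<^sub>i\<close> joins the two products with two factors \<open>D\<close>, and
    together they form the right-hand side of the relation for
    \<open>D\<^sub>j s\<^sub>i D\<^sub>j\<close>.\<close>
  have "pure A B (D j \<otimes>\<^bsub>A\<^esub> s i \<otimes>\<^bsub>A\<^esub> D j) (c \<otimes>\<^bsub>B\<^esub> (c \<otimes>\<^bsub>B\<^esub> T i)) =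
      pure A B (s i \<otimes>\<^bsub>A\<^esub> D j \<otimes>\<^bsub>A\<^esub> D i) (c \<otimes>\<^bsub>B\<^esub> (c \<otimes>\<^bsub>B\<^esub> T i))
    \<oplus>\<^bsub>TR\<^esub> pure A B (D i \<otimes>\<^bsub>A\<^esub> D j \<otimes>\<^bsub>A\<^esub> s i) (c \<otimes>\<^bsub>B\<^esub> (c \<otimes>\<^bsub>B\<^esub> T i))
    \<oplus>\<^bsub>TR\<^esub> pure A B (s i \<otimes>\<^bsub>A\<^esub> D j \<otimes>\<^bsub>A\<^esub> s i) (c \<otimes>\<^bsub>B\<^esub> (c \<otimes>\<^bsub>B\<^esub> T i))"
    using ij by (simp only: A.adjacent_DsD) (simp add: pure_ring_add_left)
  then show ?thesis
    using ij by (simp add: tau_def TR.l_distr TR.r_distr A.m_assoc B.m_assoc B.c_T cT B.T_T B.r_distr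
        pure_ring_add_right TR.a_ac)
qed

text \<open>Exchanging \<open>i\<close> and \<open>j\<close> swaps the second summand with the
  third, by \<open>adjacent_Dss\<close>, and the fifth with the sixth literally. The other three are
  invariant by the braid relations for \<open>s\<close>, \<open>T\<close> and \<open>D\<close> and
  by \<open>adjacent_sDs\<close>.\<close>

lemma tau_adjacent:
  assumes ij: "i \<in> I" "j \<in> I" "adjacent i j"
  shows "tau i \<otimes>\<^bsub>TR\<^esub> tau j \<otimes>\<^bsub>TR\<^esub> tau i = tau j \<otimes>\<^bsub>TR\<^esub> tau i \<otimes>\<^bsub>TR\<^esub> tau j"
proof -
  note ji = ij(2,1) adjacent_sym[OF ij(3)]
  show ?thesis
    unfolding tau_expand[OF ij] tau_expand[OF ji] B.adjacent_T[OF ij] A.adjacent_s[OF ij]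
      A.adjacent_Dss[OF ij] A.adjacent_Dss[OF ji] A.adjacent_sDs[OF ij] A.adjacent_D[OF ij]
    using ij by (simp add: TR.a_ac)
qed

end

section \<open>The relations of H(S_n) in the tensor square\<close>

context hs_family
begin

definition diag_s :: "nat \<Rightarrow> ('r \<times> 'r \<Rightarrow>\<^sub>0 int) set" where
  "diag_s i = pure R R (s i) (s i)"

definition diag_D :: "nat \<Rightarrow> ('r \<times> 'r \<Rightarrow>\<^sub>0 int) set" where
  "diag_D i = pure R R (D i) \<one> \<oplus>\<^bsub>tensor_ring R R\<^esub> pure R R (s i) (D i)"

end

text \<open>This is what the existence of the comultiplication amounts to. After expansion, terms
  sharing one tensor factor are grouped, and a relation of \<open>A\<close> is applied in the other
  factor.\<close>

lemma hs_family_diagonal: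
  fixes A :: "'a ring"
  assumes "hs_family A I s D"
  shows "hs_family (tensor_ring A A) I (hs_family.diag_s A s) (hs_family.diag_D A s D)"
proof -
  interpret A: hs_family A I s D by fact
  interpret ring_pair A A ..
  note defs = A.diag_s_def A.diag_D_def
  note expand = TR.l_distr TR.r_distr A.m_assoc TR.a_ac
  show ?thesis
  proof
    fix i assume i: "i \<in> I"
    then show "A.diag_s i \<in> carrier TR" "A.diag_D i \<in> carrier TR"
      by (simp_all add: defs)
    from i show "A.diag_s i \<otimes>\<^bsub>TR\<^esub> A.diag_s i = \<one>\<^bsub>TR\<^esub>"
      by (simp add: defs A.s_s tensor_ring_simps(3))
    let ?s = "s i" and ?D = "D i"
    \<comment> \<open>The unit \<open>1 \<otimes> 1\<close> completes the mixed relation in the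
      second factor and produces \<open>1 \<otimes> s\<close>. This term in turn completes the mixed
      relation in the first factor, whose other terms have \<open>s\<close> on the right.\<close>
    have "A.diag_s i \<otimes>\<^bsub>TR\<^esub> A.diag_D i \<oplus>\<^bsub>TR\<^esub> A.diag_D i \<otimes>\<^bsub>TR\<^esub> A.diag_s i \<oplus>\<^bsub>TR\<^esub> \<one>\<^bsub>TR\<^esub>
      = pure A A (?s \<otimes>\<^bsub>A\<^esub> ?D) ?s \<oplus>\<^bsub>TR\<^esub> pure A A (?D \<otimes>\<^bsub>A\<^esub> ?s) ?s
        \<oplus>\<^bsub>TR\<^esub> (pure A A \<one>\<^bsub>A\<^esub> (?s \<otimes>\<^bsub>A\<^esub> ?D) \<oplus>\<^bsub>TR\<^esub> pure A A \<one>\<^bsub>A\<^esub> (?D \<otimes>\<^bsub>A\<^esub> ?s) \<oplus>\<^bsub>TR\<^esub> pure A A \<one>\<^bsub>A\<^esub> \<one>\<^bsub>A\<^esub>)"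
      using i by (simp add: defs expand A.s_s tensor_ring_simps(3))
    also have "pure A A \<one>\<^bsub>A\<^esub> (?s \<otimes>\<^bsub>A\<^esub> ?D) \<oplus>\<^bsub>TR\<^esub> pure A A \<one>\<^bsub>A\<^esub> (?D \<otimes>\<^bsub>A\<^esub> ?s) \<oplus>\<^bsub>TR\<^esub> pure A A \<one>\<^bsub>A\<^esub> \<one>\<^bsub>A\<^esub>
      = pure A A \<one>\<^bsub>A\<^esub> ?s"
      using i by (simp add: pure_ring_add_right[symmetric] A.s_D)
    also have "pure A A (?s \<otimes>\<^bsub>A\<^esub> ?D) ?s \<oplus>\<^bsub>TR\<^esub> pure A A (?D \<otimes>\<^bsub>A\<^esub> ?s) ?s \<oplus>\<^bsub>TR\<^esub> pure A A \<one>\<^bsub>A\<^esub> ?s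
      = A.diag_s i"
      using i by (simp add: pure_ring_add_left[symmetric] A.s_D defs)
    finally show "A.diag_s i \<otimes>\<^bsub>TR\<^esub> A.diag_D i \<oplus>\<^bsub>TR\<^esub> A.diag_D i \<otimes>\<^bsub>TR\<^esub> A.diag_s i \<oplus>\<^bsub>TR\<^esub> \<one>\<^bsub>TR\<^esub>
      = A.diag_s i" .
    have "A.diag_D i \<otimes>\<^bsub>TR\<^esub> A.diag_D i
      = pure A A ?D \<one>\<^bsub>A\<^esub> \<oplus>\<^bsub>TR\<^esub>
        (pure A A (?s \<otimes>\<^bsub>A\<^esub> ?D) ?D \<oplus>\<^bsub>TR\<^esub> pure A A (?D \<otimes>\<^bsub>A\<^esub> ?s) ?D \<oplus>\<^bsub>TR\<^esub> pure A A \<one>\<^bsub>A\<^esub> ?D)"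
      using i by (simp add: defs expand A.s_s A.D_D)
    also have "\<dots> = A.diag_D i"
      using i by (simp add: pure_ring_add_left[symmetric] A.s_D defs)
    finally show "A.diag_D i \<otimes>\<^bsub>TR\<^esub> A.diag_D i = A.diag_D i" .
  next
    fix i j assume ij: "i \<in> I" "j \<in> I" "far i j"
    note rels = A.far_s[OF ij] A.far_sD[OF ij] A.far_D[OF ij]
      A.far_sD[OF ij(2,1) far_sym[OF ij(3)]]
    show "A.diag_s j \<otimes>\<^bsub>TR\<^esub> A.diag_s i = A.diag_s i \<otimes>\<^bsub>TR\<^esub> A.diag_s j"
      "A.diag_D j \<otimes>\<^bsub>TR\<^esub> A.diag_s i = A.diag_s i \<otimes>\<^bsub>TR\<^esub> A.diag_D j"
      "A.diag_D j \<otimes>\<^bsub>TR\<^esub> A.diag_D i = A.diag_D i \<otimes>\<^bsub>TR\<^esub> A.diag_D j"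
      using ij by (simp_all add: defs TR.l_distr TR.r_distr TR.a_ac rels)
  next
    fix i j assume ij: "i \<in> I" "j \<in> I" "adjacent i j"
    note ji = ij(2,1) adjacent_sym[OF ij(3)]
    note rels = A.adjacent_s[OF ij, symmetric] A.adjacent_Dss[OF ij] A.adjacent_Dss[OF ji]
    let ?s = "s i" and ?D = "D i" and ?t = "s j" and ?E = "D j"
    show "A.diag_s j \<otimes>\<^bsub>TR\<^esub> A.diag_s i \<otimes>\<^bsub>TR\<^esub> A.diag_s j = A.diag_s i \<otimes>\<^bsub>TR\<^esub> A.diag_s j \<otimes>\<^bsub>TR\<^esub> A.diag_s i"
      "A.diag_D i \<otimes>\<^bsub>TR\<^esub> A.diag_s j \<otimes>\<^bsub>TR\<^esub> A.diag_s i = A.diag_s j \<otimes>\<^bsub>TR\<^esub> A.diag_s i \<otimes>\<^bsub>TR\<^esub> A.diag_D j"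
      using ij by (simp_all add: defs TR.l_distr TR.r_distr TR.a_ac rels)
    have 1: "A.diag_D j \<otimes>\<^bsub>TR\<^esub> A.diag_s i \<otimes>\<^bsub>TR\<^esub> A.diag_D j
      = pure A A (?E \<otimes>\<^bsub>A\<^esub> ?s \<otimes>\<^bsub>A\<^esub> ?E) ?s \<oplus>\<^bsub>TR\<^esub> pure A A (?E \<otimes>\<^bsub>A\<^esub> ?s \<otimes>\<^bsub>A\<^esub> ?t) (?s \<otimes>\<^bsub>A\<^esub> ?E)
        \<oplus>\<^bsub>TR\<^esub> pure A A (?t \<otimes>\<^bsub>A\<^esub> ?s \<otimes>\<^bsub>A\<^esub> ?E) (?E \<otimes>\<^bsub>A\<^esub> ?s)
        \<oplus>\<^bsub>TR\<^esub> pure A A (?t \<otimes>\<^bsub>A\<^esub> ?s \<otimes>\<^bsub>A\<^esub> ?t) (?E \<otimes>\<^bsub>A\<^esub> ?s \<otimes>\<^bsub>A\<^esub> ?E)"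
      using ij by (simp add: defs expand)
    have 2: "A.diag_s i \<otimes>\<^bsub>TR\<^esub> A.diag_D j \<otimes>\<^bsub>TR\<^esub> A.diag_D i
      = pure A A (?s \<otimes>\<^bsub>A\<^esub> ?E \<otimes>\<^bsub>A\<^esub> ?D) ?s \<oplus>\<^bsub>TR\<^esub> pure A A (?s \<otimes>\<^bsub>A\<^esub> ?E \<otimes>\<^bsub>A\<^esub> ?s) (?s \<otimes>\<^bsub>A\<^esub> ?D)
        \<oplus>\<^bsub>TR\<^esub> pure A A (?s \<otimes>\<^bsub>A\<^esub> ?t \<otimes>\<^bsub>A\<^esub> ?D) (?s \<otimes>\<^bsub>A\<^esub> ?E)
        \<oplus>\<^bsub>TR\<^esub> pure A A (?s \<otimes>\<^bsub>A\<^esub> ?t \<otimes>\<^bsub>A\<^esub> ?s) (?s \<otimes>\<^bsub>A\<^esub> ?E \<otimes>\<^bsub>A\<^esub> ?D)"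
      using ij by (simp add: defs expand)
    have 3: "A.diag_D i \<otimes>\<^bsub>TR\<^esub> A.diag_D j \<otimes>\<^bsub>TR\<^esub> A.diag_s i
      = pure A A (?D \<otimes>\<^bsub>A\<^esub> ?E \<otimes>\<^bsub>A\<^esub> ?s) ?s \<oplus>\<^bsub>TR\<^esub> pure A A (?D \<otimes>\<^bsub>A\<^esub> ?t \<otimes>\<^bsub>A\<^esub> ?s) (?E \<otimes>\<^bsub>A\<^esub> ?s)
        \<oplus>\<^bsub>TR\<^esub> pure A A (?s \<otimes>\<^bsub>A\<^esub> ?E \<otimes>\<^bsub>A\<^esub> ?s) (?D \<otimes>\<^bsub>A\<^esub> ?s)
        \<oplus>\<^bsub>TR\<^esub> pure A A (?s \<otimes>\<^bsub>A\<^esub> ?t \<otimes>\<^bsub>A\<^esub> ?s) (?D \<otimes>\<^bsub>A\<^esub> ?E \<otimes>\<^bsub>A\<^esub> ?s)"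
      using ij by (simp add: defs expand)
    have 4: "A.diag_s i \<otimes>\<^bsub>TR\<^esub> A.diag_D j \<otimes>\<^bsub>TR\<^esub> A.diag_s i
      = pure A A (?s \<otimes>\<^bsub>A\<^esub> ?E \<otimes>\<^bsub>A\<^esub> ?s) \<one>\<^bsub>A\<^esub> \<oplus>\<^bsub>TR\<^esub> pure A A (?s \<otimes>\<^bsub>A\<^esub> ?t \<otimes>\<^bsub>A\<^esub> ?s) (?s \<otimes>\<^bsub>A\<^esub> ?E \<otimes>\<^bsub>A\<^esub> ?s)"
      using ij by (simp add: defs expand A.s_s)
    \<comment> \<open>The left factor \<open>s\<^sub>i D\<^sub>j s\<^sub>i\<close> occurs once in
      each of the three products on the right-hand side of the relation; the mixed relation in the
      second factor merges these terms into the one required by 6. The left factor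
      \<open>s\<^sub>i s\<^sub>j s\<^sub>i\<close> is handled by 7, and the two remaining terms
      match by \<open>adjacent_Dss\<close>.\<close>
    have 5: "pure A A (?s \<otimes>\<^bsub>A\<^esub> ?E \<otimes>\<^bsub>A\<^esub> ?s) (?s \<otimes>\<^bsub>A\<^esub> ?D)
        \<oplus>\<^bsub>TR\<^esub> pure A A (?s \<otimes>\<^bsub>A\<^esub> ?E \<otimes>\<^bsub>A\<^esub> ?s) (?D \<otimes>\<^bsub>A\<^esub> ?s)
        \<oplus>\<^bsub>TR\<^esub> pure A A (?s \<otimes>\<^bsub>A\<^esub> ?E \<otimes>\<^bsub>A\<^esub> ?s) \<one>\<^bsub>A\<^esub>
      = pure A A (?s \<otimes>\<^bsub>A\<^esub> ?E \<otimes>\<^bsub>A\<^esub> ?s) ?s"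
      using ij by (simp add: pure_ring_add_right[symmetric] A.s_D)
    have 6: "pure A A (?E \<otimes>\<^bsub>A\<^esub> ?s \<otimes>\<^bsub>A\<^esub> ?E) ?s = pure A A (?s \<otimes>\<^bsub>A\<^esub> ?E \<otimes>\<^bsub>A\<^esub> ?D) ?s
        \<oplus>\<^bsub>TR\<^esub> pure A A (?D \<otimes>\<^bsub>A\<^esub> ?E \<otimes>\<^bsub>A\<^esub> ?s) ?s \<oplus>\<^bsub>TR\<^esub> pure A A (?s \<otimes>\<^bsub>A\<^esub> ?E \<otimes>\<^bsub>A\<^esub> ?s) ?s"
      unfolding A.adjacent_DsD[OF ij] using ij by (simp add: pure_ring_add_left)
    have 7: "pure A A (?t \<otimes>\<^bsub>A\<^esub> ?s \<otimes>\<^bsub>A\<^esub> ?t) (?E \<otimes>\<^bsub>A\<^esub> ?s \<otimes>\<^bsub>A\<^esub> ?E)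
      = pure A A (?s \<otimes>\<^bsub>A\<^esub> ?t \<otimes>\<^bsub>A\<^esub> ?s) (?s \<otimes>\<^bsub>A\<^esub> ?E \<otimes>\<^bsub>A\<^esub> ?D)
        \<oplus>\<^bsub>TR\<^esub> pure A A (?s \<otimes>\<^bsub>A\<^esub> ?t \<otimes>\<^bsub>A\<^esub> ?s) (?D \<otimes>\<^bsub>A\<^esub> ?E \<otimes>\<^bsub>A\<^esub> ?s)
        \<oplus>\<^bsub>TR\<^esub> pure A A (?s \<otimes>\<^bsub>A\<^esub> ?t \<otimes>\<^bsub>A\<^esub> ?s) (?s \<otimes>\<^bsub>A\<^esub> ?E \<otimes>\<^bsub>A\<^esub> ?s)"
      unfolding A.adjacent_DsD[OF ij] A.adjacent_s[OF ij] using ij by (simp add: pure_ring_add_right)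
    show "A.diag_D j \<otimes>\<^bsub>TR\<^esub> A.diag_s i \<otimes>\<^bsub>TR\<^esub> A.diag_D j
      = A.diag_s i \<otimes>\<^bsub>TR\<^esub> A.diag_D j \<otimes>\<^bsub>TR\<^esub> A.diag_D i
        \<oplus>\<^bsub>TR\<^esub> A.diag_D i \<otimes>\<^bsub>TR\<^esub> A.diag_D j \<otimes>\<^bsub>TR\<^esub> A.diag_s i
        \<oplus>\<^bsub>TR\<^esub> A.diag_s i \<otimes>\<^bsub>TR\<^esub> A.diag_D j \<otimes>\<^bsub>TR\<^esub> A.diag_s i"
      unfolding 1 2 3 4 6 7 5[symmetric] A.adjacent_Dss[OF ij] A.adjacent_Dss[OF ji]
      using ij by (simp add: TR.a_ac)
  qed
qed

text \<open>Coefficients enter the tensor ring through the second factor. For the coaction this is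
  the prescribed linearity over Laurent polynomials; for the comultiplication the coefficients are
  integers.\<close>

lemma (in ring_pair) pure_one_scalars:
  assumes "\<And>c. \<sigma> c \<in> carrier B" "\<And>c d. \<sigma> (c + d) = \<sigma> c \<oplus>\<^bsub>B\<^esub> \<sigma> d"
    "\<And>c d. \<sigma> (c * d) = \<sigma> c \<otimes>\<^bsub>B\<^esub> \<sigma> d" "\<sigma> 1 = \<one>\<^bsub>B\<^esub>"
    and "\<And>x. \<psi> x \<in> carrier TR"
    and "\<And>c x. pure A B \<one>\<^bsub>A\<^esub> (\<sigma> c) \<otimes>\<^bsub>TR\<^esub> \<psi> x = \<psi> x \<otimes>\<^bsub>TR\<^esub> pure A B \<one>\<^bsub>A\<^esub> (\<sigma> c)"
  shows "free_eval TR (\<lambda>c. pure A B \<one>\<^bsub>A\<^esub> (\<sigma> c)) \<psi>"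
  using assms by unfold_locales (simp_all add: pure_ring_add_right tensor_ring_simps(3))

lemma (in presentation) cls_scalar_simps:
  "cls (scalar c) \<in> carrier Q"
  "cls (scalar (c + d)) = cls (scalar c) \<oplus>\<^bsub>Q\<^esub> cls (scalar d)"
  "cls (scalar (c * d)) = cls (scalar c) \<otimes>\<^bsub>Q\<^esub> cls (scalar d)"
  "cls (scalar 1) = \<one>\<^bsub>Q\<^esub>"
  by (simp_all add: keys_scalar scalar_add scalar_mult scalar_one cls_add cls_mult cls_one)

subsection \<open>The comultiplication of \<open>H(S\<^sub>n)\<close>\<close>

lemma HS_gens_mem: "i \<in> {1..n-1} \<Longrightarrow> SGen i \<in> HS_gens n" "i \<in> {1..n-1} \<Longrightarrow> DGen i \<in> HS_gens n"
  by (auto simp: HS_gens_def)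

lemma HS_presentation: "presentation (HS_gens n) (HS_rels n)"
proof
  show "HS_rels n \<subseteq> carrier (free_algebra (HS_gens n))"
    unfolding HS_rels_def Let_def free_algebra_simps
    by (intro Un_least UN_least subsetI; elim insertE emptyE;
        simp only: free_algebra_simps; intro keys_words HS_gens_mem; simp)
qed

lemma HS_hs_family: "hs_family (HS n) {1..n-1} (HS_s n) (HS_D n)"
proof -
  define I where "I = {1..n-1}"
  interpret HS: presentation "HS_gens n" "HS_rels n" by (rule HS_presentation)
  have k: "Poly_Mapping.keys (gen (SGen i) :: _ \<Rightarrow>\<^sub>0 int) \<subseteq> words (HS_gens n)"
    "Poly_Mapping.keys (gen (DGen i) :: _ \<Rightarrow>\<^sub>0 int) \<subseteq> words (HS_gens n)" if "i \<in> I" for i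
    using that HS_gens_mem unfolding I_def by (simp_all add: keys_gen)
  note simps = HS_s_def HS_D_def k keys_subset_add keys_mult_words keys_one_words
    HS.cls_add[symmetric] HS.cls_mult[symmetric] HS.cls_one[symmetric]
  \<comment> \<open>The mixed relator is rewritten so that its two sides are those of
    \<open>s_D\<close> in \<open>hs_family\<close>.\<close>
  have diff: "(a + b) - (c - 1) = (a + b + 1) - c" for a b c :: "hs_gen free_word \<Rightarrow>\<^sub>0 int"
    by (simp add: algebra_simps)
  note rels = HS_rels_def Let_def I_def[symmetric] diff
  have "hs_family HS.Q I (HS_s n) (HS_D n)"
  proof
    fix i assume "i \<in> I"
    then show "HS_s n i \<in> carrier HS.Q" "HS_D n i \<in> carrier HS.Q"
      by (simp_all add: HS_s_def HS_D_def k)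
  qed (simp_all only: simps, (rule HS.cls_eqI, unfold rels, blast,
        intro keys_subset_add keys_mult_words keys_one_words k; assumption)+)
  then show ?thesis by (simp add: HS_def I_def)
qed

text \<open>The universal property of \<open>HS n\<close> for families satisfying the relations. An
  assignment in \<open>free_eval\<close> must map all of \<open>hs_gen\<close> into the carrier,
  hence the default value zero for indices outside \<open>{1..n-1}\<close>.\<close>

lemma hs_family_hom:
  fixes \<phi> :: "int \<Rightarrow> 'r"
  assumes fam: "hs_family R {1..n-1} s D"
    and ev: "free_eval R \<phi> (\<lambda>g. case g of
        SGen i \<Rightarrow> if i \<in> {1..n-1} then s i else \<zero>\<^bsub>R\<^esub> | DGen i \<Rightarrow> if i \<in> {1..n-1} then D i else \<zero>\<^bsub>R\<^esub>)"
  shows "\<exists>h\<in>ring_hom (HS n) R. h \<in> extensional (carrier (HS n)) \<and>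
    (\<forall>i\<in>{1..n-1}. h (HS_s n i) = s i \<and> h (HS_D n i) = D i)"
proof -
  define I where "I = {1..n-1}"
  let ?\<psi> = "\<lambda>g. case g of
      SGen i \<Rightarrow> if i \<in> I then s i else \<zero>\<^bsub>R\<^esub> | DGen i \<Rightarrow> if i \<in> I then D i else \<zero>\<^bsub>R\<^esub>"
  interpret HS: presentation "HS_gens n" "HS_rels n" by (rule HS_presentation)
  interpret R: hs_family R I s D unfolding I_def by (rule fam)
  note ev = ev[folded I_def]
  interpret ev: free_eval R \<phi> ?\<psi> by (rule ev)
  have g: "ev.eval (gen (SGen i)) = s i" "ev.eval (gen (DGen i)) = D i" if "i \<in> I" for i
    using that by simp_all
  have diff: "(a + b) - (c - 1) = (a + b + 1) - c" for a b c :: "hs_gen free_word \<Rightarrow>\<^sub>0 int"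
    by (simp add: algebra_simps)
  have "ev.eval r = \<zero>\<^bsub>R\<^esub>" if "r \<in> HS_rels n" for r
    using that
    unfolding HS_rels_def Let_def I_def[symmetric] diff
    by (elim UnE UN_E insertE emptyE CollectE conjE, simp_all only:, rule_tac [!] ev.eval_diff_zero,
        simp_all only: ev.eval_mult ev.eval_add ev.eval_one g)
      (rule R.s_s R.s_D R.D_D R.far_s R.far_sD R.far_D R.adjacent_s R.adjacent_Dss R.adjacent_DsD;
        assumption)+
  from HS.presented_universal[OF ev this] obtain h
    where h: "h \<in> ring_hom HS.Q R" "h \<in> extensional (carrier HS.Q)"
      "\<forall>x\<in>HS_gens n. h (HS.cls (gen x)) = ?\<psi> x"
    by blast
  have "h (HS_s n i) = s i \<and> h (HS_D n i) = D i" if "i \<in> I" for i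
    using bspec[OF h(3) HS_gens_mem(1)[OF that[unfolded I_def]]]
      bspec[OF h(3) HS_gens_mem(2)[OF that[unfolded I_def]]] that
    by (simp add: HS_s_def HS_D_def)
  then show ?thesis
    using h(1,2) unfolding HS_def I_def by blast
qed

text \<open>Agreement on the coefficients is automatic: they are integer multiples of the unit, and
  both maps preserve units and sums. An induction upwards and downwards from zero makes this
  precise.\<close>

lemma HS_hom_eqI:
  assumes R: "ring R" and h: "h \<in> ring_hom (HS n) R" "h' \<in> ring_hom (HS n) R"
    and s: "\<And>i. i \<in> {1..n-1} \<Longrightarrow> h (HS_s n i) = h' (HS_s n i)"
    and D: "\<And>i. i \<in> {1..n-1} \<Longrightarrow> h (HS_D n i) = h' (HS_D n i)"
    and X: "X \<in> carrier (HS n)"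
  shows "h X = h' X"
proof -
  interpret R: ring R by fact
  interpret HS: presentation "HS_gens n" "HS_rels n" by (rule HS_presentation)
  note h = h[unfolded HS_def]
  have step: "h (HS.cls (scalar (c + 1))) = h (HS.cls (scalar c)) \<oplus>\<^bsub>R\<^esub> \<one>\<^bsub>R\<^esub>"
    if "h \<in> ring_hom HS.Q R" for h c
    using ring_hom_add[OF that, of "HS.cls (scalar c)" "\<one>\<^bsub>HS.Q\<^esub>"] ring_hom_one[OF that]
    by (simp add: HS.cls_scalar_simps)
  have zero: "h (HS.cls (scalar 0)) = \<zero>\<^bsub>R\<^esub>" if "h \<in> ring_hom HS.Q R" for h
    using ring_hom_zero[OF that HS.Q.ring_axioms R] HS.cls_scalar_simps(2)[of 0 0]
      HS.Q.add.l_cancel_one'[OF HS.cls_scalar_simps(1) HS.cls_scalar_simps(1), of 0 0]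
    by simp
  have closed: "h (HS.cls (scalar c)) \<in> carrier R" if "h \<in> ring_hom HS.Q R" for h c
    using ring_hom_closed[OF that] HS.cls_scalar_simps(1) by simp
  have scalar: "h (HS.cls (scalar c)) = h' (HS.cls (scalar c))" for c
  proof (induction c rule: int_induct[where k = 0])
    case base
    then show ?case by (simp add: zero h)
  next
    case (step1 i)
    then show ?case by (simp only: step[OF h(1)] step[OF h(2)])
  next
    \<comment> \<open>Downwards, the unit that separates the values at \<open>i - 1\<close> and
      \<open>i\<close> is cancelled in \<open>R\<close>.\<close>
    case (step2 i)
    then show ?case
      using step[OF h(1), of "i - 1"] step[OF h(2), of "i - 1"] closed[OF h(1)] closed[OF h(2)]
      by simp
  qed
  have "h (HS.cls (gen x)) = h' (HS.cls (gen x))" if "x \<in> HS_gens n" for x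
    using that s D unfolding HS_gens_def HS_s_def HS_D_def by blast
  with scalar show ?thesis
    using HS.presented_hom_eqI[OF h] X[unfolded HS_def] by blast
qed

text \<open>The description in \<open>HS_comult\<close> is justified here: existence by the
  relations in the tensor square, uniqueness by the values on the generators.\<close>

lemma HS_comult_exists1:
  "\<exists>!\<Delta>. \<Delta> \<in> ring_hom (HS n) (tensor_ring (HS n) (HS n)) \<inter> extensional (carrier (HS n)) \<and>
    (\<forall>i\<in>{1..n-1}. \<Delta> (HS_s n i) = pure (HS n) (HS n) (HS_s n i) (HS_s n i) \<and>
       \<Delta> (HS_D n i) = pure (HS n) (HS n) (HS_D n i) \<one>\<^bsub>HS n\<^esub>
         \<oplus>\<^bsub>tensor_ring (HS n) (HS n)\<^esub> pure (HS n) (HS n) (HS_s n i) (HS_D n i))"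
proof -
  interpret HS: presentation "HS_gens n" "HS_rels n" by (rule HS_presentation)
  note scalars = HS.cls_scalar_simps[folded HS_def] HS.cls_scalar_commute[folded HS_def]
  interpret fam: hs_family "HS n" "{1..n-1}" "HS_s n" "HS_D n" by (rule HS_hs_family)
  interpret ring_pair "HS n" "HS n" ..
  interpret diag: hs_family TR "{1..n-1}" fam.diag_s fam.diag_D
    by (rule hs_family_diagonal[OF HS_hs_family])
  \<comment> \<open>There is only one unital ring homomorphism from the integers; it is written
    through the second factor to fit \<open>pure_one_scalars\<close>.\<close>
  let ?\<phi> = "\<lambda>c. pure (HS n) (HS n) \<one>\<^bsub>HS n\<^esub> (HS.cls (scalar c))"
  have "?\<phi> c \<otimes>\<^bsub>TR\<^esub> fam.diag_s i = fam.diag_s i \<otimes>\<^bsub>TR\<^esub> ?\<phi> c"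
    "?\<phi> c \<otimes>\<^bsub>TR\<^esub> fam.diag_D i = fam.diag_D i \<otimes>\<^bsub>TR\<^esub> ?\<phi> c" if "i \<in> {1..n-1}" for c i
    using fam.s_closed[OF that] fam.D_closed[OF that]
    by (simp_all add: fam.diag_s_def fam.diag_D_def scalars TR.l_distr TR.r_distr)
  note commute = this
  have "free_eval TR ?\<phi> (\<lambda>g. case g of
        SGen i \<Rightarrow> if i \<in> {1..n-1} then fam.diag_s i else \<zero>\<^bsub>TR\<^esub>
      | DGen i \<Rightarrow> if i \<in> {1..n-1} then fam.diag_D i else \<zero>\<^bsub>TR\<^esub>)" (is "free_eval TR _ ?\<psi>")
  proof (rule pure_one_scalars)
    fix g c
    show "?\<psi> g \<in> carrier TR"
      using diag.s_closed diag.D_closed by (auto simp del: atLeastAtMost_iff split: hs_gen.split)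
    show "?\<phi> c \<otimes>\<^bsub>TR\<^esub> ?\<psi> g = ?\<psi> g \<otimes>\<^bsub>TR\<^esub> ?\<phi> c"
      using commute by (cases g) (simp_all del: atLeastAtMost_iff add: scalars(1))
  qed (rule scalars)+
  from hs_family_hom[OF diag.hs_family_axioms this] obtain h
    where h: "h \<in> ring_hom (HS n) TR" "h \<in> extensional (carrier (HS n))"
      "\<forall>i\<in>{1..n-1}. h (HS_s n i) = fam.diag_s i \<and> h (HS_D n i) = fam.diag_D i"
    by blast
  show ?thesis
  proof (rule ex1I[of _ h])
    show "h \<in> ring_hom (HS n) TR \<inter> extensional (carrier (HS n)) \<and>
      (\<forall>i\<in>{1..n-1}. h (HS_s n i) = pure (HS n) (HS n) (HS_s n i) (HS_s n i) \<and>
       h (HS_D n i) = pure (HS n) (HS n) (HS_D n i) \<one>\<^bsub>HS n\<^esub>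
         \<oplus>\<^bsub>TR\<^esub> pure (HS n) (HS n) (HS_s n i) (HS_D n i))"
      using h unfolding fam.diag_s_def fam.diag_D_def by blast
  next
    fix h' assume h': "h' \<in> ring_hom (HS n) TR \<inter> extensional (carrier (HS n)) \<and>
      (\<forall>i\<in>{1..n-1}. h' (HS_s n i) = pure (HS n) (HS n) (HS_s n i) (HS_s n i) \<and>
       h' (HS_D n i) = pure (HS n) (HS n) (HS_D n i) \<one>\<^bsub>HS n\<^esub>
         \<oplus>\<^bsub>TR\<^esub> pure (HS n) (HS n) (HS_s n i) (HS_D n i))"
    show "h' = h"
    proof (rule extensionalityI[of _ "carrier (HS n)"])
      fix X assume "X \<in> carrier (HS n)"
      then show "h' X = h X"
        by (rule HS_hom_eqI[OF TR.ring_axioms, rotated -1])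
          (use h h' in \<open>simp_all add: fam.diag_s_def fam.diag_D_def\<close>)
    qed (use h h' in auto)
  qed
qed

lemmas HS_comult_spec = theI'[OF HS_comult_exists1, folded HS_comult_def[unfolded Let_def]]

lemma HS_comult_hom: "HS_comult n \<in> ring_hom (HS n) (tensor_ring (HS n) (HS n))"
  using HS_comult_spec by blast

lemma HS_comult_s:
  "i \<in> {1..n-1} \<Longrightarrow> HS_comult n (HS_s n i) = pure (HS n) (HS n) (HS_s n i) (HS_s n i)"
  using HS_comult_spec by blast

lemma HS_comult_D:
  "i \<in> {1..n-1} \<Longrightarrow> HS_comult n (HS_D n i) = pure (HS n) (HS n) (HS_D n i) \<one>\<^bsub>HS n\<^esub>
     \<oplus>\<^bsub>tensor_ring (HS n) (HS n)\<^esub> pure (HS n) (HS n) (HS_s n i) (HS_D n i)"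
  using HS_comult_spec by blast

subsection \<open>The coaction on the Hecke algebra\<close>

lemma Hq_presentation: "presentation {1..n-1} (Hq_rels n)"
proof
  show "Hq_rels n \<subseteq> carrier (free_algebra {1..n-1})"
    unfolding Hq_rels_def Let_def
    by (intro Un_least UN_least subsetI; elim insertE emptyE;
        simp only: free_algebra_simps; intro keys_words; simp)
qed

lemma Hq_hecke_family:
  "hecke_family (Hq n) {1..n-1} (Hq_T n) (Hq_scalar n (1 - q_var)) (Hq_scalar n q_var)"
proof -
  define I where "I = {1..n-1}"
  interpret Hq: presentation I "Hq_rels n" unfolding I_def by (rule Hq_presentation)
  have defs: "Hq_T n i = Hq.cls (gen i)" "Hq_scalar n c = Hq.cls (scalar c)" for i c
    by (simp_all add: Hq_T_def Hq_scalar_def I_def)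
  note simps = defs keys_gen keys_subset_add keys_mult_words keys_scalar
    Hq.cls_add[symmetric] Hq.cls_mult[symmetric]
  note rels = Hq_rels_def Let_def I_def[symmetric]
  have "hecke_family Hq.Q I (Hq_T n) (Hq_scalar n (1 - q_var)) (Hq_scalar n q_var)"
  proof
    fix i assume "i \<in> I"
    then show "Hq_T n i \<in> carrier Hq.Q"
      "Hq_T n i \<otimes>\<^bsub>Hq.Q\<^esub> Hq_scalar n (1 - q_var) = Hq_scalar n (1 - q_var) \<otimes>\<^bsub>Hq.Q\<^esub> Hq_T n i"
      by (simp_all add: defs keys_gen Hq.cls_scalar_commute)
  next
    show "Hq_scalar n (1 - q_var) \<in> carrier Hq.Q" "Hq_scalar n q_var \<in> carrier Hq.Q"
      by (simp_all add: defs keys_scalar)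
  qed (simp_all only: simps, (rule Hq.cls_eqI, unfold rels, blast,
        intro keys_subset_add keys_mult_words keys_gen keys_scalar; assumption)+)
  then show ?thesis by (simp add: Hq_def I_def)
qed

text \<open>Laurent coefficients, in contrast to integers, are not sums of units and their
  negatives. Uniqueness therefore uses the prescribed values on \<open>Hq_scalar\<close> as well as
  those on the \<open>T\<^sub>i\<close>.\<close>

lemma Hq_coaction_exists1:
  "\<exists>!\<delta>. \<delta> \<in> ring_hom (Hq n) (tensor_ring (HS n) (Hq n)) \<inter> extensional (carrier (Hq n)) \<and>
    (\<forall>c. \<delta> (Hq_scalar n c) = pure (HS n) (Hq n) \<one>\<^bsub>HS n\<^esub> (Hq_scalar n c)) \<and>
    (\<forall>i\<in>{1..n-1}. \<delta> (Hq_T n i) = pure (HS n) (Hq n) (HS_s n i) (Hq_T n i)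
       \<oplus>\<^bsub>tensor_ring (HS n) (Hq n)\<^esub> pure (HS n) (Hq n) (HS_D n i) (Hq_scalar n (1 - q_var)))"
proof -
  define I where "I = {1..n-1}"
  interpret Hq: presentation I "Hq_rels n" unfolding I_def by (rule Hq_presentation)
  have Hq: "Hq.Q = Hq n" by (simp add: Hq_def I_def)
  interpret hs_hecke_pair "HS n" "Hq n" I "HS_s n" "HS_D n" "Hq_T n"
      "Hq_scalar n (1 - q_var)" "Hq_scalar n q_var"
    using HS_hs_family Hq_hecke_family by (simp add: hs_hecke_pair_def I_def)
  have sc: "Hq_scalar n c = Hq.cls (scalar c)" for c
    by (simp add: Hq_scalar_def I_def)
  have sc_closed: "Hq_scalar n c \<in> carrier (Hq n)" for c
    unfolding sc by (rule Hq.cls_scalar_simps[unfolded Hq])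
  have T: "Hq_T n i = Hq.cls (gen i)" for i
    by (simp add: Hq_T_def I_def)
  let ?\<phi> = "\<lambda>c. pure (HS n) (Hq n) \<one>\<^bsub>HS n\<^esub> (Hq_scalar n c)"
  let ?\<psi> = "\<lambda>i. if i \<in> I then tau i else \<zero>\<^bsub>TR\<^esub>"
  have "?\<phi> c \<otimes>\<^bsub>TR\<^esub> tau i = tau i \<otimes>\<^bsub>TR\<^esub> ?\<phi> c" if "i \<in> I" for c i
    using that Hq.cls_scalar_commute[folded sc, unfolded Hq, of "Hq_T n i" c]
      Hq.cls_scalar_commute[folded sc, unfolded Hq, of "Hq_scalar n (1 - q_var)" c]
    by (simp add: tau_def sc_closed TR.l_distr TR.r_distr)
  note commute = this
  have ev: "free_eval TR ?\<phi> ?\<psi>"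
  proof (rule pure_one_scalars)
    fix i c
    show "?\<psi> i \<in> carrier TR" by simp
    show "?\<phi> c \<otimes>\<^bsub>TR\<^esub> ?\<psi> i = ?\<psi> i \<otimes>\<^bsub>TR\<^esub> ?\<phi> c"
      using commute by (simp add: sc_closed)
  qed (rule Hq.cls_scalar_simps[folded sc, unfolded Hq])+
  interpret ev: free_eval TR ?\<phi> ?\<psi> by (rule ev)
  have g: "ev.eval (gen i) = tau i" if "i \<in> I" for i
    using that by simp
  have "ev.eval r = \<zero>\<^bsub>TR\<^esub>" if "r \<in> Hq_rels n" for r
    using that
    unfolding Hq_rels_def Let_def I_def[symmetric]
    by (elim UnE UN_E insertE emptyE CollectE conjE, simp_all only:, rule_tac [!] ev.eval_diff_zero,
        simp_all only: ev.eval_mult ev.eval_add ev.eval_scalar g)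
      (rule tau_quadratic tau_far tau_adjacent; assumption)+
  from Hq.presented_universal[OF ev this, unfolded Hq] obtain h
    where h: "h \<in> ring_hom (Hq n) TR" "h \<in> extensional (carrier (Hq n))"
      "\<forall>c. h (Hq.cls (scalar c)) = ?\<phi> c" "\<forall>x\<in>I. h (Hq.cls (gen x)) = ?\<psi> x"
    by blast
  show ?thesis
    unfolding I_def[symmetric]
  proof (rule ex1I[of _ h])
    show "h \<in> ring_hom (Hq n) TR \<inter> extensional (carrier (Hq n)) \<and>
      (\<forall>c. h (Hq_scalar n c) = ?\<phi> c) \<and>
      (\<forall>i\<in>I. h (Hq_T n i) = pure (HS n) (Hq n) (HS_s n i) (Hq_T n i)
         \<oplus>\<^bsub>TR\<^esub> pure (HS n) (Hq n) (HS_D n i) (Hq_scalar n (1 - q_var)))"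
      using h[folded sc T] by (simp add: tau_def)
  next
    fix h' assume h': "h' \<in> ring_hom (Hq n) TR \<inter> extensional (carrier (Hq n)) \<and>
      (\<forall>c. h' (Hq_scalar n c) = ?\<phi> c) \<and>
      (\<forall>i\<in>I. h' (Hq_T n i) = pure (HS n) (Hq n) (HS_s n i) (Hq_T n i)
         \<oplus>\<^bsub>TR\<^esub> pure (HS n) (Hq n) (HS_D n i) (Hq_scalar n (1 - q_var)))"
    show "h' = h"
    proof (rule extensionalityI[of _ "carrier (Hq n)"])
      fix X assume "X \<in> carrier (Hq n)"
      then show "h' X = h X"
        by (rule Hq.presented_hom_eqI[folded sc T, unfolded Hq, rotated -1])
          (use h[folded sc T] h' in \<open>simp_all add: tau_def\<close>)
    qed (use h h' in auto)
  qed
qed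

lemmas Hq_coaction_spec = theI'[OF Hq_coaction_exists1, folded Hq_coaction_def[unfolded Let_def]]

lemma Hq_coaction_hom: "Hq_coaction n \<in> ring_hom (Hq n) (tensor_ring (HS n) (Hq n))"
  using Hq_coaction_spec by blast

lemma Hq_coaction_scalar:
  "Hq_coaction n (Hq_scalar n c) = pure (HS n) (Hq n) \<one>\<^bsub>HS n\<^esub> (Hq_scalar n c)"
  using Hq_coaction_spec by blast

lemma Hq_coaction_T:
  "i \<in> {1..n-1} \<Longrightarrow> Hq_coaction n (Hq_T n i) = pure (HS n) (Hq n) (HS_s n i) (Hq_T n i)
     \<oplus>\<^bsub>tensor_ring (HS n) (Hq n)\<^esub> pure (HS n) (Hq n) (HS_D n i) (Hq_scalar n (1 - q_var))"
  using Hq_coaction_spec by blast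

section \<open>Associativity of the tensor product\<close>

text \<open>
  The universal property is only needed for targets with carrier in \<open>'u\<close>, which makes it
  expressible as a locale assumption.
\<close>

locale tensor_like = M: abelian_group M + N: abelian_group N + T: abelian_group T
  for M :: "('u, 'c) ring_scheme" and N :: "('u, 'd) ring_scheme" and T :: "('u, 'e) ring_scheme" +
  fixes p :: "'u \<Rightarrow> 'u \<Rightarrow> 'u"
  assumes p_biadditive: "biadditive M N (add_monoid T) p"
    and p_induct [consumes 1, case_names pure add]:
      "\<lbrakk>z \<in> carrier T; \<And>x y. \<lbrakk>x \<in> carrier M; y \<in> carrier N\<rbrakk> \<Longrightarrow> Q (p x y);
        \<And>u v. \<lbrakk>u \<in> carrier T; v \<in> carrier T; Q u; Q v\<rbrakk> \<Longrightarrow> Q (u \<oplus>\<^bsub>T\<^esub> v)\<rbrakk> \<Longrightarrow> Q z"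
    and p_universal_monoid: "\<lbrakk>comm_group (G :: 'u monoid); biadditive M N G f\<rbrakk> \<Longrightarrow>
      \<exists>h\<in>hom (add_monoid T) G. h \<in> extensional (carrier T) \<and>
        (\<forall>x\<in>carrier M. \<forall>y\<in>carrier N. h (p x y) = f x y)"
begin

lemmas p_simps = biadditiveD[OF p_biadditive, simplified]

lemma p_universal:
  assumes "abelian_group (X :: ('u, 'x) ring_scheme)" and f: "biadditive M N (add_monoid X) f"
  shows "\<exists>h\<in>hom (add_monoid T) (add_monoid X). h \<in> extensional (carrier T) \<and>
    (\<forall>x\<in>carrier M. \<forall>y\<in>carrier N. h (p x y) = f x y)"
proof -
  interpret X: abelian_group X by fact
  \<comment> \<open>The record \<open>add_monoid X\<close> may have an extended type, while the
    locale assumption speaks of plain monoids; so the additive group is copied into a plain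
    record.\<close>
  let ?G = "\<lparr>carrier = carrier X, monoid.mult = add X, one = \<zero>\<^bsub>X\<^esub>\<rparr>"
  have "comm_group ?G"
    by (rule comm_groupI) (auto simp: X.a_ac intro: X.l_neg)
  moreover have "biadditive M N ?G f" using f by (simp add: biadditive_def)
  ultimately obtain h where "h \<in> hom (add_monoid T) ?G" "h \<in> extensional (carrier T)"
    "\<forall>x\<in>carrier M. \<forall>y\<in>carrier N. h (p x y) = f x y"
    using p_universal_monoid by blast
  then show ?thesis by (intro bexI[of _ h]) (simp_all add: hom_def)
qed

lemma p_hom_eqI:
  assumes "h \<in> hom (add_monoid T) G" "h' \<in> hom (add_monoid T) G"
    and "\<And>x y. \<lbrakk>x \<in> carrier M; y \<in> carrier N\<rbrakk> \<Longrightarrow> h (p x y) = h' (p x y)"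
    and "z \<in> carrier T"
  shows "h z = h' z"
  using assms(4)
  by (induction rule: p_induct)
    (use assms(3) hom_mult[OF assms(1)] hom_mult[OF assms(2)] in auto)

lemma p_ext_hom_eqI:
  assumes "h \<in> hom (add_monoid T) G" "h' \<in> hom (add_monoid T) G"
    and "h \<in> extensional (carrier T)" "h' \<in> extensional (carrier T)"
    and "\<And>x y. \<lbrakk>x \<in> carrier M; y \<in> carrier N\<rbrakk> \<Longrightarrow> h (p x y) = h' (p x y)"
  shows "h = h'"
  using assms(3,4) p_hom_eqI[OF assms(1,2,5)] by (rule extensionalityI)

end

lemma hom_add_monoidI:
  assumes "\<And>x. x \<in> carrier T \<Longrightarrow> h x \<in> carrier X"
    and "\<And>x y. \<lbrakk>x \<in> carrier T; y \<in> carrier T\<rbrakk> \<Longrightarrow> h (x \<oplus>\<^bsub>T\<^esub> y) = h x \<oplus>\<^bsub>X\<^esub> h y"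
  shows "h \<in> hom (add_monoid T) (add_monoid X)"
  using assms by (simp add: hom_def)

lemma hom_add_monoidD:
  assumes "h \<in> hom (add_monoid T) (add_monoid X)"
  shows "x \<in> carrier T \<Longrightarrow> h x \<in> carrier X"
    and "\<lbrakk>x \<in> carrier T; y \<in> carrier T\<rbrakk> \<Longrightarrow> h (x \<oplus>\<^bsub>T\<^esub> y) = h x \<oplus>\<^bsub>X\<^esub> h y"
  using hom_in_carrier[OF assms] hom_mult[OF assms] by simp_all

locale tensor_assoc =
  MN: tensor_like M N P p1 + PV: tensor_like P V L p2 +
  NV: tensor_like N V Q p3 + MQ: tensor_like M Q R p4
  for M :: "('u, 'c1) ring_scheme" and N :: "('u, 'c2) ring_scheme" and V :: "('u, 'c3) ring_scheme"
    and P :: "('u, 'c4) ring_scheme" and Q :: "('u, 'c5) ring_scheme"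
    and L :: "('u, 'c6) ring_scheme" and R :: "('u, 'c7) ring_scheme" and p1 p2 p3 p4
begin

text \<open>A map of three variables is lifted in two stages: for fixed \<open>v\<close> over
  \<open>M\<close> and \<open>N\<close>, giving \<open>g v\<close> on \<open>P\<close>, and then
  over \<open>P\<close> and \<open>V\<close>.\<close>

lemma assoc_forward:
  "\<exists>h\<in>hom (add_monoid L) (add_monoid R). h \<in> extensional (carrier L) \<and>
    (\<forall>x\<in>carrier M. \<forall>y\<in>carrier N. \<forall>v\<in>carrier V. h (p2 (p1 x y) v) = p4 x (p3 y v))"
proof -
  have "\<exists>g\<in>hom (add_monoid P) (add_monoid R).
      \<forall>x\<in>carrier M. \<forall>y\<in>carrier N. g (p1 x y) = p4 x (p3 y v)" if v: "v \<in> carrier V" for v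
  proof -
    have "biadditive M N (add_monoid R) (\<lambda>x y. p4 x (p3 y v))"
      using v by (intro biadditiveI) (simp_all add: NV.p_simps MQ.p_simps)
    from MN.p_universal[OF MQ.T.abelian_group_axioms this] show ?thesis by blast
  qed
  then obtain g where g: "\<And>v. v \<in> carrier V \<Longrightarrow> g v \<in> hom (add_monoid P) (add_monoid R)"
    and gp: "\<And>v x y. \<lbrakk>v \<in> carrier V; x \<in> carrier M; y \<in> carrier N\<rbrakk> \<Longrightarrow> g v (p1 x y) = p4 x (p3 y v)"
    by metis
  have "biadditive P V (add_monoid R) (\<lambda>z v. g v z)"
  proof (rule biadditiveI; simp only: monoid.simps partial_object.simps)
    fix z v assume z: "z \<in> carrier P" and v: "v \<in> carrier V"
    show "g v z \<in> carrier R" using hom_add_monoidD[OF g[OF v]] z by blast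
  next
    fix z z' v assume z: "z \<in> carrier P" "z' \<in> carrier P" and v: "v \<in> carrier V"
    show "g v (z \<oplus>\<^bsub>P\<^esub> z') = g v z \<oplus>\<^bsub>R\<^esub> g v z'" using hom_add_monoidD[OF g[OF v]] z by blast
  next
    fix z v v' assume z: "z \<in> carrier P" and v: "v \<in> carrier V" "v' \<in> carrier V"
    note D = hom_add_monoidD[OF g[OF v(1)]] hom_add_monoidD[OF g[OF v(2)]]
    \<comment> \<open>The maps \<open>g v\<close> were chosen separately for each \<open>v\<close>,
      so additivity in \<open>v\<close> needs proof. Both sides are homomorphisms in
      \<open>z\<close> and have to be compared only on \<open>p1 x y\<close>.\<close>
    have "(\<lambda>z. g v z \<oplus>\<^bsub>R\<^esub> g v' z) \<in> hom (add_monoid P) (add_monoid R)"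
      using D by (intro hom_add_monoidI) (simp_all add: MQ.T.a_ac)
    note eqI = MN.p_hom_eqI[OF g this _ z]
    show "g (v \<oplus>\<^bsub>V\<^esub> v') z = g v z \<oplus>\<^bsub>R\<^esub> g v' z"
      by (rule eqI) (use v in \<open>simp_all add: gp NV.p_simps MQ.p_simps\<close>)
  qed
  from PV.p_universal[OF MQ.T.abelian_group_axioms this] obtain h
    where "h \<in> hom (add_monoid L) (add_monoid R)" "h \<in> extensional (carrier L)"
      "\<forall>z\<in>carrier P. \<forall>v\<in>carrier V. h (p2 z v) = g v z"
    by blast
  then show ?thesis by (intro bexI[of _ h]) (simp_all add: gp MN.p_simps)
qed

lemma assoc_backward:
  "\<exists>h\<in>hom (add_monoid R) (add_monoid L). h \<in> extensional (carrier R) \<and>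
    (\<forall>x\<in>carrier M. \<forall>y\<in>carrier N. \<forall>v\<in>carrier V. h (p4 x (p3 y v)) = p2 (p1 x y) v)"
proof -
  have "\<exists>g\<in>hom (add_monoid Q) (add_monoid L).
      \<forall>y\<in>carrier N. \<forall>v\<in>carrier V. g (p3 y v) = p2 (p1 x y) v" if x: "x \<in> carrier M" for x
  proof -
    have "biadditive N V (add_monoid L) (\<lambda>y v. p2 (p1 x y) v)"
      using x by (intro biadditiveI) (simp_all add: MN.p_simps PV.p_simps)
    from NV.p_universal[OF PV.T.abelian_group_axioms this] show ?thesis by blast
  qed
  then obtain g where g: "\<And>x. x \<in> carrier M \<Longrightarrow> g x \<in> hom (add_monoid Q) (add_monoid L)"
    and gp: "\<And>x y v. \<lbrakk>x \<in> carrier M; y \<in> carrier N; v \<in> carrier V\<rbrakk> \<Longrightarrow> g x (p3 y v) = p2 (p1 x y) v"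
    by metis
  have "biadditive M Q (add_monoid L) g"
  proof (rule biadditiveI; simp only: monoid.simps partial_object.simps)
    fix x z assume x: "x \<in> carrier M" and z: "z \<in> carrier Q"
    show "g x z \<in> carrier L" using hom_add_monoidD[OF g[OF x]] z by blast
  next
    fix x z z' assume x: "x \<in> carrier M" and z: "z \<in> carrier Q" "z' \<in> carrier Q"
    show "g x (z \<oplus>\<^bsub>Q\<^esub> z') = g x z \<oplus>\<^bsub>L\<^esub> g x z'" using hom_add_monoidD[OF g[OF x]] z by blast
  next
    fix x x' z assume x: "x \<in> carrier M" "x' \<in> carrier M" and z: "z \<in> carrier Q"
    note D = hom_add_monoidD[OF g[OF x(1)]] hom_add_monoidD[OF g[OF x(2)]]
    have "(\<lambda>z. g x z \<oplus>\<^bsub>L\<^esub> g x' z) \<in> hom (add_monoid Q) (add_monoid L)"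
      using D by (intro hom_add_monoidI) (simp_all add: PV.T.a_ac)
    note eqI = NV.p_hom_eqI[OF g this _ z]
    show "g (x \<oplus>\<^bsub>M\<^esub> x') z = g x z \<oplus>\<^bsub>L\<^esub> g x' z"
      by (rule eqI) (use x in \<open>simp_all add: gp MN.p_simps PV.p_simps\<close>)
  qed
  from MQ.p_universal[OF PV.T.abelian_group_axioms this] obtain h
    where "h \<in> hom (add_monoid R) (add_monoid L)" "h \<in> extensional (carrier R)"
      "\<forall>x\<in>carrier M. \<forall>z\<in>carrier Q. h (p4 x z) = g x z"
    by blast
  then show ?thesis by (intro bexI[of _ h]) (simp_all add: gp NV.p_simps)
qed

lemma left_triple_induct [consumes 1, case_names pure add]:
  assumes z: "z \<in> carrier L"
    and pure: "\<And>x y v. \<lbrakk>x \<in> carrier M; y \<in> carrier N; v \<in> carrier V\<rbrakk> \<Longrightarrow> S (p2 (p1 x y) v)"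
    and add: "\<And>u v. \<lbrakk>u \<in> carrier L; v \<in> carrier L; S u; S v\<rbrakk> \<Longrightarrow> S (u \<oplus>\<^bsub>L\<^esub> v)"
  shows "S z"
  using z
proof (induction rule: PV.p_induct)
  case p: (pure w v)
  then show ?case
    by (induction rule: MN.p_induct) (simp_all add: pure PV.p_simps add)
qed (rule add)

lemma right_triple_induct [consumes 1, case_names pure add]:
  assumes z: "z \<in> carrier R"
    and pure: "\<And>x y v. \<lbrakk>x \<in> carrier M; y \<in> carrier N; v \<in> carrier V\<rbrakk> \<Longrightarrow> S (p4 x (p3 y v))"
    and add: "\<And>u v. \<lbrakk>u \<in> carrier R; v \<in> carrier R; S u; S v\<rbrakk> \<Longrightarrow> S (u \<oplus>\<^bsub>R\<^esub> v)"
  shows "S z"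
  using z
proof (induction rule: MQ.p_induct)
  case p: (pure x w)
  from p(2,1) show ?case
    by (induction rule: NV.p_induct) (simp_all add: pure MQ.p_simps add)
qed (rule add)

text \<open>The two lifts undo each other on triple pure tensors, and these generate either side
  additively.\<close>

lemma assoc_iso:
  obtains h k where "h \<in> hom (add_monoid L) (add_monoid R)" "h \<in> extensional (carrier L)"
    "k \<in> hom (add_monoid R) (add_monoid L)" "k \<in> extensional (carrier R)"
    "\<forall>x\<in>carrier M. \<forall>y\<in>carrier N. \<forall>v\<in>carrier V. h (p2 (p1 x y) v) = p4 x (p3 y v)"
    "\<forall>z\<in>carrier L. k (h z) = z" "\<forall>z\<in>carrier R. h (k z) = z"
proof -
  obtain h where h: "h \<in> hom (add_monoid L) (add_monoid R)" "h \<in> extensional (carrier L)"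
    and hp: "\<And>x y v. \<lbrakk>x \<in> carrier M; y \<in> carrier N; v \<in> carrier V\<rbrakk> \<Longrightarrow> h (p2 (p1 x y) v) = p4 x (p3 y v)"
    using assoc_forward by blast
  obtain k where k: "k \<in> hom (add_monoid R) (add_monoid L)" "k \<in> extensional (carrier R)"
    and kp: "\<And>x y v. \<lbrakk>x \<in> carrier M; y \<in> carrier N; v \<in> carrier V\<rbrakk> \<Longrightarrow> k (p4 x (p3 y v)) = p2 (p1 x y) v"
    using assoc_backward by blast
  note simps = hom_add_monoidD[OF h(1)] hom_add_monoidD[OF k(1)] hp kp
  have "k (h z) = z" if "z \<in> carrier L" for z
    using that by (induction rule: left_triple_induct) (simp_all add: simps)
  moreover have "h (k z) = z" if "z \<in> carrier R" for z
    using that by (induction rule: right_triple_induct) (simp_all add: simps)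
  ultimately show thesis using that h k hp by blast
qed

end

section \<open>The functors \<open>F\<^sub>M\<close>\<close>

text \<open>Restricting scalars changes only the action. The universal property and the induction
  principle thus pass from the copy to \<open>Hq_tensor\<close> and \<open>HS_tensor\<close>, for
  which the associativity argument is needed.\<close>

lemma (in copy_pair) copy_tensor_like:
  assumes T: "carrier T = carrier TC" "add T = add TC" "\<zero>\<^bsub>T\<^esub> = \<zero>\<^bsub>TC\<^esub>" "abelian_group T"
  shows "tensor_like M N T elt"
proof -
  interpret T: abelian_group T by fact
  have hom: "hom (add_monoid T) G = hom (add_monoid TC) G" for G :: "'u monoid"
    by (simp add: hom_def T)
  show ?thesis
  proof
    show "biadditive M N (add_monoid T) elt"
      by (rule biadditiveI) (simp_all add: T elt_add_left elt_add_right)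
  next
    fix z Q assume "z \<in> carrier T" "\<And>x y. \<lbrakk>x \<in> carrier M; y \<in> carrier N\<rbrakk> \<Longrightarrow> Q (elt x y)"
      "\<And>u v. \<lbrakk>u \<in> carrier T; v \<in> carrier T; Q u; Q v\<rbrakk> \<Longrightarrow> Q (u \<oplus>\<^bsub>T\<^esub> v)"
    then show "Q z" unfolding T by (rule copy_induct)
  next
    fix G :: "'u monoid" and f assume "comm_group G" "biadditive M N G f"
    from copy_universal[OF this, folded hom, folded T(1)] show "\<exists>h\<in>hom (add_monoid T) G. h \<in> extensional (carrier T) \<and>
        (\<forall>x\<in>carrier M. \<forall>y\<in>carrier N. h (elt x y) = f x y)"
      .
  qed
qed

locale hs_hecke_modules = M: left_module "HS n" M + V: left_module "Hq n" V
  for n and M :: "(hs, 'u::infinite) module" and V :: "(hecke, 'u) module"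
begin

sublocale copy_pair "HS n" "Hq n" M V
  by (intro copy_pair.intro module_pair.intro M.left_module_axioms V.left_module_axioms)

lemma Hq_tensor_simps:
  "carrier (Hq_tensor n M V) = carrier TC" "add (Hq_tensor n M V) = add TC"
  "\<zero>\<^bsub>Hq_tensor n M V\<^esub> = \<zero>\<^bsub>TC\<^esub>" "a \<odot>\<^bsub>Hq_tensor n M V\<^esub> z = Hq_coaction n a \<odot>\<^bsub>TC\<^esub> z"
  by (simp_all add: Hq_tensor_def)

lemma Hq_tensor_left_module: "left_module (Hq n) (Hq_tensor n M V)"
  unfolding Hq_tensor_def
  by (rule left_module_restrict_scalars[OF V.R.ring_axioms Hq_coaction_hom tensor_copy_left_module])

sublocale FV: left_module "Hq n" "Hq_tensor n M V" by (rule Hq_tensor_left_module)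

sublocale FV: tensor_like M V "Hq_tensor n M V" elt
  by (rule copy_tensor_like) (simp_all only: Hq_tensor_simps FV.M.abelian_group_axioms)

lemma Hq_tensor_scalar:
  "\<lbrakk>x \<in> carrier M; v \<in> carrier V; Hq_scalar n c \<in> carrier (Hq n)\<rbrakk> \<Longrightarrow>
    Hq_scalar n c \<odot>\<^bsub>Hq_tensor n M V\<^esub> elt x v = elt x (Hq_scalar n c \<odot>\<^bsub>V\<^esub> v)"
  by (simp add: Hq_tensor_simps Hq_coaction_scalar M.smult_one)

lemma Hq_tensor_T:
  assumes x: "x \<in> carrier M" and v: "v \<in> carrier V" and i: "i \<in> {1..n-1}"
  shows "Hq_T n i \<odot>\<^bsub>Hq_tensor n M V\<^esub> elt x v =
      elt (HS_s n i \<odot>\<^bsub>M\<^esub> x) (Hq_T n i \<odot>\<^bsub>V\<^esub> v)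
    \<oplus>\<^bsub>Hq_tensor n M V\<^esub> elt (HS_D n i \<odot>\<^bsub>M\<^esub> x) (Hq_scalar n (1 - q_var) \<odot>\<^bsub>V\<^esub> v)"
proof -
  interpret H: hs_family "HS n" "{1..n-1}" "HS_s n" "HS_D n" by (rule HS_hs_family)
  interpret K: hecke_family "Hq n" "{1..n-1}" "Hq_T n" "Hq_scalar n (1 - q_var)" "Hq_scalar n q_var"
    by (rule Hq_hecke_family)
  note closed = H.s_closed[OF i] H.D_closed[OF i] K.T_closed[OF i] K.c_closed
  show ?thesis
    unfolding Hq_tensor_simps Hq_coaction_T[OF i] using x v closed
    by (simp add: TC.smult_l_distr)
qed

end

locale hs_modules = M: left_module "HS n" M + N: left_module "HS n" N
  for n and M N :: "(hs, 'u::infinite) module"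
begin

sublocale copy_pair "HS n" "HS n" M N
  by (intro copy_pair.intro module_pair.intro M.left_module_axioms N.left_module_axioms)

lemma HS_tensor_simps:
  "carrier (HS_tensor n M N) = carrier TC" "add (HS_tensor n M N) = add TC"
  "\<zero>\<^bsub>HS_tensor n M N\<^esub> = \<zero>\<^bsub>TC\<^esub>" "a \<odot>\<^bsub>HS_tensor n M N\<^esub> z = HS_comult n a \<odot>\<^bsub>TC\<^esub> z"
  by (simp_all add: HS_tensor_def)

lemma HS_tensor_left_module: "left_module (HS n) (HS_tensor n M N)"
  unfolding HS_tensor_def
  by (rule left_module_restrict_scalars[OF M.R.ring_axioms HS_comult_hom tensor_copy_left_module])

sublocale MN': left_module "HS n" "HS_tensor n M N" by (rule HS_tensor_left_module)

sublocale MN': tensor_like M N "HS_tensor n M N" elt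
  by (rule copy_tensor_like) (simp_all only: HS_tensor_simps MN'.M.abelian_group_axioms)

lemma HS_tensor_act:
  assumes x: "x \<in> carrier M" and y: "y \<in> carrier N" and i: "i \<in> {1..n-1}"
  shows "HS_s n i \<odot>\<^bsub>HS_tensor n M N\<^esub> elt x y = elt (HS_s n i \<odot>\<^bsub>M\<^esub> x) (HS_s n i \<odot>\<^bsub>N\<^esub> y)"
    and "HS_D n i \<odot>\<^bsub>HS_tensor n M N\<^esub> elt x y = elt (HS_D n i \<odot>\<^bsub>M\<^esub> x) y
      \<oplus>\<^bsub>HS_tensor n M N\<^esub> elt (HS_s n i \<odot>\<^bsub>M\<^esub> x) (HS_D n i \<odot>\<^bsub>N\<^esub> y)"
proof -
  interpret H: hs_family "HS n" "{1..n-1}" "HS_s n" "HS_D n" by (rule HS_hs_family)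
  note closed = H.s_closed[OF i] H.D_closed[OF i]
  show "HS_s n i \<odot>\<^bsub>HS_tensor n M N\<^esub> elt x y = elt (HS_s n i \<odot>\<^bsub>M\<^esub> x) (HS_s n i \<odot>\<^bsub>N\<^esub> y)"
    unfolding HS_tensor_simps HS_comult_s[OF i] using x y closed by simp
  show "HS_D n i \<odot>\<^bsub>HS_tensor n M N\<^esub> elt x y = elt (HS_D n i \<odot>\<^bsub>M\<^esub> x) y
      \<oplus>\<^bsub>HS_tensor n M N\<^esub> elt (HS_s n i \<odot>\<^bsub>M\<^esub> x) (HS_D n i \<odot>\<^bsub>N\<^esub> y)"
    unfolding HS_tensor_simps HS_comult_D[OF i] using x y closed
    by (simp add: TC.smult_l_distr N.smult_one)
qed

end

section \<open>Categories of modules and homomorphisms\<close>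

lemma module_homsI:
  assumes "f \<in> hom (add_monoid M) (add_monoid N)" "f \<in> extensional (carrier M)"
    and "\<And>a x. \<lbrakk>a \<in> carrier R; x \<in> carrier M\<rbrakk> \<Longrightarrow> f (a \<odot>\<^bsub>M\<^esub> x) = a \<odot>\<^bsub>N\<^esub> f x"
  shows "f \<in> module_homs R M N"
  using hom_add_monoidD[OF assms(1)] assms(2,3) by (simp add: module_homs_def PiE_def)

lemma module_homsD:
  assumes "f \<in> module_homs R M N"
  shows "f \<in> hom (add_monoid M) (add_monoid N)" "f \<in> extensional (carrier M)"
    and "x \<in> carrier M \<Longrightarrow> f x \<in> carrier N"
    and "\<lbrakk>x \<in> carrier M; y \<in> carrier M\<rbrakk> \<Longrightarrow> f (x \<oplus>\<^bsub>M\<^esub> y) = f x \<oplus>\<^bsub>N\<^esub> f y"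
    and "\<lbrakk>a \<in> carrier R; x \<in> carrier M\<rbrakk> \<Longrightarrow> f (a \<odot>\<^bsub>M\<^esub> x) = a \<odot>\<^bsub>N\<^esub> f x"
  using assms by (auto simp: module_homs_def hom_def PiE_iff)

lemma id_module_homs:
  assumes "left_module R M"
  shows "(\<lambda>x\<in>carrier M. x) \<in> module_homs R M M"
proof -
  interpret left_module R M by fact
  show ?thesis by (simp add: module_homs_def smult_closed)
qed

lemma compose_module_homs:
  assumes "left_module R L" "f \<in> module_homs R L M" "g \<in> module_homs R M N"
  shows "compose (carrier L) g f \<in> module_homs R L N"
proof -
  interpret left_module R L by fact
  note D = module_homsD(3-5)[OF assms(2)] module_homsD(3-5)[OF assms(3)]
  show ?thesis
    by (rule module_homsI)
      (simp_all add: hom_def compose_eq compose_extensional D smult_closed)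
qed

lemma Mod_cat_simps [simp]:
  "V \<in> Obj (Mod_cat R) \<longleftrightarrow> left_module R V" "Hom (Mod_cat R) = module_homs R"
  "Id (Mod_cat R) V = (\<lambda>x\<in>carrier V. x)" "Comp (Mod_cat R) U V W g f = compose (carrier U) g f"
  by (simp_all add: Mod_cat_def)

text \<open>Composites are computed on the carrier only; the category laws become equalities of
  functions because homomorphisms are extensional.\<close>

lemma category_Mod_cat: "category (Mod_cat R)"
proof (unfold_locales, unfold Mod_cat_simps)
  fix V W f assume f: "f \<in> module_homs R V W"
  note D = module_homsD(2,3)[OF f]
  show "compose (carrier V) (\<lambda>x\<in>carrier W. x) f = f"
    "compose (carrier V) f (\<lambda>x\<in>carrier V. x) = f"
    by (rule extensionalityI[of _ "carrier V"]; simp add: D compose_eq compose_extensional)+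
next
  fix U V W X f g h
  assume "f \<in> module_homs R U V"
  then show "compose (carrier U) h (compose (carrier U) g f) = compose (carrier U) (compose (carrier V) h g) f"
    by (auto simp: compose_def restrict_def fun_eq_iff dest: module_homsD(3))
qed (auto intro: id_module_homs compose_module_homs)

lemma endofunctor_endo_comp:
  assumes "endofunctor C F" "endofunctor C G"
  shows "endofunctor C (endo_comp F G)"
proof -
  interpret F: endofunctor C F by fact
  interpret G: endofunctor C G by fact
  show ?thesis
    by unfold_locales
      (simp_all add: endo_comp_def F.omap_in G.omap_in F.amap_in G.amap_in F.amap_Id G.amap_Id
        F.amap_Comp G.amap_Comp)
qed

lemma Hq_scalar_closed: "Hq_scalar n c \<in> carrier (Hq n)"
proof -
  interpret Hq: presentation "{1..n-1}" "Hq_rels n" by (rule Hq_presentation)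
  show ?thesis
    unfolding Hq_scalar_def Hq_def by (rule Hq.cls_scalar_simps)
qed

lemma Hq_T_closed: "i \<in> {1..n-1} \<Longrightarrow> Hq_T n i \<in> carrier (Hq n)"
  by (rule hecke_family.T_closed[OF Hq_hecke_family])

lemma Hq_module_homsI:
  assumes V: "left_module (Hq n) V" and W: "left_module (Hq n) W"
    and f: "f \<in> hom (add_monoid V) (add_monoid W)" "f \<in> extensional (carrier V)"
    and scalar: "\<And>c x. x \<in> carrier V \<Longrightarrow>
      f (Hq_scalar n c \<odot>\<^bsub>V\<^esub> x) = Hq_scalar n c \<odot>\<^bsub>W\<^esub> f x"
    and T: "\<And>i x. \<lbrakk>i \<in> {1..n-1}; x \<in> carrier V\<rbrakk> \<Longrightarrow>
      f (Hq_T n i \<odot>\<^bsub>V\<^esub> x) = Hq_T n i \<odot>\<^bsub>W\<^esub> f x"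
  shows "f \<in> module_homs (Hq n) V W"
proof (rule module_homsI[OF f])
  interpret V: left_module "Hq n" V by fact
  interpret W: left_module "Hq n" W by fact
  interpret Hq: presentation "{1..n-1}" "Hq_rels n" by (rule Hq_presentation)
  note fD = hom_add_monoidD[OF f(1)]
  fix a x assume "a \<in> carrier (Hq n)" and x: "x \<in> carrier V"
  then have "a \<in> carrier Hq.Q" by (simp add: Hq_def)
  \<comment> \<open>The vector is quantified inside the induction, since for a product
    \<open>X Y\<close> the hypothesis for \<open>X\<close> is applied to \<open>Y x\<close>.\<close>
  then have "\<forall>x\<in>carrier V. f (a \<odot>\<^bsub>V\<^esub> x) = a \<odot>\<^bsub>W\<^esub> f x"
  proof (induction rule: Hq.presented_induct)
    case (scalar c)
    then show ?case using assms(5) by (simp add: Hq_scalar_def)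
  next
    case (gen i)
    then show ?case using T by (simp add: Hq_T_def)
  next
    case (add X Y)
    then have "X \<in> carrier (Hq n)" "Y \<in> carrier (Hq n)" by (simp_all add: Hq_def)
    with add.IH show ?case
      unfolding Hq_def[symmetric] by (simp add: V.smult_l_distr W.smult_l_distr V.smult_closed fD)
  next
    case (mult X Y)
    then have "X \<in> carrier (Hq n)" "Y \<in> carrier (Hq n)" by (simp_all add: Hq_def)
    with mult.IH show ?case
      unfolding Hq_def[symmetric] by (simp add: V.smult_assoc W.smult_assoc V.smult_closed fD)
  qed
  with x show "f (a \<odot>\<^bsub>V\<^esub> x) = a \<odot>\<^bsub>W\<^esub> f x" by blast
qed

text \<open>The map is linear because \<open>T\<^sub>i\<close> acts on \<open>V\<close> inside the
  tensor product only through \<open>T\<^sub>i\<close> and the scalar \<open>1 - q\<close>, and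
  \<open>f\<close> commutes with both.\<close>

lemma F_mor:
  assumes M: "left_module (HS n) M" and V: "left_module (Hq n) V" and W: "left_module (Hq n) W"
    and f: "f \<in> module_homs (Hq n) V W"
  shows F_mor_module_homs: "F_mor n M V W f \<in> module_homs (Hq n) (Hq_tensor n M V) (Hq_tensor n M W)"
    and F_mor_elt: "\<And>x v. \<lbrakk>x \<in> carrier M; v \<in> carrier V\<rbrakk> \<Longrightarrow>
      F_mor n M V W f (tensor_elt M V x v) = tensor_elt M W x (f v)"
proof -
  interpret V: hs_hecke_modules n M V using M V by (rule hs_hecke_modules.intro)
  interpret W: hs_hecke_modules n M W using M W by (rule hs_hecke_modules.intro)
  note fD = module_homsD(3-5)[OF f]
  let ?P = "\<lambda>h. h \<in> hom (add_monoid (Hq_tensor n M V)) (add_monoid (Hq_tensor n M W))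
         \<inter> extensional (carrier (Hq_tensor n M V)) \<and>
     (\<forall>m\<in>carrier M. \<forall>v\<in>carrier V. h (tensor_elt M V m v) = tensor_elt M W m (f v))"
  have "biadditive M V (add_monoid (Hq_tensor n M W)) (\<lambda>m v. tensor_elt M W m (f v))"
    by (rule biadditiveI) (simp_all add: fD W.FV.p_simps)
  from V.FV.p_universal[OF W.FV.M.abelian_group_axioms this] obtain h where h: "?P h"
    by blast
  have "\<exists>!h. ?P h"
  proof (rule ex1I)
    show "?P h" by (rule h)
    fix h' assume h': "?P h'"
    show "h' = h"
      by (rule V.FV.p_ext_hom_eqI[of _ "add_monoid (Hq_tensor n M W)"]) (use h h' in auto)
  qed
  then have "?P (F_mor n M V W f)"
    unfolding F_mor_def by (rule theI')
  then have F: "F_mor n M V W f \<in> hom (add_monoid (Hq_tensor n M V)) (add_monoid (Hq_tensor n M W))"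
      "F_mor n M V W f \<in> extensional (carrier (Hq_tensor n M V))"
    and elt: "\<And>x v. \<lbrakk>x \<in> carrier M; v \<in> carrier V\<rbrakk> \<Longrightarrow>
      F_mor n M V W f (tensor_elt M V x v) = tensor_elt M W x (f v)"
    by auto
  note FD = hom_add_monoidD[OF F(1)]
  interpret H: hs_family "HS n" "{1..n-1}" "HS_s n" "HS_D n" by (rule HS_hs_family)
  show "F_mor n M V W f \<in> module_homs (Hq n) (Hq_tensor n M V) (Hq_tensor n M W)"
  proof (rule Hq_module_homsI[OF V.Hq_tensor_left_module W.Hq_tensor_left_module F])
    fix c z assume "z \<in> carrier (Hq_tensor n M V)"
    then show "F_mor n M V W f (Hq_scalar n c \<odot>\<^bsub>Hq_tensor n M V\<^esub> z)
        = Hq_scalar n c \<odot>\<^bsub>Hq_tensor n M W\<^esub> F_mor n M V W f z"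
    proof (induction rule: V.FV.p_induct)
      case (pure x v)
      then show ?case
        by (simp add: V.Hq_tensor_scalar W.Hq_tensor_scalar Hq_scalar_closed elt fD V.V.smult_closed)
    next
      case (add z z')
      then show ?case
        by (simp add: V.FV.smult_r_distr W.FV.smult_r_distr V.FV.smult_closed Hq_scalar_closed FD)
    qed
  next
    fix i z assume i: "i \<in> {1..n-1}" and "z \<in> carrier (Hq_tensor n M V)"
    note closed = H.s_closed[OF i] H.D_closed[OF i] Hq_T_closed[OF i] Hq_scalar_closed
    from \<open>z \<in> carrier (Hq_tensor n M V)\<close>
    show "F_mor n M V W f (Hq_T n i \<odot>\<^bsub>Hq_tensor n M V\<^esub> z)
        = Hq_T n i \<odot>\<^bsub>Hq_tensor n M W\<^esub> F_mor n M V W f z"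
    proof (induction rule: V.FV.p_induct)
      case (pure x v)
      then show ?case
        by (simp only: V.Hq_tensor_T[OF _ _ i] W.Hq_tensor_T[OF _ _ i] elt fD V.V.smult_closed
            V.M.smult_closed FD V.FV.p_simps closed)
    next
      case (add z z')
      then show ?case
        by (simp add: V.FV.smult_r_distr W.FV.smult_r_distr V.FV.smult_closed closed FD)
    qed
  qed
  show "\<And>x v. \<lbrakk>x \<in> carrier M; v \<in> carrier V\<rbrakk> \<Longrightarrow>
      F_mor n M V W f (tensor_elt M V x v) = tensor_elt M W x (f v)"
    by (rule elt)
qed

lemma F_endo_simps [simp]: "omap (F_endo n M) = Hq_tensor n M" "amap (F_endo n M) = F_mor n M"
  by (simp_all add: F_endo_def)

text \<open>Each functor law equates two extensional additive maps out of
  \<open>M \<otimes> V\<close>, so it is decided on pure tensors, where it is the corresponding law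
  in the second factor.\<close>

lemma F_endo_endofunctor:
  assumes M: "left_module (HS n) (M :: (hs, 'u::infinite) module)"
  shows "endofunctor (Mod_cat (Hq n)) (F_endo n M)"
proof (rule endofunctor.intro[OF category_Mod_cat], unfold_locales, unfold Mod_cat_simps F_endo_simps)
  fix V :: "(hecke, 'u) module" assume V: "left_module (Hq n) V"
  interpret V: hs_hecke_modules n M V using M V by (rule hs_hecke_modules.intro)
  show "left_module (Hq n) (Hq_tensor n M V)" by (rule V.Hq_tensor_left_module)
  note id = id_module_homs[OF V]
  note id' = id_module_homs[OF V.Hq_tensor_left_module]
  note F = F_mor_module_homs[OF M V V id]
  show "F_mor n M V V (\<lambda>x\<in>carrier V. x) = (\<lambda>x\<in>carrier (Hq_tensor n M V). x)"
    by (rule V.FV.p_ext_hom_eqI[OF module_homsD(1)[OF F] module_homsD(1)[OF id']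
          module_homsD(2)[OF F] module_homsD(2)[OF id']])
      (simp add: F_mor_elt[OF M V V id] V.FV.p_simps)
  fix W :: "(hecke, 'u) module" and f assume W: "left_module (Hq n) W" and f: "f \<in> module_homs (Hq n) V W"
  interpret W: hs_hecke_modules n M W using M W by (rule hs_hecke_modules.intro)
  note Ff = F_mor_module_homs[OF M V W f]
  show "F_mor n M V W f \<in> module_homs (Hq n) (Hq_tensor n M V) (Hq_tensor n M W)" by (rule Ff)
  fix X :: "(hecke, 'u) module" and g assume X: "left_module (Hq n) X" and g: "g \<in> module_homs (Hq n) W X"
  note Fg = F_mor_module_homs[OF M W X g]
  note gf = compose_module_homs[OF V f g]
  note Fgf = F_mor_module_homs[OF M V X gf]
  note FgFf = compose_module_homs[OF V.Hq_tensor_left_module Ff Fg]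
  show "F_mor n M V X (compose (carrier V) g f)
      = compose (carrier (Hq_tensor n M V)) (F_mor n M W X g) (F_mor n M V W f)"
    by (rule V.FV.p_ext_hom_eqI[OF module_homsD(1)[OF Fgf] module_homsD(1)[OF FgFf]
          module_homsD(2)[OF Fgf] module_homsD(2)[OF FgFf]])
      (simp add: F_mor_elt[OF M V X gf] F_mor_elt[OF M V W f] F_mor_elt[OF M W X g]
        V.FV.p_simps compose_eq module_homsD(3)[OF f])
qed

section \<open>The associator as a module isomorphism\<close>

locale hs_hs_hecke_modules = M: left_module "HS n" M + N: left_module "HS n" N + V: left_module "Hq n" V
  for n and M N :: "(hs, 'u::infinite) module" and V :: "(hecke, 'u) module"
begin

sublocale MN: hs_modules n M N
  by (intro hs_modules.intro M.left_module_axioms N.left_module_axioms)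
sublocale NV: hs_hecke_modules n N V
  by (intro hs_hecke_modules.intro N.left_module_axioms V.left_module_axioms)
sublocale PV: hs_hecke_modules n "HS_tensor n M N" V
  by (intro hs_hecke_modules.intro MN.HS_tensor_left_module V.left_module_axioms)
sublocale MQ: hs_hecke_modules n M "Hq_tensor n N V"
  by (intro hs_hecke_modules.intro M.left_module_axioms NV.Hq_tensor_left_module)

abbreviation "L \<equiv> Hq_tensor n (HS_tensor n M N) V"
abbreviation "R \<equiv> Hq_tensor n M (Hq_tensor n N V)"
abbreviation "eltL x y v \<equiv> tensor_elt (HS_tensor n M N) V (tensor_elt M N x y) v"
abbreviation "eltR x y v \<equiv> tensor_elt M (Hq_tensor n N V) x (tensor_elt N V y v)"

sublocale assoc: tensor_assoc M N V "HS_tensor n M N" "Hq_tensor n N V" L R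
    "tensor_elt M N" "tensor_elt (HS_tensor n M N) V" "tensor_elt N V" "tensor_elt M (Hq_tensor n N V)"
  by (intro tensor_assoc.intro MN.MN'.tensor_like_axioms PV.FV.tensor_like_axioms
      NV.FV.tensor_like_axioms MQ.FV.tensor_like_axioms)

lemma associator:
  "\<exists>h\<in>module_homs (Hq n) L R. \<exists>k\<in>module_homs (Hq n) R L.
    (\<forall>x\<in>carrier M. \<forall>y\<in>carrier N. \<forall>v\<in>carrier V. h (eltL x y v) = eltR x y v) \<and>
    compose (carrier L) k h = (\<lambda>z\<in>carrier L. z) \<and> compose (carrier R) h k = (\<lambda>z\<in>carrier R. z)"
proof -
  obtain h k where h: "h \<in> hom (add_monoid L) (add_monoid R)" "h \<in> extensional (carrier L)"
    and k: "k \<in> hom (add_monoid R) (add_monoid L)" "k \<in> extensional (carrier R)"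
    and elt: "\<forall>x\<in>carrier M. \<forall>y\<in>carrier N. \<forall>v\<in>carrier V. h (eltL x y v) = eltR x y v"
    and kh: "\<forall>z\<in>carrier L. k (h z) = z" and hk: "\<forall>z\<in>carrier R. h (k z) = z"
    by (rule assoc.assoc_iso)
  note hD = hom_add_monoidD[OF h(1)] and kD = hom_add_monoidD[OF k(1)]
  interpret H: hs_family "HS n" "{1..n-1}" "HS_s n" "HS_D n" by (rule HS_hs_family)
  have hlin: "h \<in> module_homs (Hq n) L R"
  proof (rule Hq_module_homsI[OF PV.Hq_tensor_left_module MQ.Hq_tensor_left_module h])
    fix c z assume "z \<in> carrier L"
    then show "h (Hq_scalar n c \<odot>\<^bsub>L\<^esub> z) = Hq_scalar n c \<odot>\<^bsub>R\<^esub> h z"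
    proof (induction rule: assoc.left_triple_induct)
      case (pure x y v)
      then show ?case
        by (simp only: PV.Hq_tensor_scalar MQ.Hq_tensor_scalar NV.Hq_tensor_scalar Hq_scalar_closed
            elt V.smult_closed MN.MN'.p_simps NV.FV.p_simps)
    next
      case (add z z')
      then show ?case
        by (simp add: PV.FV.smult_r_distr MQ.FV.smult_r_distr PV.FV.smult_closed Hq_scalar_closed hD)
    qed
  next
    fix i z assume i: "i \<in> {1..n-1}" and "z \<in> carrier L"
    note closed = H.s_closed[OF i] H.D_closed[OF i] Hq_T_closed[OF i] Hq_scalar_closed
    from \<open>z \<in> carrier L\<close>
    show "h (Hq_T n i \<odot>\<^bsub>L\<^esub> z) = Hq_T n i \<odot>\<^bsub>R\<^esub> h z"
    proof (induction rule: assoc.left_triple_induct)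
      case (pure x y v)
      let ?c = "Hq_scalar n (1 - q_var)"
      let ?s = "HS_s n i" and ?D = "HS_D n i" and ?T = "Hq_T n i"
      \<comment> \<open>On this side the coaction is applied once, and the comultiplication then
        distributes \<open>s\<^sub>i\<close> and \<open>D\<^sub>i\<close> over \<open>x\<close> and
        \<open>y\<close>.\<close>
      have "h (?T \<odot>\<^bsub>L\<^esub> eltL x y v) = eltR (?s \<odot>\<^bsub>M\<^esub> x) (?s \<odot>\<^bsub>N\<^esub> y) (?T \<odot>\<^bsub>V\<^esub> v)
          \<oplus>\<^bsub>R\<^esub> (eltR (?D \<odot>\<^bsub>M\<^esub> x) y (?c \<odot>\<^bsub>V\<^esub> v) \<oplus>\<^bsub>R\<^esub> eltR (?s \<odot>\<^bsub>M\<^esub> x) (?D \<odot>\<^bsub>N\<^esub> y) (?c \<odot>\<^bsub>V\<^esub> v))"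
        using pure
        by (simp only: PV.Hq_tensor_T[OF _ _ i] MN.HS_tensor_act[OF _ _ i] elt hD closed
            V.smult_closed M.smult_closed N.smult_closed MN.MN'.p_simps PV.FV.p_simps PV.FV.M.add.m_closed)
      \<comment> \<open>On this side the coaction is applied twice: \<open>T\<^sub>i\<close> acts
        again on \<open>y \<otimes> v\<close>, while the scalar \<open>1 - q\<close> passes over
        \<open>y\<close> directly to \<open>v\<close>.\<close>
      also have "\<dots> = ?T \<odot>\<^bsub>R\<^esub> eltR x y v"
        using pure
        by (simp add: MQ.Hq_tensor_T[OF _ _ i] NV.Hq_tensor_T[OF _ _ i] NV.Hq_tensor_scalar closed
            V.smult_closed M.smult_closed N.smult_closed NV.FV.p_simps MQ.FV.p_simps MQ.FV.M.a_ac)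
      finally show ?case using pure elt by simp
    next
      case (add z z')
      then show ?case
        by (simp add: PV.FV.smult_r_distr MQ.FV.smult_r_distr PV.FV.smult_closed closed hD)
    qed
  qed
  \<comment> \<open>As the inverse of a linear bijection, \<open>k\<close> is linear; no second
    computation with generators is required.\<close>
  have klin: "k \<in> module_homs (Hq n) R L"
  proof (rule module_homsI[OF k])
    fix a z assume a: "a \<in> carrier (Hq n)" and z: "z \<in> carrier R"
    have "k (a \<odot>\<^bsub>R\<^esub> z) = k (a \<odot>\<^bsub>R\<^esub> h (k z))" using z hk by simp
    also have "\<dots> = k (h (a \<odot>\<^bsub>L\<^esub> k z))" using a z kD module_homsD(5)[OF hlin] by simp
    also have "\<dots> = a \<odot>\<^bsub>L\<^esub> k z" using a z kD kh PV.FV.smult_closed by simp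
    finally show "k (a \<odot>\<^bsub>R\<^esub> z) = a \<odot>\<^bsub>L\<^esub> k z" .
  qed
  have "compose (carrier L) k h = (\<lambda>z\<in>carrier L. z)" "compose (carrier R) h k = (\<lambda>z\<in>carrier R. z)"
    using kh hk by (auto simp: compose_def)
  then show ?thesis using hlin klin elt by blast
qed

end

text \<open>Naturality compares additive maps out of \<open>(M \<otimes> N) \<otimes> V\<close>. On
  \<open>(x \<otimes> y) \<otimes> v\<close> both give \<open>x \<otimes> (y \<otimes> f v)\<close>,
  since the functors change only the last factor and the associator only the bracketing.\<close>

lemma F_endo_tensor_natural_isomorphism:
  fixes M N :: "(hs, 'u::infinite) module"
  assumes M: "left_module (HS n) M" and N: "left_module (HS n) N"
  shows "\<exists>\<alpha>. natural_isomorphism (Mod_cat (Hq n))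
        (F_endo n (HS_tensor n M N)) (endo_comp (F_endo n M) (F_endo n N)) \<alpha> \<and>
      (\<forall>V. left_module (Hq n) V \<longrightarrow>
        (\<forall>x\<in>carrier M. \<forall>y\<in>carrier N. \<forall>v\<in>carrier V.
           \<alpha> V (tensor_elt (HS_tensor n M N) V (tensor_elt M N x y) v)
           = tensor_elt M (Hq_tensor n N V) x (tensor_elt N V y v)))"
proof -
  let ?P = "HS_tensor n M N"
  let ?L = "\<lambda>V. Hq_tensor n ?P V" and ?R = "\<lambda>V. Hq_tensor n M (Hq_tensor n N V)"
  interpret MN: hs_modules n M N using M N by (rule hs_modules.intro)
  note P = MN.HS_tensor_left_module
  have loc: "hs_hs_hecke_modules n M N V" if "left_module (Hq n) V" for V
    using M N that by (rule hs_hs_hecke_modules.intro)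
  \<comment> \<open>The condition on \<open>V\<close> stands under the existential quantifier so
    that \<open>choice\<close> applies to all records at once; where \<open>V\<close> is not a
    module the component is arbitrary.\<close>
  have "\<forall>V. \<exists>h. left_module (Hq n) V \<longrightarrow> h \<in> module_homs (Hq n) (?L V) (?R V) \<and>
    (\<exists>k\<in>module_homs (Hq n) (?R V) (?L V).
      compose (carrier (?L V)) k h = (\<lambda>z\<in>carrier (?L V). z) \<and>
      compose (carrier (?R V)) h k = (\<lambda>z\<in>carrier (?R V). z)) \<and>
    (\<forall>x\<in>carrier M. \<forall>y\<in>carrier N. \<forall>v\<in>carrier V.
      h (tensor_elt ?P V (tensor_elt M N x y) v) = tensor_elt M (Hq_tensor n N V) x (tensor_elt N V y v))"
    using hs_hs_hecke_modules.associator[OF loc] by blast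
  from choice[OF this] obtain \<alpha> where \<alpha>: "\<And>V. left_module (Hq n) V \<Longrightarrow> \<alpha> V \<in> module_homs (Hq n) (?L V) (?R V)"
    and iso: "\<And>V. left_module (Hq n) V \<Longrightarrow> \<exists>k\<in>module_homs (Hq n) (?R V) (?L V).
      compose (carrier (?L V)) k (\<alpha> V) = (\<lambda>z\<in>carrier (?L V). z) \<and>
      compose (carrier (?R V)) (\<alpha> V) k = (\<lambda>z\<in>carrier (?R V). z)"
    and elt: "\<And>V x y v. \<lbrakk>left_module (Hq n) V; x \<in> carrier M; y \<in> carrier N; v \<in> carrier V\<rbrakk> \<Longrightarrow>
      \<alpha> V (tensor_elt ?P V (tensor_elt M N x y) v) = tensor_elt M (Hq_tensor n N V) x (tensor_elt N V y v)"
    by blast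
  have "natural_isomorphism (Mod_cat (Hq n)) (F_endo n ?P) (endo_comp (F_endo n M) (F_endo n N)) \<alpha>"
  proof (rule natural_isomorphism.intro[OF F_endo_endofunctor[OF P]
        endofunctor_endo_comp[OF F_endo_endofunctor[OF M] F_endo_endofunctor[OF N]]],
      rule natural_isomorphism_axioms.intro; simp only: Mod_cat_simps endo_comp_def endo.simps F_endo_simps)
    fix V W :: "(hecke, 'u) module" and f
    assume V: "left_module (Hq n) V" and W: "left_module (Hq n) W" and f: "f \<in> module_homs (Hq n) V W"
    interpret V: hs_hs_hecke_modules n M N V by (rule loc[OF V])
    interpret W: hs_hs_hecke_modules n M N W by (rule loc[OF W])
    note FN = F_mor_module_homs[OF N V W f]
    note FM = F_mor_module_homs[OF M V.NV.Hq_tensor_left_module W.NV.Hq_tensor_left_module FN]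
    note FP = F_mor_module_homs[OF P V W f]
    note left = compose_module_homs[OF V.PV.Hq_tensor_left_module \<alpha>[OF V] FM]
    note right = compose_module_homs[OF V.PV.Hq_tensor_left_module FP \<alpha>[OF W]]
    show "compose (carrier (?L V)) (F_mor n M (Hq_tensor n N V) (Hq_tensor n N W) (F_mor n N V W f)) (\<alpha> V)
        = compose (carrier (?L V)) (\<alpha> W) (F_mor n ?P V W f)" (is "?l = ?r")
    proof (rule extensionalityI[OF module_homsD(2)[OF left] module_homsD(2)[OF right]])
      fix z assume "z \<in> carrier (?L V)"
      then show "?l z = ?r z"
      proof (induction rule: V.assoc.left_triple_induct)
        case (pure x y v)
        then show ?case
          by (simp add: compose_eq MN.MN'.p_simps V.PV.FV.p_simps V.NV.FV.p_simps elt[OF V] elt[OF W]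
              F_mor_elt[OF N V W f] F_mor_elt[OF P V W f] module_homsD(3)[OF f]
              F_mor_elt[OF M V.NV.Hq_tensor_left_module W.NV.Hq_tensor_left_module FN])
      next
        case (add z z')
        then show ?case by (simp only: module_homsD(4)[OF left] module_homsD(4)[OF right])
      qed
    qed
  qed (use \<alpha> iso in blast)+
  then show ?thesis using elt by blast
qed

text \<open>The canonical identification is expressed by the values of \<open>\<alpha>\<close> on
  triple pure tensors. These generate \<open>(M \<otimes> N) \<otimes> V\<close> additively, so the
  prescribed values determine every component at a module \<open>V\<close>, and no other natural
  isomorphism can satisfy the condition.\<close>

theorem corollary1p11:
  fixes n :: nat
  assumes "n \<ge> 2"
  shows "(\<forall>M :: (hs, 'u::infinite) module. left_module (HS n) M \<longrightarrow>
            endofunctor (Mod_cat (Hq n)) (F_endo n M))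
       \<and> (\<forall>(M :: (hs, 'u) module) (N :: (hs, 'u) module).
            left_module (HS n) M \<longrightarrow> left_module (HS n) N \<longrightarrow>
            left_module (HS n) (HS_tensor n M N) \<and>
            (\<exists>\<alpha>. natural_isomorphism (Mod_cat (Hq n))
                    (F_endo n (HS_tensor n M N)) (endo_comp (F_endo n M) (F_endo n N)) \<alpha> \<and>
                 (\<forall>V :: (hecke, 'u) module. left_module (Hq n) V \<longrightarrow>
                    (\<forall>x\<in>carrier M. \<forall>y\<in>carrier N. \<forall>v\<in>carrier V.
                       \<alpha> V (tensor_elt (HS_tensor n M N) V (tensor_elt M N x y) v)
                       = tensor_elt M (Hq_tensor n N V) x (tensor_elt N V y v)))))"
  by (intro conjI allI impI F_endo_endofunctor F_endo_tensor_natural_isomorphism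
      hs_modules.HS_tensor_left_module hs_modules.intro)

end
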